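(* Let $p\in LH_0(\mathbb{R}^d)\cap\mathcal{P}_{\gamma_d}^\infty(\mathbb{R}^d)$ with $p^->1$. Then there exists a constant $K>0$ such that $$\|\mathcal{M}_{\gamma_d}f\|_{p(\cdot),\gamma_d}\le K\|f\|_{p(\cdot),\gamma_d}$$ for every $f\in L^{p(\cdot)}(\gamma_d)$.
   Context: $d\gamma_d(x)=\pi^{-d/2}e^{-|x|^2}dx$ on $\mathbb{R}^d$. The non-centered Gaussian maximal function is $\mathcal{M}_{\gamma_d}f(x)=\sup_{B\ni x}\frac{1}{\gamma_d(B)}\int_B|f(y)|\,d\gamma_d(y)$, the supremum being over all Euclidean balls $B$ of $\mathbb{R}^d$ containing $x$. An exponent is a measurable bounded function $p:\mathbb{R}^d\to[1,\infty)$; $p^-$ is its essential infimum over $\mathbb{R}^d$. $L^{p(\cdot)}(\gamma_d)$ is the space of measurable $f$ with $\int_{\mathbb{R}^d}(|f|/\lambda)^{p(x)}d\gamma_d<\infty$ for some $\lambda>0$, with the norm $\|f\|_{p(\cdot),\gamma_d}=\inf\{\lambda>0:\int_{\mathbb{R}^d}(|f(x)|/\lambda)^{p(x)}d\gamma_d(x)\le 1\}$. We write $p\in LH_0(\mathbb{R}^d)$ if there is $C_{\log}(p)>0$ with $|p(x)-p(y)|\le \frac{C_{\log}(p)}{-\log|x-y|}$ whenever $0<|x-y|<1/2$. We write $p\in\mathcal{P}_{\gamma_d}^\infty(\mathbb{R}^d)$ if there are constants $C_{\gamma_d}>0$ and $p_\infty\ge1$ with $|p(x)-p_\infty|\le C_{\gamma_d}/|x|^2$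 for all $x\in\mathbb{R}^d\setminus\{0\}$. *)

theory Defs
  imports "HOL-Analysis.Analysis" "HOL-Probability.Essential_Supremum"
begin

(* The Gaussian measure gamma_d, with d = DIM('a); it lives on the Lebesgue sigma-algebra. *)
definition gauss :: "'a::euclidean_space measure" where
  "gauss = density lebesgue
     (\<lambda>x. ennreal (pi powr (- (real DIM('a) / 2)) * exp (- (norm x)\<^sup>2)))"

(* The balls are open, so every ball containing x has positive radius and positive measure.
   For locally integrable f closed balls give the same supremum.  A priori the value may be
   infinite, hence the codomain. *)
definition gauss_maximal :: "('a::euclidean_space \<Rightarrow> real) \<Rightarrow> 'a \<Rightarrow> ennreal" where
  "gauss_maximal f x =
     (SUP B\<in>{ball c r | c r. x \<in> ball c r}.
        (\<integral>\<^sup>+y\<in>B. ennreal \<bar>f y\<bar> \<partial>gauss) / emeasure gauss B)"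

definition exponent :: "('a::euclidean_space \<Rightarrow> real) \<Rightarrow> bool" where
  "exponent p \<longleftrightarrow> p \<in> borel_measurable lebesgue \<and> bounded (range p) \<and> (\<forall>x. 1 \<le> p x)"

(* The essential infimum p^-, as the dual of the library's essential supremum, which requires
   a complete linear order. *)
definition exponent_minus :: "('a::euclidean_space \<Rightarrow> real) \<Rightarrow> ereal" where
  "exponent_minus p = - esssup lebesgue (\<lambda>x. - ereal (p x))"

(* Powers with exponent q > 0 extended to the value infinity. *)
definition ennreal_powr :: "ennreal \<Rightarrow> real \<Rightarrow> ennreal" where
  "ennreal_powr a q = (if a = top then top else ennreal (enn2real a powr q))"

(* Modular and norm are stated for [0,\<infinity>]-valued functions, so that they apply both to |f| and to
   the maximal function. *)
definition gauss_modular :: "('a::euclidean_space \<Rightarrow> real) \<Rightarrow> ('a \<Rightarrow> ennreal) \<Rightarrow> ennreal" where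
  "gauss_modular p g = (\<integral>\<^sup>+x. ennreal_powr (g x) (p x) \<partial>gauss)"

(* The infimum of the empty set is infinity. *)
definition gauss_norm :: "('a::euclidean_space \<Rightarrow> real) \<Rightarrow> ('a \<Rightarrow> ennreal) \<Rightarrow> ennreal" where
  "gauss_norm p g =
     Inf {ennreal l | l. 0 < l \<and> gauss_modular p (\<lambda>x. g x / ennreal l) \<le> 1}"

definition gauss_Lp :: "('a::euclidean_space \<Rightarrow> real) \<Rightarrow> ('a \<Rightarrow> real) set" where
  "gauss_Lp p = {f \<in> borel_measurable lebesgue.
     \<exists>l>0. gauss_modular p (\<lambda>x. ennreal \<bar>f x\<bar> / ennreal l) < top}"

definition LH0 :: "('a::euclidean_space \<Rightarrow> real) \<Rightarrow> bool" where
  "LH0 p \<longleftrightarrow> (\<exists>C>0. \<forall>x y. 0 < norm (x - y) \<and> norm (x - y) < 1/2 \<longrightarrow>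
     \<bar>p x - p y\<bar> \<le> C / (- ln (norm (x - y))))"

definition P_gauss_infty :: "('a::euclidean_space \<Rightarrow> real) \<Rightarrow> bool" where
  "P_gauss_infty p \<longleftrightarrow> (\<exists>C>0. \<exists>p_inf\<ge>1. \<forall>x. x \<noteq> 0 \<longrightarrow>
     \<bar>p x - p_inf\<bar> \<le> C / (norm x)\<^sup>2)"

end

theory Submission
  imports Defs "HOL-Real_Asymp.Real_Asymp"
begin

text \<open>
  Put \<open>q = p / p0\<close> with a constant \<open>1 < p0 \<le> p\<close>. The exponent varies so little on each ball
  \<open>B\<close> that \<open>\<gamma>(B)\<close> raised to minus the oscillation of \<open>p\<close> on \<open>B\<close> stays bounded
  (\<open>oscillation_log_measure_bound\<close>): a small ball is handled by the log-Hoelder condition, and a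
  ball at distance \<open>a\<close> from the origin, whose measure is of size \<open>exp (- a\<^sup>2)\<close> up to lower order,
  by the decay \<open>1 / a\<^sup>2\<close> of \<open>p - p_inf\<close>. With Jensen's inequality this gives, for every function
  \<open>f\<close> of modular at most 1 and every ball \<open>B\<close> containing \<open>x\<close>, that the average of \<open>\<bar>f\<bar>\<close> over \<open>B\<close>
  to the power \<open>p x\<close> is at most a constant times the average of \<open>\<bar>f\<bar> powr q + 1\<close> to the constant
  power \<open>p0\<close> (\<open>average_powr_variable_exponent\<close>). Since \<open>\<gamma>\<close> is finite, boundedness of the
  maximal operator for the constant exponent \<open>p0\<close> then bounds the modular of the maximal function, and homogeneity
  of the norm finishes the proof.

  The constant exponent (\<open>gauss_ball_maximal_strong_type\<close>) is the substantial part, because \<open>\<gamma>\<close> is not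
  doubling and the operator is not of weak type (1,1) in dimension at least 2. Balls of radius at most
  \<open>1 / (1 + \<bar>c\<bar>)\<close> are doubling and are covered by Vitali's lemma. Larger balls that come within
  distance 1 of the origin have measure bounded below. For a ball at distance \<open>a \<ge> 1\<close>, most
  of the mass lies within \<open>1 / a\<close> of the sphere of radius \<open>a\<close>, and each sphere around the origin meets
  the ball in a cap. The average of \<open>h\<close> over the ball is then at most an integral in the radius
  of the maximal function over caps of \<open>h\<close> restricted to spheres
  (\<open>far_ball_average_le\<close>). Caps are doubling, so the angular maximal operator is bounded for every
  \<open>p > 1\<close>, and all the radial kernels, for varying \<open>a\<close>, are dominated by one kernel that passes
  Schur's test when \<open>p > 1\<close>. Polar coordinates combine the two bounds.
\<close>

section \<open>Powers of extended nonnegative numbers\<close>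

lemma ennreal_powr_ennreal: "0 \<le> a \<Longrightarrow> ennreal_powr (ennreal a) q = ennreal (a powr q)"
  by (simp add: ennreal_powr_def)

lemma ennreal_powr_top [simp]: "ennreal_powr top q = top"
  by (simp add: ennreal_powr_def)

lemma ennreal_powr_0 [simp]: "ennreal_powr 0 q = 0"
  by (simp add: ennreal_powr_def)

lemma ennreal_powr_1 [simp]: "ennreal_powr 1 q = 1"
  using ennreal_powr_ennreal[of 1 q] by simp

lemma ennreal_powr_one_exponent: "ennreal_powr a 1 = a"
  by (cases a) (auto simp: ennreal_powr_ennreal)

lemma ennreal_powr_mono: "a \<le> b \<Longrightarrow> 0 \<le> q \<Longrightarrow> ennreal_powr a q \<le> ennreal_powr b q"
  by (cases a; cases b) (auto simp: ennreal_powr_ennreal top_unique intro!: ennreal_leI powr_mono2)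

lemma ennreal_powr_mult:
  "0 < q \<Longrightarrow> ennreal_powr (a * b) q = ennreal_powr a q * ennreal_powr b q"
  by (cases a; cases b)
     (auto simp: ennreal_powr_ennreal ennreal_mult[symmetric] powr_mult ennreal_mult_top
        ennreal_top_mult ennreal_powr_def)

lemma ennreal_powr_powr:
  "ennreal_powr (ennreal_powr a q) s = ennreal_powr a (q * s)"
  by (cases a) (auto simp: ennreal_powr_ennreal powr_powr)

lemma ennreal_powr_add:
  "ennreal_powr a (q + s) = ennreal_powr a q * ennreal_powr a s"
  by (cases a) (auto simp: ennreal_powr_ennreal ennreal_mult[symmetric] powr_add)

lemma ennreal_powr_le_iff:
  assumes "0 < q"
  shows "ennreal_powr a q \<le> b \<longleftrightarrow> a \<le> ennreal_powr b (1 / q)"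
proof
  assume "ennreal_powr a q \<le> b"
  then have "ennreal_powr (ennreal_powr a q) (1/q) \<le> ennreal_powr b (1/q)"
    using assms by (intro ennreal_powr_mono) auto
  then show "a \<le> ennreal_powr b (1/q)"
    using assms by (simp add: ennreal_powr_powr ennreal_powr_one_exponent)
next
  assume "a \<le> ennreal_powr b (1/q)"
  then have "ennreal_powr a q \<le> ennreal_powr (ennreal_powr b (1/q)) q"
    using assms by (intro ennreal_powr_mono) auto
  then show "ennreal_powr a q \<le> b"
    using assms by (simp add: ennreal_powr_powr ennreal_powr_one_exponent)
qed

lemma ennreal_powr_mono_exponent:
  assumes "1 \<le> a" "q \<le> s"
  shows "ennreal_powr a q \<le> ennreal_powr a s"
proof (cases a)
  case (real x)
  with assms have "1 \<le> x"
    by (metis ennreal_1 ennreal_le_iff)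
  with real assms show ?thesis
    by (auto simp: ennreal_powr_ennreal intro!: ennreal_leI powr_mono)
qed simp

lemma ennreal_powr_sum_le:
  assumes "0 < q"
  shows "ennreal_powr (a + b) q \<le> ennreal (2 powr q) * (ennreal_powr a q + ennreal_powr b q)"
proof -
  have "a + b \<le> ennreal 2 * max a b"
    using add_mono[of a "max a b" b "max a b"] by (simp flip: mult_2)
  then have "ennreal_powr (a + b) q \<le> ennreal_powr (ennreal 2 * max a b) q"
    using assms by (intro ennreal_powr_mono) auto
  also have "\<dots> = ennreal (2 powr q) * ennreal_powr (max a b) q"
    using assms by (simp only: ennreal_powr_mult) (simp add: ennreal_powr_ennreal del: ennreal_numeral)
  also have "\<dots> \<le> ennreal (2 powr q) * (ennreal_powr a q + ennreal_powr b q)"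
    by (intro mult_left_mono) (auto simp: max_def)
  finally show ?thesis .
qed

lemma measurable_ennreal_powr [measurable]:
  assumes [measurable]: "f \<in> borel_measurable M" "q \<in> borel_measurable M"
  shows "(\<lambda>x. ennreal_powr (f x) (q x)) \<in> borel_measurable M"
  unfolding ennreal_powr_def by measurable

text \<open>
  The graph of \<open>h \<mapsto> h powr p\<close> lies above its tangent at \<open>t\<close>. Being linear in \<open>h powr p\<close>, this form can be
  integrated, and the best \<open>t\<close> chosen afterwards.
\<close>

lemma Young_tangent:
  fixes h t p :: real
  assumes "0 \<le> h" "0 < t" "1 \<le> p"
  shows "h \<le> h powr p * (t powr (1 - p) / p) + t * (1 - 1 / p)"
proof (cases "h = 0")
  case True
  then show ?thesis using assms by simp
next
  case False
  with assms have h: "0 < h" by simp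
  have "((h/t) powr p) powr (1/p) * 1 powr (1 - 1/p) \<le> (1/p) * (h/t) powr p + (1 - 1/p) * 1"
    using assms h by (intro Youngs_inequality_0) auto
  then have "h / t \<le> (h/t) powr p / p + (1 - 1/p)"
    using assms by (simp add: powr_powr)
  then have "h \<le> t * ((h/t) powr p / p + (1 - 1/p))"
    using assms by (simp add: field_simps)
  also have "(h/t) powr p = h powr p * t powr (- p)"
    using assms by (simp add: powr_divide powr_minus field_simps)
  also have "t * (h powr p * t powr (-p) / p + (1 - 1/p)) = h powr p * ((t powr 1 * t powr (-p)) / p) + t * (1 - 1 / p)"
    using assms by (simp add: algebra_simps)
  also have "t powr 1 * t powr (-p) = t powr (1 - p)"
    by (metis diff_conv_add_uminus powr_add)
  finally show ?thesis .
qed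

text \<open>
  Jensen's inequality for a measure of total mass at most \<open>L\<close>, with no integrability assumption.
  It serves both for averages and, with density a kernel, for Schur's test.
\<close>

lemma nn_integral_Jensen_powr:
  assumes H [measurable]: "H \<in> borel_measurable N" and p: "1 \<le> p"
    and L: "0 < L" "emeasure N (space N) \<le> ennreal L"
  shows "ennreal_powr (\<integral>\<^sup>+x. H x \<partial>N) p
           \<le> ennreal (L powr (p - 1)) * (\<integral>\<^sup>+x. ennreal_powr (H x) p \<partial>N)"
proof (cases "\<integral>\<^sup>+x. ennreal_powr (H x) p \<partial>N")
  case top
  then show ?thesis using L by (simp add: ennreal_mult_top)
next
  case (real I)
  show ?thesis
  proof (cases "I = 0")
    case True
    have "AE x in N. ennreal_powr (H x) p = 0"
      using real True by (subst nn_integral_0_iff_AE[symmetric]) auto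
    then have "AE x in N. H x = 0"
      by eventually_elim (auto simp: ennreal_powr_def enn2real_eq_0_iff split: if_splits)
    then have "(\<integral>\<^sup>+x. H x \<partial>N) = 0"
      by (subst nn_integral_0_iff_AE) auto
    then show ?thesis by simp
  next
    case False
    with real have I: "0 < I" by simp
    \<comment> \<open>This point of tangency makes both terms of the tangent inequality integrate to multiples of \<open>L * t\<close>.\<close>
    define t where "t = (I / L) powr (1 / p)"
    have t: "0 < t" using I L by (simp add: t_def)
    have tp: "t powr p = I / L" using I L p by (simp add: t_def powr_powr)
    have le: "H x \<le> ennreal_powr (H x) p * ennreal (t powr (1 - p) / p) + ennreal (t * (1 - 1 / p))" for x
    proof (cases "H x")
      case (real h)
      then show ?thesis
        using Young_tangent[OF real(1) t p] t p
        by (simp add: ennreal_powr_ennreal ennreal_mult[symmetric] ennreal_plus[symmetric] ennreal_leI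
             del: ennreal_plus)
    qed (use t p in \<open>simp add: ennreal_top_mult\<close>)
    have "(\<integral>\<^sup>+x. H x \<partial>N) \<le> (\<integral>\<^sup>+x. ennreal_powr (H x) p * ennreal (t powr (1 - p) / p) + ennreal (t * (1 - 1 / p)) \<partial>N)"
      by (intro nn_integral_mono le)
    also have "\<dots> = ennreal I * ennreal (t powr (1 - p) / p) + ennreal (t * (1 - 1 / p)) * emeasure N (space N)"
      using real by (subst nn_integral_add) (auto simp: nn_integral_multc)
    also have "\<dots> \<le> ennreal I * ennreal (t powr (1 - p) / p) + ennreal (t * (1 - 1 / p)) * ennreal L"
      by (intro add_left_mono mult_left_mono L) simp
    also have "\<dots> = ennreal (I * (t powr (1 - p) / p) + t * (1 - 1 / p) * L)"
      using I t p L by (simp add: ennreal_mult[symmetric] ennreal_plus[symmetric] del: ennreal_plus)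
    also have "I * (t powr (1 - p) / p) + t * (1 - 1 / p) * L = L * t"
    proof -
      have "I * t powr (1 - p) = L * (t powr p * t powr (1 - p))"
        using tp L by simp
      also have "t powr p * t powr (1 - p) = t"
        using t by (simp flip: powr_add)
      finally have "I * (t powr (1 - p) / p) = L * t / p" by simp
      then show ?thesis using p by (simp add: field_simps)
    qed
    finally have "ennreal_powr (\<integral>\<^sup>+x. H x \<partial>N) p \<le> ennreal_powr (ennreal (L * t)) p"
      using p by (intro ennreal_powr_mono) auto
    also have "\<dots> = ennreal (L powr p * t powr p)"
      using L t by (simp add: ennreal_powr_ennreal powr_mult)
    also have "L powr p * t powr p = L powr (p - 1) * I"
      using L tp by (simp add: powr_diff)
    also have "ennreal (L powr (p - 1) * I) = ennreal (L powr (p - 1)) * ennreal I"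
      using I by (simp add: ennreal_mult)
    finally show ?thesis using real by simp
  qed
qed

section \<open>Maximal functions over doubling families of balls\<close>

lemma emeasure_UN_le_count_space:
  assumes [measurable]: "\<And>i. i \<in> I \<Longrightarrow> X i \<in> sets M" and I [simp]: "countable I"
  shows "emeasure M (\<Union>i\<in>I. X i) \<le> (\<integral>\<^sup>+i. emeasure M (X i) \<partial>count_space I)"
proof -
  note sets.countable_UN'[unfolded subset_eq, measurable]
  have "emeasure M (\<Union>i\<in>I. X i) = (\<integral>\<^sup>+x. indicator (\<Union>i\<in>I. X i) x \<partial>M)"
    by simp
  also have "\<dots> \<le> (\<integral>\<^sup>+x. \<integral>\<^sup>+i. indicator (X i) x \<partial>count_space I \<partial>M)"
  proof (intro nn_integral_mono)
    fix x
    show "indicator (\<Union>i\<in>I. X i) x \<le> (\<integral>\<^sup>+i. indicator (X i) x \<partial>count_space I :: ennreal)"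
    proof (cases "\<exists>j\<in>I. x \<in> X j")
      case True
      then obtain j where "j \<in> I" "x \<in> X j" by auto
      then have "indicator (\<Union>i\<in>I. X i) x = (1::ennreal)" "indicator (X j) x = (1::ennreal)"
        by (metis UN_I indicator_simps(1))+
      then show ?thesis
        using nn_integral_ge_point[of j I "\<lambda>i. indicator (X i) x"] \<open>j \<in> I\<close> by simp
    qed auto
  qed
  also have "\<dots> = (\<integral>\<^sup>+i. \<integral>\<^sup>+x. indicator (X i) x \<partial>M \<partial>count_space I)"
    by (simp add: nn_integral_count_space_nn_integral)
  finally show ?thesis
    by (simp cong: nn_integral_cong_simp)
qed

text \<open>
  The family is a set of centres and radii, and membership in the ball is a factor of
  the averages: for a countable family the maximal function is then a countable
  supremum of functions that depend measurably on any further parameter of \<open>h\<close>.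
\<close>

definition ball_maximal ::
  "('a::euclidean_space \<times> real) set \<Rightarrow> 'a measure \<Rightarrow> ('a \<Rightarrow> ennreal) \<Rightarrow> 'a \<Rightarrow> ennreal" where
  "ball_maximal Q M h x =
     (SUP (c, r)\<in>Q. indicator (ball c r) x * ((\<integral>\<^sup>+y\<in>ball c r. h y \<partial>M) / emeasure M (ball c r)))"

lemma ball_average_le_ball_maximal:
  assumes "(c, r) \<in> Q" "x \<in> ball c r"
  shows "(\<integral>\<^sup>+y\<in>ball c r. h y \<partial>M) / emeasure M (ball c r) \<le> ball_maximal Q M h x"
  unfolding ball_maximal_def using assms by (intro SUP_upper2[of "(c, r)"]) auto

lemma less_ball_maximal_iff:
  "l < ball_maximal Q M h x \<longleftrightarrow>
     (\<exists>(c, r)\<in>Q. x \<in> ball c r \<and> l < (\<integral>\<^sup>+y\<in>ball c r. h y \<partial>M) / emeasure M (ball c r))"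
  unfolding ball_maximal_def less_SUP_iff
proof (intro bex_cong refl)
  fix i assume "i \<in> Q"
  show "(l < (case i of (c, r) \<Rightarrow> indicator (ball c r) x * ((\<integral>\<^sup>+y\<in>ball c r. h y \<partial>M) / emeasure M (ball c r)))) =
    (case i of (c, r) \<Rightarrow> x \<in> ball c r \<and> l < (\<integral>\<^sup>+y\<in>ball c r. h y \<partial>M) / emeasure M (ball c r))"
    by (cases i; cases "x \<in> ball (fst i) (snd i)") (simp_all del: mem_ball)
qed

lemma ball_maximal_superlevel:
  "{x. l < ball_maximal Q M h x} =
     (\<Union>(c, r)\<in>{(c, r)\<in>Q. l < (\<integral>\<^sup>+y\<in>ball c r. h y \<partial>M) / emeasure M (ball c r)}. ball c r)"
  by (force simp: less_ball_maximal_iff)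

lemma borel_measurable_ball_maximal [measurable]: "ball_maximal Q M h \<in> borel_measurable borel"
proof (rule borel_measurableI_greater)
  fix l
  have "open {x. l < ball_maximal Q M h x}"
    unfolding ball_maximal_superlevel by auto
  then show "{x \<in> space borel. l < ball_maximal Q M h x} \<in> sets borel"
    by simp
qed

text \<open>
  The factor 5 and the common bound on the radii are those of Vitali's covering lemma.
\<close>

definition doubling_on :: "('a::euclidean_space \<times> real) set \<Rightarrow> 'a measure \<Rightarrow> real \<Rightarrow> bool" where
  "doubling_on Q M K \<longleftrightarrow> 0 < K \<and> (\<exists>r0. \<forall>(c, r)\<in>Q. 0 < r \<and> r \<le> r0 \<and>
     emeasure M (ball c (5 * r)) \<le> ennreal K * emeasure M (ball c r))"

text \<open>
  The balls with average above \<open>l\<close> cover the superlevel set. Vitali's lemma selects disjoint ones whose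
  fivefold enlargements still cover it; doubling takes the enlargements back to the selected balls, and on
  disjoint balls the integrals of \<open>h\<close> add up to at most the whole integral.
\<close>

lemma ball_maximal_weak_type:
  fixes M :: "'a::euclidean_space measure"
  assumes M: "finite_measure M" "sets M = sets borel" and D: "doubling_on Q M K"
    and h [measurable]: "h \<in> borel_measurable borel"
  shows "l * emeasure M {x. l < ball_maximal Q M h x} \<le> ennreal K * (\<integral>\<^sup>+x. h x \<partial>M)"
proof -
  interpret finite_measure M by fact
  note M(2)[measurable_cong]
  define I where "I = {(c, r)\<in>Q. l < (\<integral>\<^sup>+y\<in>ball c r. h y \<partial>M) / emeasure M (ball c r)}"
  from D obtain r0 where r0: "\<And>i. i \<in> I \<Longrightarrow> 0 < snd i \<and> snd i \<le> r0"
    and K: "\<And>i. i \<in> I \<Longrightarrow> emeasure M (ball (fst i) (5 * snd i)) \<le> ennreal K * emeasure M (ball (fst i) (snd i))"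
    unfolding doubling_on_def I_def by fastforce
  have E: "{x. l < ball_maximal Q M h x} = (\<Union>i\<in>I. ball (fst i) (snd i))"
    unfolding ball_maximal_superlevel I_def by auto
  obtain C where C: "countable C" "C \<subseteq> I"
    "pairwise (\<lambda>i j. disjnt (ball (fst i) (snd i)) (ball (fst j) (snd j))) C"
    "{x. l < ball_maximal Q M h x} \<subseteq> (\<Union>i\<in>C. ball (fst i) (5 * snd i))"
    using Vitali_covering_lemma_balls[where S = "{x. l < ball_maximal Q M h x}" and K = I and a = fst and r = snd and B = r0] E r0 by blast
  have avg: "l * emeasure M (ball (fst i) (snd i)) \<le> (\<integral>\<^sup>+y\<in>ball (fst i) (snd i). h y \<partial>M)" if "i \<in> C" for i
  proof (cases "emeasure M (ball (fst i) (snd i)) = 0")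
    case False
    have "l * emeasure M (ball (fst i) (snd i)) \<le>
      (\<integral>\<^sup>+y\<in>ball (fst i) (snd i). h y \<partial>M) / emeasure M (ball (fst i) (snd i)) * emeasure M (ball (fst i) (snd i))"
      using that C(2) unfolding I_def by (intro mult_right_mono) (auto simp: less_imp_le)
    then show ?thesis
      using False by (simp add: ennreal_divide_times ennreal_times_divide emeasure_finite mult_divide_eq_ennreal)
  qed simp
  have "l * emeasure M {x. l < ball_maximal Q M h x} \<le> l * emeasure M (\<Union>i\<in>C. ball (fst i) (5 * snd i))"
    using C by (intro mult_left_mono emeasure_mono) (auto simp: M(2) intro!: sets.countable_UN')
  also have "\<dots> \<le> l * (\<integral>\<^sup>+i. emeasure M (ball (fst i) (5 * snd i)) \<partial>count_space C)"
    using C by (intro mult_left_mono emeasure_UN_le_count_space) (auto simp: M(2))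
  also have "\<dots> \<le> l * (\<integral>\<^sup>+i. ennreal K * emeasure M (ball (fst i) (snd i)) \<partial>count_space C)"
    using C K by (intro mult_left_mono nn_integral_mono) auto
  also have "\<dots> = ennreal K * (\<integral>\<^sup>+i. l * emeasure M (ball (fst i) (snd i)) \<partial>count_space C)"
    by (simp add: nn_integral_cmult mult_ac)
  also have "\<dots> \<le> ennreal K * (\<integral>\<^sup>+i. emeasure (density M h) (ball (fst i) (snd i)) \<partial>count_space C)"
    using avg by (intro mult_left_mono nn_integral_mono) (auto simp: emeasure_density M(2))
  also have "\<dots> = ennreal K * emeasure (density M h) (\<Union>i\<in>C. ball (fst i) (snd i))"
    using C by (subst emeasure_UN_countable) (auto simp: M(2) disjoint_family_on_def pairwise_def disjnt_def)
  also have "\<dots> \<le> ennreal K * emeasure (density M h) UNIV"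
    by (intro mult_left_mono emeasure_mono) (auto simp: M(2))
  also have "emeasure (density M h) UNIV = (\<integral>\<^sup>+x. h x \<partial>M)"
    by (subst emeasure_density) (auto simp: M(2))
  finally show ?thesis .
qed

text \<open>
  The layer-cake representation of a power; both sides are infinite at \<open>a = \<infinity>\<close>.
\<close>

lemma nn_integral_powr_below:
  assumes "0 < s"
  shows "(\<integral>\<^sup>+l. ennreal (l powr (s - 1)) * indicator {l. 0 < l \<and> ennreal l < a} l \<partial>lborel)
           = ennreal (1 / s) * ennreal_powr a s"
proof -
  have fin: "(\<integral>\<^sup>+l. ennreal (l powr (s - 1)) * indicator {l. 0 < l \<and> ennreal l < ennreal b} l \<partial>lborel)
           = ennreal (1 / s) * ennreal (b powr s)" if "0 \<le> b" for b
  proof -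
    have "(\<integral>\<^sup>+l. ennreal (l powr (s - 1)) * indicator {l. 0 < l \<and> ennreal l < ennreal b} l \<partial>lborel)
      = (\<integral>\<^sup>+l. ennreal (l powr (s - 1)) * indicator {0..b} l \<partial>lborel)"
    proof (rule nn_integral_cong_AE)
      have "AE l in lborel. l \<noteq> (0::real)" "AE l in lborel. l \<noteq> b"
        by (rule AE_lborel_singleton)+
      then show "AE l in lborel. ennreal (l powr (s - 1)) * indicator {l. 0 < l \<and> ennreal l < ennreal b} l
          = ennreal (l powr (s - 1)) * indicator {0..b} l"
        by eventually_elim (auto simp: indicator_def ennreal_less_iff)
    qed
    also have "\<dots> = ennreal (b powr (s - 1 + 1) / (s - 1 + 1))"
      using assms that
      by (intro nn_integral_has_integral_lebesgue' has_integral_powr_from_0) auto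
    finally show ?thesis using assms by (simp add: ennreal_mult[symmetric])
  qed
  show ?thesis
  proof (cases a)
    case (real b)
    then show ?thesis using fin[of b] by (simp add: ennreal_powr_ennreal)
  next
    case top
    have "ennreal (1 / s) * ennreal (real n) \<le> (\<integral>\<^sup>+l. ennreal (l powr (s - 1)) * indicator {l. 0 < l \<and> ennreal l < top} l \<partial>lborel)" for n
    proof -
      have "ennreal (1 / s) * ennreal (real n) = ennreal (1 / s) * ennreal ((real n powr (1/s)) powr s)"
        using assms by (simp add: powr_powr)
      also have "\<dots> = (\<integral>\<^sup>+l. ennreal (l powr (s - 1)) * indicator {l. 0 < l \<and> ennreal l < ennreal (real n powr (1/s))} l \<partial>lborel)"
        by (subst fin) auto
      also have "\<dots> \<le> (\<integral>\<^sup>+l. ennreal (l powr (s - 1)) * indicator {l. 0 < l \<and> ennreal l < top} l \<partial>lborel)"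
        by (intro nn_integral_mono mult_left_mono) (auto simp: indicator_def)
      finally show ?thesis .
    qed
    then have "(SUP n. ennreal (1 / s) * ennreal (real n)) \<le> (\<integral>\<^sup>+l. ennreal (l powr (s - 1)) * indicator {l. 0 < l \<and> ennreal l < top} l \<partial>lborel)"
      by (intro SUP_least) auto
    also have "(SUP n. ennreal (1 / s) * ennreal (real n)) = ennreal (1 / s) * (SUP n. ennreal (real n))"
      by (simp add: SUP_mult_left_ennreal)
    also have "(SUP n. ennreal (real n)) = top"
      using ennreal_SUP_of_nat_eq_top by (simp add: ennreal_of_nat_eq_real_of_nat)
    finally show ?thesis using top assms
      by (simp add: ennreal_mult_top top_unique)
  qed
qed

text \<open>
  The part of \<open>h\<close> below \<open>l / 2\<close> contributes at most \<open>l / 2\<close> to any average, so only the part of \<open>h\<close>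
  above \<open>l / 2\<close> has to be estimated by the weak type bound.
\<close>

lemma ball_maximal_weak_type_truncated:
  fixes M :: "'a::euclidean_space measure"
  assumes M: "finite_measure M" "sets M = sets borel" and D: "doubling_on Q M K"
    and h [measurable]: "h \<in> borel_measurable borel" and l: "0 < l"
  shows "ennreal (l / 2) * emeasure M {x. ennreal l < ball_maximal Q M h x}
    \<le> ennreal K * (\<integral>\<^sup>+x. h x * indicator {x. ennreal (l / 2) < h x} x \<partial>M)"
proof -
  interpret finite_measure M by fact
  note M(2)[measurable_cong]
  define g where "g x = h x * indicator {x. ennreal (l / 2) < h x} x" for x
  have [measurable]: "g \<in> borel_measurable borel"
    unfolding g_def by measurable
  have hg: "h x \<le> g x + ennreal (l / 2)" for x
    by (auto simp: g_def indicator_def not_less)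
  have half: "ennreal l = ennreal (l / 2) + ennreal (l / 2)"
    using l by (simp flip: ennreal_plus)
  have "{x. ennreal l < ball_maximal Q M h x} \<subseteq> {x. ennreal (l / 2) < ball_maximal Q M g x}"
  proof
    fix x assume "x \<in> {x. ennreal l < ball_maximal Q M h x}"
    then obtain c r where cr: "(c, r) \<in> Q" "x \<in> ball c r"
      "ennreal l < (\<integral>\<^sup>+y\<in>ball c r. h y \<partial>M) / emeasure M (ball c r)"
      by (auto simp: less_ball_maximal_iff)
    let ?m = "emeasure M (ball c r)"
    have [measurable]: "g \<in> borel_measurable M" "ball c r \<in> sets M"
      by (simp_all add: M(2))
    have "(\<integral>\<^sup>+y\<in>ball c r. h y \<partial>M) \<le> (\<integral>\<^sup>+y\<in>ball c r. g y + ennreal (l / 2) \<partial>M)"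
      by (intro nn_integral_mono mult_right_mono hg) auto
    also have "\<dots> = (\<integral>\<^sup>+y\<in>ball c r. g y \<partial>M) + ennreal (l / 2) * ?m"
      unfolding distrib_right
      by (subst nn_integral_add) (simp_all add: nn_integral_cmult_indicator)
    finally have *: "(\<integral>\<^sup>+y\<in>ball c r. h y \<partial>M) / ?m \<le> ((\<integral>\<^sup>+y\<in>ball c r. g y \<partial>M) + ennreal (l / 2) * ?m) / ?m"
      by (rule divide_right_mono_ennreal)
    also have "\<dots> \<le> (\<integral>\<^sup>+y\<in>ball c r. g y \<partial>M) / ?m + ennreal (l / 2)"
    proof (cases "?m = 0")
      case True
      then have "(\<integral>\<^sup>+y\<in>ball c r. g y \<partial>M) = 0"
        by (intro nn_integral_null_set[unfolded null_sets_def, OF CollectI]) (auto simp: M(2))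
      with True show ?thesis by simp
    next
      case False
      then show ?thesis
        by (simp add: add_divide_distrib_ennreal mult_divide_eq_ennreal emeasure_finite)
    qed
    finally have "ennreal l < (\<integral>\<^sup>+y\<in>ball c r. g y \<partial>M) / ?m + ennreal (l / 2)"
      using cr(3) by simp
    then have "ennreal (l / 2) < (\<integral>\<^sup>+y\<in>ball c r. g y \<partial>M) / ?m"
      unfolding half by (metis add.commute add_left_mono not_less)
    then show "x \<in> {x. ennreal (l / 2) < ball_maximal Q M g x}"
      using cr by (auto simp: less_ball_maximal_iff)
  qed
  then have "ennreal (l / 2) * emeasure M {x. ennreal l < ball_maximal Q M h x} \<le>
    ennreal (l / 2) * emeasure M {x. ennreal (l / 2) < ball_maximal Q M g x}"
    by (intro mult_left_mono emeasure_mono) (auto simp: M(2))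
  also have "\<dots> \<le> ennreal K * (\<integral>\<^sup>+x. g x \<partial>M)"
    by (rule ball_maximal_weak_type[OF M D]) simp
  finally show ?thesis by (simp add: g_def)
qed

text \<open>
  Marcinkiewicz interpolation: the truncated weak type bound is integrated against \<open>l powr (p - 1)\<close>, and
  Fubini's theorem turns the right-hand side into an integral of \<open>h powr p\<close>. The constant depends on
  \<open>K\<close> and \<open>p\<close> only, so that the bound can be applied on all spheres at once.
\<close>

theorem ball_maximal_strong_type:
  fixes M :: "'a::euclidean_space measure"
  assumes M: "finite_measure M" "sets M = sets borel" and D: "doubling_on Q M K"
    and h [measurable]: "h \<in> borel_measurable borel" and p: "1 < p"
  shows "(\<integral>\<^sup>+x. ennreal_powr (ball_maximal Q M h x) p \<partial>M)
    \<le> ennreal (2 powr p * K * p / (p - 1)) * (\<integral>\<^sup>+x. ennreal_powr (h x) p \<partial>M)"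
proof -
  interpret finite_measure M by fact
  interpret pair_sigma_finite lborel M ..
  note M(2)[measurable_cong]
  have [measurable]: "ball_maximal Q M h \<in> borel_measurable M"
    by simp
  have K: "0 < K" using D by (simp add: doubling_on_def)
  let ?S = "\<lambda>x. ball_maximal Q M h x"
  let ?A = "\<lambda>x l. ennreal (l powr (p - 2)) * indicator {l. 0 < l \<and> ennreal l < 2 * h x} l"
  let ?B = "\<lambda>x l. ennreal (l powr (p - 1)) * indicator {l. 0 < l \<and> ennreal l < ?S x} l"
  have pow: "ennreal_powr (?S x) p =
     ennreal p * (\<integral>\<^sup>+l. ?B x l \<partial>lborel)" for x
    using p by (subst nn_integral_powr_below) (auto simp: mult.assoc[symmetric] ennreal_mult[symmetric])
  have weak: "ennreal (l powr (p - 1)) * indicator {0<..} l * emeasure M {x. ennreal l < ?S x}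
     \<le> ennreal (2 * K) * (\<integral>\<^sup>+x. h x * ?A x l \<partial>M)" for l
  proof (cases "0 < l")
    case True
    have "ennreal (l powr (p - 1)) * emeasure M {x. ennreal l < ?S x}
      = ennreal (2 * l powr (p - 2)) * (ennreal (l / 2) * emeasure M {x. ennreal l < ?S x})"
    proof -
      have "l powr (p - 1) = (2 * l powr (p - 2)) * (l / 2)"
        using True powr_add[of l "p - 2" 1] by simp
      then have "ennreal (l powr (p - 1)) = ennreal (2 * l powr (p - 2)) * ennreal (l / 2)"
        using True by (simp add: ennreal_mult[symmetric])
      then show ?thesis by (simp add: mult.assoc)
    qed
    also have "\<dots> \<le> ennreal (2 * l powr (p - 2)) * (ennreal K * (\<integral>\<^sup>+x. h x * indicator {x. ennreal (l / 2) < h x} x \<partial>M))"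
      by (intro mult_left_mono ball_maximal_weak_type_truncated M D True) auto
    also have "\<dots> = ennreal (2 * K) * (\<integral>\<^sup>+x. ennreal (l powr (p - 2)) * (h x * indicator {x. ennreal (l / 2) < h x} x) \<partial>M)"
      using K by (subst nn_integral_cmult) (auto simp: ennreal_mult mult_ac)
    also have "(\<lambda>x. ennreal (l powr (p - 2)) * (h x * indicator {x. ennreal (l / 2) < h x} x)) =
       (\<lambda>x. h x * ?A x l)"
    proof
      fix x
      have "ennreal (l / 2) < h x \<longleftrightarrow> ennreal l < 2 * h x"
      proof (cases "h x")
        case (real b)
        then have "2 * h x = ennreal (2 * b)" by (simp add: ennreal_mult)
        then show ?thesis using real True by (simp only: ennreal_less_iff) auto
      qed (simp add: ennreal_mult_top)
      then show "ennreal (l powr (p - 2)) * (h x * indicator {x. ennreal (l / 2) < h x} x) =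
       h x * ?A x l"
        using True by (auto simp: indicator_def mult_ac)
    qed
    finally show ?thesis using True by simp
  qed simp
  have "(\<integral>\<^sup>+x. ennreal_powr (?S x) p \<partial>M) =
    ennreal p * (\<integral>\<^sup>+x. (\<integral>\<^sup>+l. ?B x l \<partial>lborel) \<partial>M)"
    unfolding pow by (subst nn_integral_cmult) (auto simp: nn_integral_cmult)
  also have "(\<integral>\<^sup>+x. (\<integral>\<^sup>+l. ?B x l \<partial>lborel) \<partial>M)
    = (\<integral>\<^sup>+l. (\<integral>\<^sup>+x. ?B x l \<partial>M) \<partial>lborel)"
    by (rule Fubini') simp
  also have "\<dots> = (\<integral>\<^sup>+l. ennreal (l powr (p - 1)) * indicator {0<..} l * emeasure M {x. ennreal l < ?S x} \<partial>lborel)"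
  proof (intro nn_integral_cong)
    fix l :: real
    have "(\<integral>\<^sup>+x. ?B x l \<partial>M)
      = (\<integral>\<^sup>+x. (ennreal (l powr (p - 1)) * indicator {0<..} l) * indicator {x. ennreal l < ?S x} x \<partial>M)"
      by (intro nn_integral_cong) (auto simp: indicator_def)
    also have "\<dots> = ennreal (l powr (p - 1)) * indicator {0<..} l * emeasure M {x. ennreal l < ?S x}"
      by (subst nn_integral_cmult_indicator) (auto simp: M(2))
    finally show "(\<integral>\<^sup>+x. ?B x l \<partial>M) = \<dots>" .
  qed
  also have "\<dots> \<le> (\<integral>\<^sup>+l. ennreal (2 * K) * (\<integral>\<^sup>+x. h x * ?A x l \<partial>M) \<partial>lborel)"
    by (intro nn_integral_mono weak)
  also have "\<dots> = ennreal (2 * K) * (\<integral>\<^sup>+l. (\<integral>\<^sup>+x. h x * ?A x l \<partial>M) \<partial>lborel)"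
    by (rule nn_integral_cmult) simp
  also have "(\<integral>\<^sup>+l. (\<integral>\<^sup>+x. h x * ?A x l \<partial>M) \<partial>lborel)
    = (\<integral>\<^sup>+x. (\<integral>\<^sup>+l. h x * ?A x l \<partial>lborel) \<partial>M)"
    by (rule Fubini'[symmetric]) simp
  also have "\<dots> = (\<integral>\<^sup>+x. ennreal (2 powr (p - 1) / (p - 1)) * ennreal_powr (h x) p \<partial>M)"
  proof (intro nn_integral_cong)
    fix x
    have "(\<integral>\<^sup>+l. h x * ?A x l \<partial>lborel)
      = h x * (\<integral>\<^sup>+l. ennreal (l powr ((p - 1) - 1)) * indicator {l. 0 < l \<and> ennreal l < 2 * h x} l \<partial>lborel)"
      by (subst nn_integral_cmult) auto
    also have "\<dots> = h x * (ennreal (1 / (p - 1)) * ennreal_powr (ennreal 2 * h x) (p - 1))"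
      using p by (subst nn_integral_powr_below) auto
    also have "\<dots> = ennreal (1 / (p - 1)) * ennreal (2 powr (p - 1)) * (ennreal_powr (h x) 1 * ennreal_powr (h x) (p - 1))"
      using p by (subst ennreal_powr_mult)
        (auto simp: ennreal_powr_ennreal mult_ac ennreal_powr_one_exponent simp del: ennreal_numeral)
    also have "\<dots> = ennreal (2 powr (p - 1) / (p - 1)) * ennreal_powr (h x) p"
      using p by (subst ennreal_powr_add[symmetric]) (simp add: ennreal_mult[symmetric])
    finally show "(\<integral>\<^sup>+l. h x * ?A x l \<partial>lborel) = \<dots>" .
  qed
  also have "\<dots> = ennreal (2 powr (p - 1) / (p - 1)) * (\<integral>\<^sup>+x. ennreal_powr (h x) p \<partial>M)"
    by (rule nn_integral_cmult) simp
  also have "ennreal p * (ennreal (2 * K) * (ennreal (2 powr (p - 1) / (p - 1)) * (\<integral>\<^sup>+x. ennreal_powr (h x) p \<partial>M)))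
    = ennreal (p * (2 * K) * (2 powr (p - 1) / (p - 1))) * (\<integral>\<^sup>+x. ennreal_powr (h x) p \<partial>M)"
    using p K by (simp add: ennreal_mult[symmetric] mult.assoc[symmetric])
  also have "p * (2 * K) * (2 powr (p - 1) / (p - 1)) = 2 powr p * K * p / (p - 1)"
    using p by (simp add: powr_diff field_simps)
  finally show ?thesis by (simp add: mult_left_mono)
qed

section \<open>Polar coordinates and spherical caps\<close>

lemma ball_in_sets_borel [measurable]: "ball (c::'a::metric_space) r \<in> sets borel"
  by simp

text \<open>
  Surface measure on the unit sphere, obtained as the dimension times the volume of the cone
  over a set. It lives on the whole space and is concentrated on vectors of norm 1.
\<close>

definition sphere_measure :: "'a::euclidean_space measure" where
  "sphere_measure = distr (density lborel (\<lambda>y. ennreal (real DIM('a)) * indicator (ball 0 1) y)) borel sgn"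

definition radial_measure :: "'a::euclidean_space itself \<Rightarrow> real measure" where
  "radial_measure _ = density lborel (\<lambda>t. ennreal (t ^ (DIM('a) - 1)) * indicator {0..} t)"

lemma measurable_sgn [measurable]: "(sgn :: 'a::euclidean_space \<Rightarrow> 'a) \<in> borel_measurable borel"
  unfolding sgn_div_norm[abs_def] by measurable

lemma sets_sphere_measure [simp, measurable_cong]: "sets sphere_measure = sets borel"
  by (simp add: sphere_measure_def)

lemma space_sphere_measure [simp]: "space sphere_measure = UNIV"
  by (simp add: sphere_measure_def)

lemma sets_radial_measure [simp, measurable_cong]: "sets (radial_measure x) = sets borel"
  by (simp add: radial_measure_def)

lemma space_radial_measure [simp]: "space (radial_measure x) = UNIV"
  by (simp add: radial_measure_def)

lemma emeasure_sphere_measure: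
  assumes [measurable]: "B \<in> sets borel"
  shows "emeasure (sphere_measure :: 'a::euclidean_space measure) B =
     ennreal (real DIM('a)) * emeasure lborel {y::'a. norm y < 1 \<and> sgn y \<in> B}"
proof -
  have [measurable]: "sgn -` B \<in> sets (borel :: 'a measure)"
    by (rule measurable_sets_borel[OF measurable_sgn]) simp
  have "emeasure (sphere_measure :: 'a measure) B =
    (\<integral>\<^sup>+y. ennreal (real DIM('a)) * indicator (ball 0 1) y * indicator (sgn -` B) (y::'a) \<partial>lborel)"
    unfolding sphere_measure_def by (subst emeasure_distr) (auto simp: emeasure_density)
  also have "\<dots> = (\<integral>\<^sup>+y. ennreal (real DIM('a)) * indicator {y::'a. norm y < 1 \<and> sgn y \<in> B} y \<partial>lborel)"
    by (intro nn_integral_cong) (auto simp: indicator_def)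
  finally show ?thesis
    by (subst (asm) nn_integral_cmult_indicator) auto
qed

lemma finite_measure_sphere_measure: "finite_measure (sphere_measure :: 'a::euclidean_space measure)"
proof
  have "{y::'a. norm y < 1 \<and> sgn y \<in> UNIV} = ball 0 1" by auto
  then show "emeasure (sphere_measure :: 'a measure) (space sphere_measure) \<noteq> \<infinity>"
    by (simp add: emeasure_sphere_measure emeasure_ball ennreal_mult_eq_top_iff)
qed

lemma AE_sphere_measure: "AE w in (sphere_measure :: 'a::euclidean_space measure). norm w = 1"
proof -
  have "AE y in lborel. y \<noteq> (0::'a)"
    by (rule AE_lborel_singleton)
  then show ?thesis
    unfolding sphere_measure_def
    by (subst AE_distr_iff) (auto simp: AE_density norm_sgn elim: eventually_mono)
qed

text \<open>
  Homogeneity of Lebesgue measure; this is where the density \<open>t ^ (DIM('a) - 1)\<close> of the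
  radial measure comes from.
\<close>

lemma emeasure_cone_scale:
  assumes [measurable]: "B \<in> sets borel" and r: "0 < r"
  shows "emeasure lborel {y::'a::euclidean_space. norm y < r \<and> sgn y \<in> B} =
    ennreal (r ^ DIM('a)) * emeasure lborel {y::'a. norm y < 1 \<and> sgn y \<in> B}"
proof -
  have "emeasure lborel {y::'a. norm y < r \<and> sgn y \<in> B} =
    emeasure (density (distr lborel borel (\<lambda>x. 0 + r *\<^sub>R x)) (\<lambda>_. ennreal (\<bar>r\<bar>^DIM('a)))) {y::'a. norm y < r \<and> sgn y \<in> B}"
    using lborel_affine[of r "0::'a"] r by simp
  also have "\<dots> = ennreal (r ^ DIM('a)) * emeasure lborel ((\<lambda>x. 0 + r *\<^sub>R x) -` {y::'a. norm y < r \<and> sgn y \<in> B})"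
    using r by (subst emeasure_density) (auto simp: nn_integral_cmult_indicator emeasure_distr)
  also have "(\<lambda>x. 0 + r *\<^sub>R x) -` {y::'a. norm y < r \<and> sgn y \<in> B} = {y::'a. norm y < 1 \<and> sgn y \<in> B}"
    using r by (auto simp: sgn_scaleR)
  finally show ?thesis .
qed

lemma emeasure_radial_measure_lessThan:
  "emeasure (radial_measure TYPE('a::euclidean_space)) {..<r} =
     (if 0 < r then ennreal (r ^ DIM('a) / DIM('a)) else 0)"
proof (cases "0 < r")
  case True
  have D: "DIM('a) = Suc (DIM('a) - 1)" using DIM_positive[where 'a='a] by simp
  have "emeasure (radial_measure TYPE('a)) {..<r} =
    (\<integral>\<^sup>+t. ennreal (t ^ (DIM('a) - 1)) * indicator {0..} t * indicator {..<r} t \<partial>lborel)"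
    unfolding radial_measure_def by (subst emeasure_density) auto
  also have "\<dots> = (\<integral>\<^sup>+t. ennreal (t ^ (DIM('a) - 1)) * indicator {0..r} t \<partial>lborel)"
  proof (rule nn_integral_cong_AE)
    have "AE t in lborel. t \<noteq> r" by (rule AE_lborel_singleton)
    then show "AE t in lborel. ennreal (t ^ (DIM('a) - 1)) * indicator {0..} t * indicator {..<r} t =
       ennreal (t ^ (DIM('a) - 1)) * indicator {0..r} t"
      by eventually_elim (auto simp: indicator_def)
  qed
  also have "\<dots> = ennreal (r ^ DIM('a) / DIM('a) - 0 ^ DIM('a) / DIM('a))"
    using True by (intro nn_integral_FTC_Icc) (auto intro!: derivative_eq_intros)
  finally show ?thesis using True D by (metis (no_types) diff_zero div_0 power_0_Suc)
next
  case False
  have "emeasure (radial_measure TYPE('a)) {..<r} =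
    (\<integral>\<^sup>+t. ennreal (t ^ (DIM('a) - 1)) * indicator {0..} t * indicator {..<r} t \<partial>lborel)"
    unfolding radial_measure_def by (subst emeasure_density) auto
  also have "\<dots> = (\<integral>\<^sup>+(t::real). 0 \<partial>lborel)"
    using False by (intro nn_integral_cong) (auto simp: indicator_def)
  finally show ?thesis using False by simp
qed

lemma sigma_finite_radial_measure: "sigma_finite_measure (radial_measure TYPE('a::euclidean_space))"
proof
  show "\<exists>A. countable A \<and> A \<subseteq> sets (radial_measure TYPE('a)) \<and> \<Union>A = space (radial_measure TYPE('a))
     \<and> (\<forall>a\<in>A. emeasure (radial_measure TYPE('a)) a \<noteq> \<infinity>)"
    by (intro exI[of _ "range (\<lambda>n::nat. {..<real n})"])
       (auto simp: emeasure_radial_measure_lessThan reals_Archimedean2)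
qed

text \<open>
  For a fixed set of directions both sides are measures of the radial set, and the half-lines
  \<open>{..<r}\<close>, on which they agree by homogeneity, generate the Borel sets.
\<close>

lemma polar_product:
  "distr lborel (borel \<Otimes>\<^sub>M borel) (\<lambda>y::'a::euclidean_space. (norm y, sgn y)) =
     radial_measure TYPE('a) \<Otimes>\<^sub>M sphere_measure"
proof (rule pair_measure_eqI[symmetric])
  show "sigma_finite_measure (radial_measure TYPE('a))"
    by (rule sigma_finite_radial_measure)
  show "sigma_finite_measure (sphere_measure :: 'a measure)"
    using finite_measure_sphere_measure by (rule finite_measure.axioms)
  show "sets (radial_measure TYPE('a) \<Otimes>\<^sub>M (sphere_measure :: 'a measure)) =
    sets (distr lborel (borel \<Otimes>\<^sub>M borel) (\<lambda>y::'a. (norm y, sgn y)))"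
    by (simp cong: sets_pair_measure_cong)
  fix A and B :: "'a set" assume "A \<in> sets (radial_measure TYPE('a))" "B \<in> sets sphere_measure"
  then have [measurable]: "A \<in> sets borel" "B \<in> sets borel" by auto
  define P where "P = distr (density lborel (indicator (sgn -` B))) borel (norm :: 'a \<Rightarrow> real)"
  have [measurable]: "sgn -` B \<in> sets (borel :: 'a measure)"
    by (rule measurable_sets_borel[OF measurable_sgn]) simp
  have P: "emeasure P X = emeasure lborel {y::'a. norm y \<in> X \<and> sgn y \<in> B}" if [measurable]: "X \<in> sets borel" for X
  proof -
    have [measurable]: "norm -` X \<in> sets (borel :: 'a measure)"
      by (rule measurable_sets_borel[of norm borel X]) auto
    have "emeasure P X = (\<integral>\<^sup>+y. indicator (sgn -` B) y * indicator (norm -` X) y \<partial>(lborel :: 'a measure))"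
      unfolding P_def by (subst emeasure_distr) (auto simp: emeasure_density)
    also have "\<dots> = (\<integral>\<^sup>+y. indicator {y::'a. norm y \<in> X \<and> sgn y \<in> B} y \<partial>lborel)"
      by (intro nn_integral_cong) (auto simp: indicator_def)
    finally show ?thesis by simp
  qed
  have "P = scale_measure (emeasure sphere_measure B) (radial_measure TYPE('a))"
  proof (rule measure_eqI_generator_eq[where \<Omega> = UNIV and E = "range lessThan" and A = "\<lambda>n. {..<real n}"])
    show "Int_stable (range lessThan :: real set set)"
    proof -
      have "{..<a} \<inter> {..<b} = {..<min a b}" for a b :: real by auto
      then show ?thesis by (auto simp: Int_stable_def)
    qed
    show "sets P = sigma_sets UNIV (range lessThan)"
      unfolding P_def sets_distr by (subst borel_Iio) (rule sets_measure_of, simp)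
    show "sets (scale_measure (emeasure sphere_measure B) (radial_measure TYPE('a))) = sigma_sets UNIV (range lessThan)"
      unfolding sets_scale_measure sets_radial_measure by (subst borel_Iio) (rule sets_measure_of, simp)
    have eq: "emeasure P {..<r} = emeasure (scale_measure (emeasure sphere_measure B) (radial_measure TYPE('a))) {..<r}" for r
    proof (cases "0 < r")
      case True
      have "emeasure P {..<r} = ennreal (r ^ DIM('a)) * emeasure lborel {y::'a. norm y < 1 \<and> sgn y \<in> B}"
        using emeasure_cone_scale[OF \<open>B \<in> sets borel\<close> True] by (simp add: P)
      also have "ennreal (r ^ DIM('a)) = ennreal (r ^ DIM('a) / DIM('a)) * ennreal (real DIM('a))"
        using True by (subst ennreal_mult[symmetric]) auto
      finally show ?thesis using True
        by (simp add: emeasure_radial_measure_lessThan emeasure_sphere_measure mult_ac)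
    next
      case False
      then have "{y::'a. norm y \<in> {..<r} \<and> sgn y \<in> B} = {}"
        by (auto simp: not_less) (meson norm_ge_zero not_less order_trans)
      then show ?thesis using False
        by (simp only: P[OF borel_open[OF open_lessThan]]) (simp add: emeasure_radial_measure_lessThan)
    qed
    then show "emeasure P X = emeasure (scale_measure (emeasure sphere_measure B) (radial_measure TYPE('a))) X"
      if "X \<in> range lessThan" for X
      using that by auto
    interpret S: finite_measure "sphere_measure :: 'a measure" by (rule finite_measure_sphere_measure)
    show "emeasure P {..<real n} \<noteq> \<infinity>" for n
      unfolding eq by (auto simp: emeasure_radial_measure_lessThan ennreal_mult_eq_top_iff S.emeasure_finite)
  qed (auto simp: reals_Archimedean2)
  then have "emeasure P A = emeasure (scale_measure (emeasure sphere_measure B) (radial_measure TYPE('a))) A"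
    by simp
  moreover have "emeasure (distr lborel (borel \<Otimes>\<^sub>M borel) (\<lambda>y::'a. (norm y, sgn y))) (A \<times> B) =
    emeasure lborel {y::'a. norm y \<in> A \<and> sgn y \<in> B}"
    by (subst emeasure_distr) (auto intro!: arg_cong[where f = "emeasure lborel"])
  ultimately show "emeasure (radial_measure TYPE('a)) A * emeasure sphere_measure B =
    emeasure (distr lborel (borel \<Otimes>\<^sub>M borel) (\<lambda>y::'a. (norm y, sgn y))) (A \<times> B)"
    by (simp add: P mult.commute)
qed

lemma nn_integral_polar:
  fixes h :: "'a::euclidean_space \<Rightarrow> ennreal"
  assumes [measurable]: "h \<in> borel_measurable borel"
  shows "(\<integral>\<^sup>+y. h y \<partial>lborel) =
    (\<integral>\<^sup>+t. ennreal (t ^ (DIM('a) - 1)) * indicator {0..} t * (\<integral>\<^sup>+w. h (t *\<^sub>R w) \<partial>sphere_measure) \<partial>lborel)"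
proof -
  interpret S: finite_measure "sphere_measure :: 'a measure" by (rule finite_measure_sphere_measure)
  have "norm y *\<^sub>R sgn y = y" for y :: 'a
    by (cases "y = 0") (auto simp: sgn_div_norm)
  then have "(\<integral>\<^sup>+y. h y \<partial>lborel) = (\<integral>\<^sup>+y. (\<lambda>(t, w). h (t *\<^sub>R w)) (norm y, sgn y) \<partial>lborel)"
    by simp
  also have "\<dots> = (\<integral>\<^sup>+z. (\<lambda>(t, w). h (t *\<^sub>R w)) z \<partial>distr lborel (borel \<Otimes>\<^sub>M borel) (\<lambda>y::'a. (norm y, sgn y)))"
    by (subst nn_integral_distr) auto
  also have "\<dots> = (\<integral>\<^sup>+t. (\<integral>\<^sup>+w. h (t *\<^sub>R w) \<partial>sphere_measure) \<partial>radial_measure TYPE('a))"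
    unfolding polar_product by (subst S.nn_integral_fst[symmetric]) auto
  also have "\<dots> = (\<integral>\<^sup>+t. ennreal (t ^ (DIM('a) - 1)) * indicator {0..} t * (\<integral>\<^sup>+w. h (t *\<^sub>R w) \<partial>sphere_measure) \<partial>lborel)"
    unfolding radial_measure_def by (subst nn_integral_density) auto
  finally show ?thesis .
qed

text \<open>
  The ball of radius \<open>s / 4\<close> about \<open>e\<close> projects into the cap of radius \<open>s\<close> and has radii in an interval
  of length \<open>s / 2\<close>, so polar coordinates bound its volume, of order \<open>s ^ DIM('a)\<close>,
  by a multiple of \<open>s\<close> times the measure of the cap.
\<close>

lemma emeasure_cap_lower:
  "\<exists>k>0. \<forall>e::'a::euclidean_space. \<forall>s. norm e = 1 \<longrightarrow> 0 < s \<longrightarrow> s \<le> 4 \<longrightarrow>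
     ennreal (k * s ^ (DIM('a) - 1)) \<le> emeasure sphere_measure (ball e s)"
proof (intro exI conjI allI impI)
  let ?n = "DIM('a)"
  let ?v = "unit_ball_vol (real ?n)"
  let ?k = "?v / (4 ^ ?n * 2 ^ (?n - 1))"
  have v: "0 < ?v" by simp
  show "0 < ?k" by simp
  fix e :: 'a and s :: real assume e: "norm e = 1" and s: "0 < s" "s \<le> 4"
  let ?S = "emeasure sphere_measure (ball e s)"
  have D: "?n = Suc (?n - 1)" using DIM_positive[where 'a='a] by simp
  have "ennreal (?v * (s / 4) ^ ?n) = emeasure lborel (ball e (s / 4))"
    using s by (simp add: emeasure_ball)
  also have "\<dots> = (\<integral>\<^sup>+y. indicator (ball e (s / 4)) y \<partial>lborel)"
    by simp
  also have "\<dots> = (\<integral>\<^sup>+t. ennreal (t ^ (?n - 1)) * indicator {0..} t * (\<integral>\<^sup>+w. indicator (ball e (s / 4)) (t *\<^sub>R w) \<partial>sphere_measure) \<partial>lborel)"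
    by (rule nn_integral_polar) measurable
  also have "\<dots> \<le> (\<integral>\<^sup>+t. (ennreal (2 ^ (?n - 1)) * ?S) * indicator {1 - s / 4..1 + s / 4} t \<partial>lborel)"
  proof (intro nn_integral_mono)
    fix t :: real
    show "ennreal (t ^ (?n - 1)) * indicator {0..} t * (\<integral>\<^sup>+w. indicator (ball e (s / 4)) (t *\<^sub>R w) \<partial>sphere_measure)
      \<le> (ennreal (2 ^ (?n - 1)) * ?S) * indicator {1 - s / 4..1 + s / 4} t"
    proof (cases "0 \<le> t")
      case True
      have *: "indicator (ball e (s / 4)) (t *\<^sub>R w) \<le> (indicator {1 - s / 4..1 + s / 4} t * indicator (ball e s) w :: ennreal)"
        if w: "norm w = 1" for w :: 'a
      proof (cases "t *\<^sub>R w \<in> ball e (s / 4)")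
        case True': True
        then have d: "norm (e - t *\<^sub>R w) < s / 4" by (simp add: dist_norm)
        have "\<bar>t - 1\<bar> = \<bar>norm e - norm (t *\<^sub>R w)\<bar>" using e w True by simp
        also have "\<dots> \<le> norm (e - t *\<^sub>R w)" by (rule norm_triangle_ineq3)
        finally have t: "\<bar>t - 1\<bar> < s / 4" using d by simp
        have "norm (e - w) \<le> norm (e - t *\<^sub>R w) + norm (t *\<^sub>R w - w)"
          using norm_triangle_ineq[of "e - t *\<^sub>R w" "t *\<^sub>R w - w"] by simp
        also have "t *\<^sub>R w - w = (t - 1) *\<^sub>R w" by (simp add: algebra_simps)
        also have "norm \<dots> = \<bar>t - 1\<bar>" using w by simp
        finally have "norm (e - w) < s" using d t s by linarith
        moreover have "1 - s / 4 \<le> t" "t \<le> 1 + s / 4" using t by linarith+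
        ultimately have "w \<in> ball e s" "t \<in> {1 - s / 4..1 + s / 4}" by (auto simp: dist_norm)
        then show ?thesis by (simp del: atLeastAtMost_iff mem_ball add: indicator_def)
      qed simp
      have "(\<integral>\<^sup>+w. indicator (ball e (s / 4)) (t *\<^sub>R w) \<partial>sphere_measure)
        \<le> (\<integral>\<^sup>+w. indicator {1 - s / 4..1 + s / 4} t * indicator (ball e s) w \<partial>sphere_measure)"
        using AE_sphere_measure by (intro nn_integral_mono_AE) (auto elim!: eventually_mono simp del: mem_ball intro!: *)
      also have "\<dots> = indicator {1 - s / 4..1 + s / 4} t * ?S"
        by (subst nn_integral_cmult_indicator) auto
      finally have "ennreal (t ^ (?n - 1)) * indicator {0..} t * (\<integral>\<^sup>+w. indicator (ball e (s / 4)) (t *\<^sub>R w) \<partial>sphere_measure)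
        \<le> ennreal (t ^ (?n - 1)) * 1 * (indicator {1 - s / 4..1 + s / 4} t * ?S)"
        by (intro mult_mono) (auto simp: indicator_def)
      also have "\<dots> \<le> ennreal (2 ^ (?n - 1)) * 1 * (indicator {1 - s / 4..1 + s / 4} t * ?S)"
      proof (cases "t \<in> {1 - s / 4..1 + s / 4}")
        case True
        then have "t ^ (?n - 1) \<le> 2 ^ (?n - 1)" using s \<open>0 \<le> t\<close> by (intro power_mono) auto
        then show ?thesis by (intro mult_right_mono) (auto intro: ennreal_leI)
      qed simp
      finally show ?thesis by (simp add: mult_ac)
    qed simp
  qed
  also have "\<dots> = (ennreal (2 ^ (?n - 1)) * ?S) * ennreal (s / 2)"
    using s by (subst nn_integral_cmult_indicator) auto
  also have "\<dots> = ennreal (2 ^ (?n - 1) * (s / 2)) * ?S"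
    using s by (subst ennreal_mult) (auto simp only: mult_ac zero_le_power zero_le_numeral)
  finally have *: "ennreal (?v * (s / 4) ^ ?n) \<le> ennreal (2 ^ (?n - 1) * (s / 2)) * ?S" .
  have "ennreal (?k * s ^ (?n - 1)) = ennreal (1 / (2 ^ (?n - 1) * s)) * ennreal (?v * (s / 4) ^ ?n)"
  proof -
    have "?k * s ^ (?n - 1) = 1 / (2 ^ (?n - 1) * s) * (?v * (s / 4) ^ ?n)"
    proof -
      have "s ^ ?n = s * s ^ (?n - 1)" using D by (metis power_Suc)
      then show ?thesis using s by (simp add: power_divide field_simps)
    qed
    then show ?thesis using s v by (simp add: ennreal_mult[symmetric] less_imp_le)
  qed
  also have "\<dots> \<le> ennreal (1 / (2 ^ (?n - 1) * s)) * (ennreal (2 ^ (?n - 1) * (s / 2)) * ?S)"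
    by (intro mult_left_mono *) simp
  also have "\<dots> = ennreal (1 / (2 ^ (?n - 1) * s) * (2 ^ (?n - 1) * (s / 2))) * ?S"
    using s by (subst ennreal_mult) (auto simp: mult.assoc)
  also have "1 / (2 ^ (?n - 1) * s) * (2 ^ (?n - 1) * (s / 2)) = 1 / 2"
    using s by simp
  also have "ennreal (1 / 2) * ?S \<le> 1 * ?S"
    by (intro mult_right_mono order_trans[OF ennreal_leI[of "1 / 2" 1]]) auto
  finally show "ennreal (?k * s ^ (?n - 1)) \<le> ?S" by simp
qed

text \<open>
  Thickened radially by \<open>s\<close>, the cap still lies in the ball of radius \<open>2 * s\<close> about \<open>e\<close>.
\<close>

lemma emeasure_cap_upper:
  fixes e :: "'a::euclidean_space"
  assumes e: "norm e = 1" and s: "0 < s"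
  shows "emeasure sphere_measure (ball e s)
    \<le> ennreal (unit_ball_vol (real DIM('a)) * 2 ^ DIM('a) * s ^ (DIM('a) - 1))"
proof -
  let ?n = "DIM('a)"
  let ?v = "unit_ball_vol (real ?n)"
  have v: "0 < ?v" by simp
  let ?S = "emeasure sphere_measure (ball e s)"
  have D: "?n = Suc (?n - 1)" using DIM_positive[where 'a='a] by simp
  have "?S * ennreal s = (\<integral>\<^sup>+t. ?S * indicator {1..1 + s} t \<partial>lborel)"
    using s by (subst nn_integral_cmult_indicator) auto
  also have "\<dots> \<le> (\<integral>\<^sup>+t. ennreal (t ^ (?n - 1)) * indicator {0..} t * (\<integral>\<^sup>+w. indicator (ball e (2 * s)) (t *\<^sub>R w) \<partial>sphere_measure) \<partial>lborel)"
  proof (intro nn_integral_mono)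
    fix t :: real
    show "?S * indicator {1..1 + s} t \<le> ennreal (t ^ (?n - 1)) * indicator {0..} t * (\<integral>\<^sup>+w. indicator (ball e (2 * s)) (t *\<^sub>R w) \<partial>sphere_measure)"
    proof (cases "t \<in> {1..1 + s}")
      case True
      have *: "indicator (ball e s) w \<le> (indicator (ball e (2 * s)) (t *\<^sub>R w) :: ennreal)"
        if w: "norm w = 1" for w :: 'a
      proof (cases "w \<in> ball e s")
        case True': True
        have "norm (e - t *\<^sub>R w) \<le> norm (e - w) + norm (w - t *\<^sub>R w)"
          using norm_triangle_ineq[of "e - w" "w - t *\<^sub>R w"] by simp
        also have "w - t *\<^sub>R w = (1 - t) *\<^sub>R w" by (simp add: algebra_simps)
        also have "norm \<dots> = t - 1" using w True by simp
        finally have "t *\<^sub>R w \<in> ball e (2 * s)" using True' True by (auto simp: dist_norm)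
        then show ?thesis by (simp del: mem_ball add: indicator_def)
      qed simp
      have "?S = (\<integral>\<^sup>+w. indicator (ball e s) w \<partial>sphere_measure)" by simp
      also have "\<dots> \<le> (\<integral>\<^sup>+w. indicator (ball e (2 * s)) (t *\<^sub>R w) \<partial>sphere_measure)"
        using AE_sphere_measure by (intro nn_integral_mono_AE) (auto elim!: eventually_mono simp del: mem_ball intro!: *)
      finally have "1 * ?S \<le> ennreal (t ^ (?n - 1)) * (\<integral>\<^sup>+w. indicator (ball e (2 * s)) (t *\<^sub>R w) \<partial>sphere_measure)"
        using True by (intro mult_mono) (auto simp: one_le_power)
      then show ?thesis using True by simp
    qed simp
  qed
  also have "\<dots> = (\<integral>\<^sup>+y. indicator (ball e (2 * s)) y \<partial>lborel)"
    by (rule nn_integral_polar[symmetric]) measurable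
  also have "\<dots> = ennreal (?v * (2 * s) ^ ?n)"
    using s by (simp add: emeasure_ball)
  finally have "ennreal (1 / s) * (?S * ennreal s) \<le> ennreal (1 / s) * ennreal (?v * (2 * s) ^ ?n)"
    by (intro mult_left_mono) auto
  also have "\<dots> = ennreal (?v * 2 ^ ?n * s ^ (?n - 1))"
  proof -
    have "s ^ ?n = s * s ^ (?n - 1)" using D by (metis power_Suc)
    then show ?thesis using s v by (simp add: power_mult_distrib ennreal_mult[symmetric] less_imp_le)
  qed
  also have "ennreal (1 / s) * (?S * ennreal s) = ennreal (1 / s * s) * ?S"
    using s by (subst ennreal_mult) (auto simp: mult_ac)
  finally show ?thesis using s by simp
qed

text \<open>
  Every cap lies in a cap of at most comparable radius from one countable doubling family, so
  integrals over arbitrary caps are controlled by a single maximal function that is also measurable in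
  parameters.
\<close>

lemma countable_cap_family:
  "\<exists>Q :: ('a::euclidean_space \<times> real) set. countable Q \<and> (\<exists>K. doubling_on Q sphere_measure K) \<and>
    (\<exists>C>0. \<forall>e w s k. norm e = 1 \<longrightarrow> norm w = 1 \<longrightarrow> w \<in> ball e s \<longrightarrow> k \<in> borel_measurable borel \<longrightarrow>
      (\<integral>\<^sup>+z\<in>ball e s. k z \<partial>sphere_measure) \<le> ennreal (C * s ^ (DIM('a) - 1)) * ball_maximal Q sphere_measure k w)"
proof -
  let ?n = "DIM('a)"
  let ?v = "unit_ball_vol (real ?n)"
  have v: "0 < ?v" by simp
  interpret S: finite_measure "sphere_measure :: 'a measure" by (rule finite_measure_sphere_measure)
  obtain k0 where k0: "0 < k0" "\<And>(e::'a) s. norm e = 1 \<Longrightarrow> 0 < s \<Longrightarrow> s \<le> 4 \<Longrightarrow>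
     ennreal (k0 * s ^ (?n - 1)) \<le> emeasure sphere_measure (ball e s)"
    using emeasure_cap_lower[where 'a='a] by blast
  obtain D where D: "countable D" "D \<subseteq> sphere (0::'a) 1" "sphere 0 1 \<subseteq> closure D"
    using separable[of "sphere (0::'a) 1"] by blast
  define Q :: "('a \<times> real) set" where "Q = D \<times> (\<rat> \<inter> {0<..4})"
  have "countable Q" unfolding Q_def using D countable_rat by (intro countable_SIGMA) auto
  moreover have "doubling_on Q sphere_measure (?v * 2 ^ ?n * 5 ^ (?n - 1) / k0)"
    unfolding doubling_on_def
  proof (intro conjI exI[of _ 4])
    show "0 < ?v * 2 ^ ?n * 5 ^ (?n - 1) / k0" using k0 v by simp
    show "\<forall>(c, r)\<in>Q. 0 < r \<and> r \<le> 4 \<and> emeasure sphere_measure (ball c (5 * r)) \<le>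
       ennreal (?v * 2 ^ ?n * 5 ^ (?n - 1) / k0) * emeasure sphere_measure (ball c r)"
    proof (clarify, intro conjI)
      fix c r assume "(c, r) \<in> Q"
      then have c: "norm c = 1" and r: "0 < r" "r \<le> 4" using D(2) by (auto simp: Q_def)
      show "0 < r" "r \<le> 4" by fact+
      have "emeasure sphere_measure (ball c (5 * r)) \<le> ennreal (?v * 2 ^ ?n * (5 * r) ^ (?n - 1))"
        using r by (intro emeasure_cap_upper c) auto
      also have "?v * 2 ^ ?n * (5 * r) ^ (?n - 1) = (?v * 2 ^ ?n * 5 ^ (?n - 1) / k0) * (k0 * r ^ (?n - 1))"
        using k0 by (simp add: power_mult_distrib)
      also have "ennreal \<dots> = ennreal (?v * 2 ^ ?n * 5 ^ (?n - 1) / k0) * ennreal (k0 * r ^ (?n - 1))"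
        using k0 v r by (intro ennreal_mult) (auto simp: less_imp_le)
      also have "\<dots> \<le> ennreal (?v * 2 ^ ?n * 5 ^ (?n - 1) / k0) * emeasure sphere_measure (ball c r)"
        by (intro mult_left_mono k0 c r) auto
      finally show "emeasure sphere_measure (ball c (5 * r)) \<le> \<dots>" .
    qed
  qed
  moreover have "(\<integral>\<^sup>+z\<in>ball e s. k z \<partial>sphere_measure)
     \<le> ennreal ((?v * 2 ^ ?n * (3 / 2) ^ (?n - 1)) * s ^ (?n - 1)) * ball_maximal Q sphere_measure k w"
    if e: "norm e = 1" and w: "norm w = 1" "w \<in> ball e s" and [measurable]: "k \<in> borel_measurable borel" for e w :: 'a and s k
  proof -
    have s: "0 < s" using w(2) by (metis ball_empty empty_iff not_le)
    \<comment> \<open>A cap of radius above 2 is the whole sphere, so larger radii can be cut off and the family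
      keeps bounded radii.\<close>
    define s' where "s' = min s (5 / 2)"
    have s': "0 < s'" "s' \<le> s" "s' \<le> 5 / 2" using s by (auto simp: s'_def)
    have "e \<in> closure D" using D(3) e by auto
    then obtain c where c: "c \<in> D" "dist c e < s' / 8"
      using s'(1) by (auto simp: closure_approachable dest!: spec[of _ "s' / 8"])
    obtain r where r: "r \<in> \<rat>" "9 / 8 * s' < r" "r < 3 / 2 * s'"
      using Rats_dense_in_real[of "9 / 8 * s'" "3 / 2 * s'"] s' by auto
    have cn: "norm c = 1" using c D(2) by auto
    have Q: "(c, r) \<in> Q" using c r s' by (auto simp: Q_def)
    have r0: "0 < r" "r \<le> 4" using r s' by auto
    have sub: "z \<in> ball c r" if z: "norm z = 1" "z \<in> ball e s" for z
    proof (cases "s \<le> 5 / 2")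
      case True
      then have "s' = s" by (simp add: s'_def)
      then have "dist c z < r" using dist_triangle[of c z e] z c r by auto
      then show ?thesis by simp
    next
      case False
      then have "s' = 5 / 2" by (simp add: s'_def)
      then have "dist c z < r" using norm_triangle_ineq4[of c z] z cn r by (auto simp: dist_norm)
      then show ?thesis by simp
    qed
    let ?m = "emeasure sphere_measure (ball c r)"
    have m0: "?m \<noteq> 0"
      using k0(2)[OF cn r0] k0(1) r0 by (auto simp: ennreal_le_iff2 mult_le_0_iff) 
    have "(\<integral>\<^sup>+z\<in>ball e s. k z \<partial>sphere_measure) \<le> (\<integral>\<^sup>+z\<in>ball c r. k z \<partial>sphere_measure)"
      using AE_sphere_measure
      by (intro nn_integral_mono_AE) (auto elim!: eventually_mono simp: indicator_def dest: sub[unfolded mem_ball])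
    also have "\<dots> = ?m * ((\<integral>\<^sup>+z\<in>ball c r. k z \<partial>sphere_measure) / ?m)"
      using m0 by (simp add: ennreal_times_divide mult.commute[of ?m] mult_divide_eq_ennreal S.emeasure_finite)
    also have "\<dots> \<le> ?m * ball_maximal Q sphere_measure k w"
      by (intro mult_left_mono ball_average_le_ball_maximal[OF Q] sub w) auto
    also have "\<dots> \<le> ennreal (?v * 2 ^ ?n * r ^ (?n - 1)) * ball_maximal Q sphere_measure k w"
      by (intro mult_right_mono emeasure_cap_upper cn r0) auto
    also have "\<dots> \<le> ennreal ((?v * 2 ^ ?n * (3 / 2) ^ (?n - 1)) * s ^ (?n - 1)) * ball_maximal Q sphere_measure k w"
    proof (intro mult_right_mono ennreal_leI)
      have "r ^ (?n - 1) \<le> (3 / 2 * s) ^ (?n - 1)"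
        using r r0 s' by (intro power_mono) auto
      then have "?v * 2 ^ ?n * r ^ (?n - 1) \<le> ?v * 2 ^ ?n * (3 / 2 * s) ^ (?n - 1)"
        by (intro mult_left_mono) auto
      then show "?v * 2 ^ ?n * r ^ (?n - 1) \<le> ?v * 2 ^ ?n * (3 / 2) ^ (?n - 1) * s ^ (?n - 1)"
        by (simp only: power_mult_distrib mult.assoc)
    qed auto
    finally show ?thesis .
  qed
  moreover have "0 < ?v * 2 ^ ?n * (3 / 2) ^ (?n - 1)" using v by simp
  ultimately show ?thesis by blast
qed

section \<open>A Schur test for the radial variable\<close>

text \<open>
  Jensen's inequality for the measures \<open>k x y dy\<close>, then Fubini's theorem and the same mass bound
  in the other variable.
\<close>

lemma Schur_test_symmetric:
  fixes k :: "'b \<Rightarrow> 'b \<Rightarrow> real"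
  assumes N: "sigma_finite_measure N"
    and k [measurable]: "case_prod k \<in> borel_measurable (N \<Otimes>\<^sub>M N)"
    and sym: "\<And>x y. k x y = k y x"
    and L: "0 < L" "\<And>x. x \<in> space N \<Longrightarrow> (\<integral>\<^sup>+y. ennreal (k x y) \<partial>N) \<le> ennreal L"
    and H [measurable]: "H \<in> borel_measurable N" and p: "1 \<le> p"
  shows "(\<integral>\<^sup>+x. ennreal_powr (\<integral>\<^sup>+y. ennreal (k x y) * H y \<partial>N) p \<partial>N)
    \<le> ennreal (L powr p) * (\<integral>\<^sup>+y. ennreal_powr (H y) p \<partial>N)"
proof -
  interpret sigma_finite_measure N by fact
  interpret NN: pair_sigma_finite N N ..
  have jensen: "ennreal_powr (\<integral>\<^sup>+y. ennreal (k x y) * H y \<partial>N) p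
      \<le> ennreal (L powr (p - 1)) * (\<integral>\<^sup>+y. ennreal (k x y) * ennreal_powr (H y) p \<partial>N)"
    if x: "x \<in> space N" for x
  proof -
    have [measurable]: "(\<lambda>y. k x y) \<in> borel_measurable N"
      using measurable_compose[OF measurable_Pair1'[OF x] k] by simp
    have "ennreal_powr (\<integral>\<^sup>+y. H y \<partial>density N (\<lambda>y. ennreal (k x y))) p
      \<le> ennreal (L powr (p - 1)) * (\<integral>\<^sup>+y. ennreal_powr (H y) p \<partial>density N (\<lambda>y. ennreal (k x y)))"
    proof (rule nn_integral_Jensen_powr[OF _ p L(1)])
      show "emeasure (density N (\<lambda>y. ennreal (k x y))) (space (density N (\<lambda>y. ennreal (k x y)))) \<le> ennreal L"
        using L(2)[OF x] by (simp add: emeasure_density cong: nn_integral_cong)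
    qed simp
    then show ?thesis
      by (simp add: nn_integral_density)
  qed
  have "(\<integral>\<^sup>+x. ennreal_powr (\<integral>\<^sup>+y. ennreal (k x y) * H y \<partial>N) p \<partial>N)
    \<le> (\<integral>\<^sup>+x. ennreal (L powr (p - 1)) * (\<integral>\<^sup>+y. ennreal (k x y) * ennreal_powr (H y) p \<partial>N) \<partial>N)"
    by (intro nn_integral_mono jensen)
  also have "\<dots> = ennreal (L powr (p - 1)) * (\<integral>\<^sup>+x. (\<integral>\<^sup>+y. ennreal (k x y) * ennreal_powr (H y) p \<partial>N) \<partial>N)"
    by (intro nn_integral_cmult) measurable
  also have "(\<integral>\<^sup>+x. (\<integral>\<^sup>+y. ennreal (k x y) * ennreal_powr (H y) p \<partial>N) \<partial>N)
    = (\<integral>\<^sup>+y. (\<integral>\<^sup>+x. ennreal (k x y) * ennreal_powr (H y) p \<partial>N) \<partial>N)"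
    by (rule NN.Fubini'[symmetric]) measurable
  also have "\<dots> \<le> (\<integral>\<^sup>+y. ennreal L * ennreal_powr (H y) p \<partial>N)"
  proof (intro nn_integral_mono)
    fix y assume y: "y \<in> space N"
    have [measurable]: "(\<lambda>x. k y x) \<in> borel_measurable N"
      using measurable_compose[OF measurable_Pair1'[OF y] k] by simp
    have "(\<integral>\<^sup>+x. ennreal (k x y) * ennreal_powr (H y) p \<partial>N) = (\<integral>\<^sup>+x. ennreal (k y x) \<partial>N) * ennreal_powr (H y) p"
      by (subst nn_integral_multc) (auto simp: sym[of _ y])
    also have "\<dots> \<le> ennreal L * ennreal_powr (H y) p"
      by (intro mult_right_mono L y) auto
    finally show "(\<integral>\<^sup>+x. ennreal (k x y) * ennreal_powr (H y) p \<partial>N) \<le> \<dots>" .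
  qed
  also have "\<dots> = ennreal L * (\<integral>\<^sup>+y. ennreal_powr (H y) p \<partial>N)"
    by (intro nn_integral_cmult) measurable
  also have "ennreal (L powr (p - 1)) * (ennreal L * (\<integral>\<^sup>+y. ennreal_powr (H y) p \<partial>N))
     = ennreal (L powr p) * (\<integral>\<^sup>+y. ennreal_powr (H y) p \<partial>N)"
    using L(1) by (simp add: mult.assoc[symmetric] ennreal_mult[symmetric] powr_diff)
  finally show ?thesis by (simp add: mult_left_mono)
qed

text \<open>
  The kernel that controls all large balls at once, once the Gaussian weights are divided out.
  Since the derivative of \<open>t\<^sup>2\<close> is \<open>2 * t\<close>, the bound \<open>min R t \<le> t\<close> makes its integrals elementary.
\<close>

definition radial_kernel :: "real \<Rightarrow> real \<Rightarrow> real \<Rightarrow> real" where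
  "radial_kernel \<delta> R t = min R t * exp (- \<delta> * \<bar>R\<^sup>2 - t\<^sup>2\<bar>)"

lemma radial_kernel_sym: "radial_kernel \<delta> R t = radial_kernel \<delta> t R"
  by (simp add: radial_kernel_def min.commute abs_minus_commute)

lemma borel_measurable_radial_kernel [measurable]:
  "(\<lambda>(R, t). radial_kernel \<delta> R t) \<in> borel_measurable (borel \<Otimes>\<^sub>M borel)"
  unfolding radial_kernel_def by measurable

lemma nn_integral_radial_kernel_le:
  assumes d: "0 < \<delta>" and R: "0 \<le> R"
  shows "(\<integral>\<^sup>+t. ennreal (radial_kernel \<delta> R t) * indicator {0..} t \<partial>lborel) \<le> ennreal (1 / \<delta>)"
proof -
  have "(\<integral>\<^sup>+t. ennreal (radial_kernel \<delta> R t) * indicator {0..} t \<partial>lborel) \<le>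
    (\<integral>\<^sup>+t. ennreal (t * exp (- \<delta> * (R\<^sup>2 - t\<^sup>2))) * indicator {0..R} t + ennreal (t * exp (- \<delta> * (t\<^sup>2 - R\<^sup>2))) * indicator {R..} t \<partial>lborel)"
  proof (intro nn_integral_mono)
    fix t
    show "ennreal (radial_kernel \<delta> R t) * indicator {0..} t \<le>
      ennreal (t * exp (- \<delta> * (R\<^sup>2 - t\<^sup>2))) * indicator {0..R} t + ennreal (t * exp (- \<delta> * (t\<^sup>2 - R\<^sup>2))) * indicator {R..} t"
    proof (cases "0 \<le> t")
      case True
      show ?thesis
      proof (cases "t \<le> R")
        case True': True
        then have "t\<^sup>2 \<le> R\<^sup>2" using True by (intro power_mono) auto
        then show ?thesis using True True' by (simp add: radial_kernel_def min_def indicator_def add_increasing2)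
      next
        case False
        then have "R\<^sup>2 \<le> t\<^sup>2" using R by (intro power_mono) auto
        then have "radial_kernel \<delta> R t \<le> t * exp (- \<delta> * (t\<^sup>2 - R\<^sup>2))"
          using False by (auto simp: radial_kernel_def min_def intro!: mult_mono)
        then show ?thesis using True False by (simp add: indicator_def ennreal_leI)
      qed
    qed simp
  qed
  also have "\<dots> = (\<integral>\<^sup>+t. ennreal (t * exp (- \<delta> * (R\<^sup>2 - t\<^sup>2))) * indicator {0..R} t \<partial>lborel)
     + (\<integral>\<^sup>+t. ennreal (t * exp (- \<delta> * (t\<^sup>2 - R\<^sup>2))) * indicator {R..} t \<partial>lborel)"
    by (rule nn_integral_add) auto
  also have "(\<integral>\<^sup>+t. ennreal (t * exp (- \<delta> * (R\<^sup>2 - t\<^sup>2))) * indicator {0..R} t \<partial>lborel)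
    = ennreal (exp (- \<delta> * (R\<^sup>2 - R\<^sup>2)) / (2 * \<delta>) - exp (- \<delta> * (R\<^sup>2 - 0\<^sup>2)) / (2 * \<delta>))"
    using d R by (intro nn_integral_FTC_Icc[where F = "\<lambda>t. exp (- \<delta> * (R\<^sup>2 - t\<^sup>2)) / (2 * \<delta>)"])
      (auto intro!: derivative_eq_intros)
  also have "(\<integral>\<^sup>+t. ennreal (t * exp (- \<delta> * (t\<^sup>2 - R\<^sup>2))) * indicator {R..} t \<partial>lborel)
    = ennreal (0 - (- exp (- \<delta> * (R\<^sup>2 - R\<^sup>2)) / (2 * \<delta>)))"
  proof (rule nn_integral_FTC_atLeast[where F = "\<lambda>t. - exp (- \<delta> * (t\<^sup>2 - R\<^sup>2)) / (2 * \<delta>)"])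
    show "((\<lambda>t. - exp (- \<delta> * (t\<^sup>2 - R\<^sup>2)) / (2 * \<delta>)) \<longlongrightarrow> 0) at_top"
      using d by real_asymp
  qed (use d R in \<open>auto intro!: derivative_eq_intros\<close>)
  also have "ennreal (exp (- \<delta> * (R\<^sup>2 - R\<^sup>2)) / (2 * \<delta>) - exp (- \<delta> * (R\<^sup>2 - 0\<^sup>2)) / (2 * \<delta>))
       + ennreal (0 - (- exp (- \<delta> * (R\<^sup>2 - R\<^sup>2)) / (2 * \<delta>)))
     = ennreal ((1 / (2 * \<delta>) - exp (- \<delta> * R\<^sup>2) / (2 * \<delta>)) + 1 / (2 * \<delta>))"
    using d by (subst ennreal_plus) (auto intro!: divide_right_mono)
  also have "\<dots> \<le> ennreal (1 / \<delta>)"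
    using d by (intro ennreal_leI) (auto simp: field_simps)
  finally show ?thesis .
qed

lemma polynomial_le_exp:
  fixes \<delta> :: real
  assumes "0 < \<delta>"
  shows "\<exists>C>0. \<forall>u\<ge>0. (1 + u) ^ k \<le> C * exp (\<delta> * u)"
proof -
  \<comment> \<open>Chosen so that \<open>1 + u \<le> M * (1 + \<delta> * u / Suc k)\<close>, whose \<open>k\<close>-th power is below an exponential.\<close>
  define M where "M = max 1 (real (Suc k) / \<delta>)"
  have M: "1 \<le> M" "real (Suc k) \<le> M * \<delta>"
    using assms by (auto simp: M_def max_def field_simps)
  have "(1 + u) ^ k \<le> M ^ k * exp (\<delta> * u)" if u: "0 \<le> u" for u
  proof -
    have "u * real (Suc k) \<le> u * (M * \<delta>)"
      using M u by (intro mult_left_mono) auto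
    then have "u \<le> M * (\<delta> * u / real (Suc k))"
      by (simp add: field_simps)
    then have "1 + u \<le> M * (1 + \<delta> * u / real (Suc k))"
      using M by (simp add: distrib_left add_mono)
    also have "\<dots> \<le> M * exp (\<delta> * u / real (Suc k))"
      using M by (intro mult_left_mono exp_ge_add_one_self) auto
    finally have "(1 + u) ^ k \<le> (M * exp (\<delta> * u / real (Suc k))) ^ k"
      using u by (intro power_mono) auto
    also have "\<dots> = M ^ k * exp (real k * (\<delta> * u / real (Suc k)))"
      by (simp only: power_mult_distrib exp_of_nat_mult)
    also have "\<dots> \<le> M ^ k * exp (\<delta> * u)"
    proof -
      have "real k * (\<delta> * u / real (Suc k)) = (\<delta> * u) * (real k / real (Suc k))" by simp
      also have "\<dots> \<le> \<delta> * u * 1"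
        using assms u by (intro mult_left_mono) auto
      finally show ?thesis using M by simp
    qed
    finally show ?thesis .
  qed
  moreover have "0 < M ^ k" using M by simp
  ultimately show ?thesis by blast
qed

definition radial_weight :: "nat \<Rightarrow> real \<Rightarrow> real" where
  "radial_weight n t = t ^ n * exp (- t\<^sup>2)"

lemma radial_weight_pos: "0 < t \<Longrightarrow> 0 < radial_weight n t"
  by (simp add: radial_weight_def)

lemma borel_measurable_radial_weight [measurable]: "radial_weight n \<in> borel_measurable borel"
  unfolding radial_weight_def by measurable

text \<open>
  The left-hand side is the radial kernel of a ball at distance \<open>a\<close> from the origin that contains a point
  of norm \<open>R\<close>; the right-hand side is independent of \<open>a\<close>, so that the supremum over all balls becomes one
  integral operator. With \<open>X = t\<^sup>2 - a\<^sup>2\<close> and \<open>Y = R\<^sup>2 - a\<^sup>2\<close>, all polynomial factors are at most a power of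
  \<open>1 + X + Y\<close>, while the exponentials combine to \<open>exp (- (X * (1 - 1 / p) + Y * (1 / p)))\<close>. Because
  \<open>p > 1\<close>, both coefficients are positive; half of this decay absorbs the polynomials and the other half is
  the decay of the radial kernel.
\<close>

lemma large_ball_kernel_le:
  fixes p :: real
  assumes p: "1 < p"
  defines "\<delta> \<equiv> min (1 / p) (1 - 1 / p) / 2"
  shows "\<exists>C>0. \<forall>a t R. 1 \<le> a \<longrightarrow> a \<le> t \<longrightarrow> a \<le> R \<longrightarrow>
    (1 + a * (t - a) + a * (R - a)) ^ n * (a / a ^ n) * exp (a\<^sup>2) * radial_weight n t
      \<le> C * radial_weight n R powr (- 1 / p) * radial_kernel \<delta> R t * radial_weight n t powr (1 / p)"
proof -
  have d: "0 < \<delta>" "2 * \<delta> \<le> 1 / p" "2 * \<delta> \<le> 1 - 1 / p"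
    using p by (auto simp: \<delta>_def min_def)
  obtain C where C: "0 < C" "\<And>u. 0 \<le> u \<Longrightarrow> (1 + u) ^ (2 * n) \<le> C * exp (\<delta> * u)"
    using polynomial_le_exp[OF d(1), of "2 * n"] by blast
  have main: "(1 + a * (t - a) + a * (R - a)) ^ n * (a / a ^ n) * exp (a\<^sup>2) * radial_weight n t
      \<le> C * radial_weight n R powr (- 1 / p) * radial_kernel \<delta> R t * radial_weight n t powr (1 / p)"
    if a: "1 \<le> a" "a \<le> t" "a \<le> R" for a t R
  proof -
    let ?c = "(1 + a * (t - a) + a * (R - a)) ^ n * (a / a ^ n) * exp (a\<^sup>2)"
    define X where "X = t\<^sup>2 - a\<^sup>2"
    define Y where "Y = R\<^sup>2 - a\<^sup>2"
    have X': "X = (t - a) * (t + a)" and Y': "Y = (R - a) * (R + a)"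
      by (simp_all add: X_def Y_def power2_eq_square algebra_simps)
    have X: "0 \<le> X" "a * (t - a) \<le> X" "t \<le> a * (1 + X)"
    proof -
      show "0 \<le> X" using a by (simp add: X')
      show "a * (t - a) \<le> X" unfolding X' using a by (subst mult.commute) (intro mult_left_mono, auto)
      have "(t - a) * 1 \<le> (t - a) * (a * (t + a))"
        using a mult_mono[of 1 a 1 "t + a"] by (intro mult_left_mono) auto
      then show "t \<le> a * (1 + X)" by (simp add: X' algebra_simps)
    qed
    have Y: "0 \<le> Y" "a * (R - a) \<le> Y" "R \<le> a * (1 + Y)"
    proof -
      show "0 \<le> Y" using a by (simp add: Y')
      show "a * (R - a) \<le> Y" unfolding Y' using a by (subst mult.commute) (intro mult_left_mono, auto)
      have "(R - a) * 1 \<le> (R - a) * (a * (R + a))"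
        using a mult_mono[of 1 a 1 "R + a"] by (intro mult_left_mono) auto
      then show "R \<le> a * (1 + Y)" by (simp add: Y' algebra_simps)
    qed
    define T where "T = (1 + X + Y) ^ n"
    have T: "1 \<le> T" unfolding T_def using X Y by (intro one_le_power) auto
    have aT: "0 < a ^ n * T" using a T by simp
    have tn: "t ^ n \<le> a ^ n * T"
    proof -
      have "a * (1 + X) \<le> a * (1 + X + Y)" using Y a by (intro mult_left_mono) auto
      then have "t \<le> a * (1 + X + Y)" using X by linarith
      then have "t ^ n \<le> (a * (1 + X + Y)) ^ n" using a by (intro power_mono) auto
      then show ?thesis by (simp add: T_def power_mult_distrib)
    qed
    have Rn: "R ^ n \<le> a ^ n * T"
    proof -
      have "a * (1 + Y) \<le> a * (1 + X + Y)" using X a by (intro mult_left_mono) auto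
      then have "R \<le> a * (1 + X + Y)" using Y by linarith
      then have "R ^ n \<le> (a * (1 + X + Y)) ^ n" using a by (intro power_mono) auto
      then show ?thesis by (simp add: T_def power_mult_distrib)
    qed
    have first: "(1 + a * (t - a) + a * (R - a)) ^ n \<le> T"
      unfolding T_def using a X Y by (intro power_mono add_mono) auto
    have wt: "radial_weight n t powr (1 - 1 / p) = (t ^ n) powr (1 - 1 / p) * exp (- t\<^sup>2 * (1 - 1 / p))"
      and wR: "radial_weight n R powr (1 / p) = (R ^ n) powr (1 / p) * exp (- R\<^sup>2 / p)"
      using a by (simp_all add: radial_weight_def powr_mult exp_powr_real)
    have prod: "(t ^ n) powr (1 - 1 / p) * (R ^ n) powr (1 / p) \<le> a ^ n * T"
    proof -
      have "(t ^ n) powr (1 - 1 / p) * (R ^ n) powr (1 / p) \<le> (a ^ n * T) powr (1 - 1 / p) * (a ^ n * T) powr (1 / p)"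
        using tn Rn a p by (intro mult_mono powr_mono2) auto
      also have "\<dots> = a ^ n * T"
        using aT by (simp flip: powr_add)
      finally show ?thesis .
    qed
    have eq: "exp (a\<^sup>2) * (exp (- t\<^sup>2 * (1 - 1 / p)) * exp (- R\<^sup>2 / p)) = exp (- (X * (1 - 1 / p) + Y * (1 / p)))"
      by (simp add: X_def Y_def algebra_simps diff_divide_distrib flip: exp_add)
    have "?c * (radial_weight n t powr (1 - 1 / p) * radial_weight n R powr (1 / p))
      \<le> T * (a / a ^ n) * exp (a\<^sup>2) * (radial_weight n t powr (1 - 1 / p) * radial_weight n R powr (1 / p))"
      using a by (intro mult_right_mono first) auto
    also have "\<dots> = (T * (a / a ^ n)) * ((t ^ n) powr (1 - 1 / p) * (R ^ n) powr (1 / p)) * exp (- (X * (1 - 1 / p) + Y * (1 / p)))"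
      unfolding wt wR eq[symmetric] by (simp only: mult_ac)
    also have "\<dots> \<le> (T * (a / a ^ n)) * (a ^ n * T) * exp (- (X * (1 - 1 / p) + Y * (1 / p)))"
      using a T prod by (intro mult_right_mono mult_left_mono) auto
    also have "\<dots> = a * ((1 + (X + Y)) ^ (2 * n) * exp (- (X * (1 - 1 / p) + Y * (1 / p))))"
      using a by (simp add: T_def power_mult power2_eq_square mult_2 power_add add.assoc)
    also have "\<dots> \<le> a * ((C * exp (\<delta> * (X + Y))) * exp (- (2 * \<delta> * (X + Y))))"
    proof (intro mult_left_mono mult_mono)
      have "X * (2 * \<delta>) + Y * (2 * \<delta>) \<le> X * (1 - 1 / p) + Y * (1 / p)"
        using d X Y by (intro add_mono mult_left_mono) auto
      then show "exp (- (X * (1 - 1 / p) + Y * (1 / p))) \<le> exp (- (2 * \<delta> * (X + Y)))"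
        by (simp add: algebra_simps)
    qed (use a C X Y in auto)
    also have "\<dots> = C * (a * exp (- \<delta> * (X + Y)))"
      by (simp add: mult_ac flip: exp_add)
    also have "\<dots> \<le> C * radial_kernel \<delta> R t"
      unfolding radial_kernel_def
    proof (intro mult_left_mono mult_mono)
      have "\<bar>R\<^sup>2 - t\<^sup>2\<bar> \<le> X + Y" using X Y by (simp add: X_def Y_def abs_le_iff)
      then have "\<delta> * \<bar>R\<^sup>2 - t\<^sup>2\<bar> \<le> \<delta> * (X + Y)" using d by (intro mult_left_mono) auto
      then show "exp (- \<delta> * (X + Y)) \<le> exp (- \<delta> * \<bar>R\<^sup>2 - t\<^sup>2\<bar>)" by simp
    qed (use a C in auto)
    finally have *: "?c *
       (radial_weight n t powr (1 - 1 / p) * radial_weight n R powr (1 / p)) \<le> C * radial_kernel \<delta> R t" .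
    have pos: "0 < radial_weight n t" "0 < radial_weight n R"
      using a by (auto intro: radial_weight_pos)
    have "?c * radial_weight n t =
      (?c * (radial_weight n t powr (1 - 1 / p) * radial_weight n R powr (1 / p)))
        * (radial_weight n R powr (- 1 / p) * radial_weight n t powr (1 / p))"
    proof -
      have swap: "K * (u * v) * (v' * u') = K * ((u * u') * (v * v'))" for K u v u' v' :: real
        by (simp add: mult_ac)
      have 1: "radial_weight n t powr (1 - 1 / p) * radial_weight n t powr (1 / p) = radial_weight n t"
        and 2: "radial_weight n R powr (1 / p) * radial_weight n R powr (- 1 / p) = 1"
        using pos by (simp_all flip: powr_add)
      show ?thesis unfolding swap 1 2 by simp
    qed
    also have "\<dots> \<le> (C * radial_kernel \<delta> R t) * (radial_weight n R powr (- 1 / p) * radial_weight n t powr (1 / p))"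
      by (intro mult_right_mono *) auto
    finally show ?thesis by (simp only: mult_ac)
  qed
  show ?thesis using C(1) main by blast
qed

section \<open>The Gaussian measure of balls\<close>

lemma ennreal_divide_le:
  fixes I m :: ennreal
  assumes "0 < k" "ennreal k \<le> m"
  shows "I / m \<le> ennreal (1 / k) * I"
proof -
  have "ennreal k * ennreal (1 / k) \<le> m * ennreal (1 / k)"
    by (intro mult_right_mono assms) simp
  then have "1 \<le> m * ennreal (1 / k)"
    using assms by (simp add: ennreal_mult[symmetric])
  then have "1 * I \<le> m * ennreal (1 / k) * I"
    by (intro mult_right_mono) auto
  moreover have "0 < m"
    using assms by (metis ennreal_less_zero_iff order_less_le_trans)
  ultimately show ?thesis
    by (intro divide_le_posI_ennreal) (auto simp: mult.assoc)
qed

text \<open>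
  The Gaussian measure on the Borel sets, where product measures and measurability are
  unproblematic.
\<close>

definition gauss_borel :: "'a::euclidean_space measure" where
  "gauss_borel = density lborel (\<lambda>x. ennreal (pi powr (- (real DIM('a) / 2)) * exp (- (norm x)\<^sup>2)))"

lemma sets_gauss_borel [simp, measurable_cong]: "sets gauss_borel = sets borel"
  by (simp add: gauss_borel_def)

lemma space_gauss_borel [simp]: "space gauss_borel = UNIV"
  by (simp add: gauss_borel_def)

lemma nn_integral_gauss_borel:
  fixes h :: "'a::euclidean_space \<Rightarrow> ennreal"
  assumes [measurable]: "h \<in> borel_measurable borel"
  shows "(\<integral>\<^sup>+x. h x \<partial>gauss_borel) =
    (\<integral>\<^sup>+x. ennreal (pi powr (- (real DIM('a) / 2)) * exp (- (norm x)\<^sup>2)) * h x \<partial>lborel)"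
  unfolding gauss_borel_def by (subst nn_integral_density) auto

lemma nn_integral_gauss_borel_polar:
  fixes h :: "'a::euclidean_space \<Rightarrow> ennreal"
  assumes [measurable]: "h \<in> borel_measurable borel"
  shows "(\<integral>\<^sup>+x. h x \<partial>gauss_borel) =
    (\<integral>\<^sup>+t. ennreal (pi powr (- (real DIM('a) / 2)) * radial_weight (DIM('a) - 1) t) * indicator {0..} t *
       (\<integral>\<^sup>+w. h (t *\<^sub>R w) \<partial>sphere_measure) \<partial>lborel)"
proof -
  let ?g = "pi powr (- (real DIM('a) / 2))"
  have "(\<integral>\<^sup>+x. h x \<partial>gauss_borel) =
     (\<integral>\<^sup>+t. ennreal (t ^ (DIM('a) - 1)) * indicator {0..} t *
        (\<integral>\<^sup>+w. ennreal (?g * exp (- (norm (t *\<^sub>R w))\<^sup>2)) * h (t *\<^sub>R w) \<partial>sphere_measure) \<partial>lborel)"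
    unfolding nn_integral_gauss_borel[OF assms] by (rule nn_integral_polar) measurable
  also have "\<dots> = (\<integral>\<^sup>+t. ennreal (?g * radial_weight (DIM('a) - 1) t) * indicator {0..} t *
       (\<integral>\<^sup>+w. h (t *\<^sub>R w) \<partial>sphere_measure) \<partial>lborel)"
  proof (intro nn_integral_cong)
    fix t :: real
    have "(\<integral>\<^sup>+w. ennreal (?g * exp (- (norm (t *\<^sub>R w))\<^sup>2)) * h (t *\<^sub>R w) \<partial>sphere_measure)
      = (\<integral>\<^sup>+w. ennreal (?g * exp (- t\<^sup>2)) * h (t *\<^sub>R w) \<partial>sphere_measure)"
      using AE_sphere_measure by (intro nn_integral_cong_AE) (auto elim!: eventually_mono)
    also have "\<dots> = ennreal (?g * exp (- t\<^sup>2)) * (\<integral>\<^sup>+w. h (t *\<^sub>R w) \<partial>sphere_measure)"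
      by (intro nn_integral_cmult) measurable
    finally have *: "(\<integral>\<^sup>+w. ennreal (?g * exp (- (norm (t *\<^sub>R w))\<^sup>2)) * h (t *\<^sub>R w) \<partial>sphere_measure) = \<dots>" .
    show "ennreal (t ^ (DIM('a) - 1)) * indicator {0..} t *
        (\<integral>\<^sup>+w. ennreal (?g * exp (- (norm (t *\<^sub>R w))\<^sup>2)) * h (t *\<^sub>R w) \<partial>sphere_measure) =
      ennreal (?g * radial_weight (DIM('a) - 1) t) * indicator {0..} t * (\<integral>\<^sup>+w. h (t *\<^sub>R w) \<partial>sphere_measure)"
    proof (cases "0 \<le> t")
      case True
      then have "ennreal (?g * radial_weight (DIM('a) - 1) t) = ennreal (t ^ (DIM('a) - 1)) * ennreal (?g * exp (- t\<^sup>2))"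
        by (simp add: radial_weight_def ennreal_mult[symmetric] mult_ac)
      then show ?thesis unfolding * using True by (simp add: mult.assoc)
    qed simp
  qed
  finally show ?thesis .
qed

text \<open>
  In polar coordinates \<open>- t\<^sup>2 \<le> 1 - 2 * t\<close> leaves the decay \<open>exp (- t)\<close> after the power of \<open>t\<close> is absorbed.
\<close>

lemma finite_measure_gauss_borel: "finite_measure (gauss_borel :: 'a::euclidean_space measure)"
proof
  let ?g = "pi powr (- (real DIM('a) / 2))"
  interpret S: finite_measure "sphere_measure :: 'a measure" by (rule finite_measure_sphere_measure)
  obtain C :: real where C: "0 < C" "\<forall>u\<ge>0. (1 + u) ^ (DIM('a) - 1) \<le> C * exp (1 * u)"
    using polynomial_le_exp[OF zero_less_one] by blast
  have W: "radial_weight (DIM('a) - 1) t \<le> C * exp 1 * exp (- t)" if "0 \<le> t" for t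
  proof -
    have "t ^ (DIM('a) - 1) \<le> (1 + t) ^ (DIM('a) - 1)" using that by (intro power_mono) auto
    also have "\<dots> \<le> C * exp t" using C(2) that by simp
    finally have 1: "t ^ (DIM('a) - 1) \<le> C * exp t" .
    have "0 \<le> (t - 1)\<^sup>2" by simp
    then have "- t\<^sup>2 \<le> 1 - 2 * t" by (simp add: power2_eq_square algebra_simps)
    then have "radial_weight (DIM('a) - 1) t \<le> (C * exp t) * exp (1 - 2 * t)"
      unfolding radial_weight_def using 1 C that by (intro mult_mono) auto
    also have "\<dots> = C * exp 1 * exp (- t)" by (simp add: mult.assoc flip: exp_add)
    finally show ?thesis .
  qed
  have "emeasure (gauss_borel :: 'a measure) UNIV = (\<integral>\<^sup>+(x::'a). 1 \<partial>gauss_borel)" by simp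
  also have "\<dots> = (\<integral>\<^sup>+t. ennreal (?g * radial_weight (DIM('a) - 1) t) * indicator {0..} t *
       (\<integral>\<^sup>+w. 1 \<partial>(sphere_measure :: 'a measure)) \<partial>lborel)"
    by (rule nn_integral_gauss_borel_polar) simp
  also have "\<dots> \<le> (\<integral>\<^sup>+t. (ennreal (exp (- t)) * indicator {0..} t) * (ennreal (?g * C * exp 1) * emeasure (sphere_measure :: 'a measure) UNIV) \<partial>lborel)"
  proof (intro nn_integral_mono)
    fix t :: real
    show "ennreal (?g * radial_weight (DIM('a) - 1) t) * indicator {0..} t * (\<integral>\<^sup>+w. 1 \<partial>(sphere_measure :: 'a measure))
      \<le> (ennreal (exp (- t)) * indicator {0..} t) * (ennreal (?g * C * exp 1) * emeasure (sphere_measure :: 'a measure) UNIV)"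
    proof (cases "0 \<le> t")
      case True
      have "ennreal (?g * radial_weight (DIM('a) - 1) t) \<le> ennreal (?g * (C * exp 1 * exp (- t)))"
        by (intro ennreal_leI mult_left_mono W True) simp
      also have "\<dots> = ennreal (exp (- t)) * ennreal (?g * C * exp 1)"
        using C by (simp add: ennreal_mult[symmetric] mult_ac)
      finally show ?thesis using True by (simp add: mult_right_mono mult.assoc[symmetric])
    qed simp
  qed
  also have "\<dots> = (\<integral>\<^sup>+t. ennreal (exp (- t)) * indicator {0..} t \<partial>lborel) * (ennreal (?g * C * exp 1) * emeasure (sphere_measure :: 'a measure) UNIV)"
    by (rule nn_integral_multc) measurable
  also have "(\<integral>\<^sup>+(t::real). ennreal (exp (- t)) * indicator {0..} t \<partial>lborel) = ennreal (0 - (- exp (- 0)))"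
  proof (rule nn_integral_FTC_atLeast[where F = "\<lambda>t. - exp (- t)"])
    show "((\<lambda>t::real. - exp (- t)) \<longlongrightarrow> 0) at_top" by real_asymp
  qed (auto intro!: derivative_eq_intros)
  also have "ennreal (0 - (- exp (- 0))) * (ennreal (?g * C * exp 1) * emeasure (sphere_measure :: 'a measure) UNIV) < \<infinity>"
    using S.emeasure_finite[of UNIV] by (simp add: ennreal_mult_eq_top_iff less_top[symmetric])
  finally show "emeasure (gauss_borel :: 'a measure) (space gauss_borel) \<noteq> \<infinity>" by simp
qed

lemma gauss_borel_ge:
  fixes A :: "'a::euclidean_space set"
  assumes [measurable]: "A \<in> sets borel" and A: "\<And>y. y \<in> A \<Longrightarrow> (norm y)\<^sup>2 \<le> b"
  shows "ennreal (pi powr (- (real DIM('a) / 2)) * exp (- b)) * emeasure lborel A \<le> emeasure gauss_borel A"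
proof -
  have "ennreal (pi powr (- (real DIM('a) / 2)) * exp (- b)) * emeasure lborel A =
    (\<integral>\<^sup>+y. ennreal (pi powr (- (real DIM('a) / 2)) * exp (- b)) * indicator A y \<partial>lborel)"
    by (subst nn_integral_cmult_indicator) auto
  also have "\<dots> \<le> (\<integral>\<^sup>+y. ennreal (pi powr (- (real DIM('a) / 2)) * exp (- (norm y)\<^sup>2)) * indicator A y \<partial>lborel)"
    using A by (intro nn_integral_mono) (auto simp: indicator_def intro!: ennreal_leI)
  also have "\<dots> = emeasure gauss_borel A"
    unfolding gauss_borel_def by (subst emeasure_density) auto
  finally show ?thesis .
qed

lemma gauss_borel_le:
  fixes A :: "'a::euclidean_space set"
  assumes [measurable]: "A \<in> sets borel" and A: "\<And>y. y \<in> A \<Longrightarrow> b \<le> (norm y)\<^sup>2"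
  shows "emeasure gauss_borel A \<le> ennreal (pi powr (- (real DIM('a) / 2)) * exp (- b)) * emeasure lborel A"
proof -
  have "emeasure gauss_borel A = (\<integral>\<^sup>+y. ennreal (pi powr (- (real DIM('a) / 2)) * exp (- (norm y)\<^sup>2)) * indicator A y \<partial>lborel)"
    unfolding gauss_borel_def by (subst emeasure_density) auto
  also have "\<dots> \<le> (\<integral>\<^sup>+y. ennreal (pi powr (- (real DIM('a) / 2)) * exp (- b)) * indicator A y \<partial>lborel)"
    using A by (intro nn_integral_mono) (auto simp: indicator_def intro!: ennreal_leI)
  also have "\<dots> = ennreal (pi powr (- (real DIM('a) / 2)) * exp (- b)) * emeasure lborel A"
    by (subst nn_integral_cmult_indicator) auto
  finally show ?thesis .
qed

text \<open>
  A ball of radius \<open>s\<close> inside \<open>ball c r\<close>, placed as close to the origin as possible, already has the claimed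
  measure.
\<close>

lemma gauss_borel_ball_lower:
  fixes c :: "'a::euclidean_space"
  assumes s: "0 < s" "s \<le> r"
  shows "ennreal (pi powr (- (real DIM('a) / 2)) * unit_ball_vol (real DIM('a)) * s ^ DIM('a) *
      exp (- (max 0 (norm c - r) + 2 * s)\<^sup>2)) \<le> emeasure gauss_borel (ball c r)"
proof -
  let ?g = "pi powr (- (real DIM('a) / 2))"
  let ?v = "unit_ball_vol (real DIM('a))"
  define m where "m = max 0 (norm c - r) + s"
  have m: "0 < m" "norm c - r \<le> m - s" using s by (auto simp: m_def)
  obtain z where z: "norm z \<le> m" "norm (z - c) \<le> r - s"
  proof (cases "norm c \<le> m")
    case True
    then show ?thesis using that[of c] s by simp
  next
    case False
    have "norm ((m / norm c) *\<^sub>R c - c) = norm ((m / norm c - 1) *\<^sub>R c)"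
      by (simp add: algebra_simps)
    also have "\<dots> = norm c - m"
    proof -
      have "0 < norm c" using False m by linarith
      moreover have "m / norm c \<le> 1" using False \<open>0 < norm c\<close> by (simp add: divide_le_eq)
      ultimately have "m / norm c \<le> 1" "0 < norm c" by auto
      then have "norm ((m / norm c - 1) *\<^sub>R c) = (1 - m / norm c) * norm c" by simp
      also have "\<dots> = norm c - m" using \<open>0 < norm c\<close> by (simp add: field_simps)
      finally show ?thesis .
    qed
    finally show ?thesis using that[of "(m / norm c) *\<^sub>R c"] False m by auto
  qed
  have sub: "ball z s \<subseteq> ball c r"
  proof
    fix y assume "y \<in> ball z s"
    then have "dist c y < r" using dist_triangle[of c y z] z(2) by (auto simp: dist_norm norm_minus_commute)
    then show "y \<in> ball c r" by simp
  qed
  have "ennreal (?g * ?v * s ^ DIM('a) * exp (- (m + s)\<^sup>2)) = ennreal (?g * exp (- (m + s)\<^sup>2)) * emeasure lborel (ball z s)"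
    using s by (simp add: emeasure_ball ennreal_mult[symmetric] mult_ac)
  also have "\<dots> \<le> emeasure gauss_borel (ball z s)"
  proof (intro gauss_borel_ge power_mono)
    fix y assume "y \<in> ball z s"
    then show "norm y \<le> m + s"
      using norm_triangle_ineq4[of z "z - y"] z(1) by (auto simp: dist_norm)
  qed auto
  also have "\<dots> \<le> emeasure gauss_borel (ball c r)"
    using sub by (intro emeasure_mono) auto
  finally show ?thesis by (simp add: m_def add.assoc)
qed

text \<open>
  On these balls \<open>(norm y)\<^sup>2\<close> varies by at most a constant, and so the Gaussian density is
  constant up to a fixed factor.
\<close>

definition local_balls :: "('a::euclidean_space \<times> real) set" where
  "local_balls = {(c, r). 0 < r \<and> r * (1 + norm c) \<le> 1}"

lemma doubling_on_local_balls:
  "\<exists>K. doubling_on (local_balls :: ('a::euclidean_space \<times> real) set) gauss_borel K"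
proof -
  let ?g = "pi powr (- (real DIM('a) / 2))"
  have "doubling_on (local_balls :: ('a \<times> real) set) gauss_borel (5 ^ DIM('a) * exp 88)"
    unfolding doubling_on_def
  proof (intro conjI exI[of _ 1])
    show "0 < (5::real) ^ DIM('a) * exp 88" by simp
    show "\<forall>(c::'a, r)\<in>local_balls. 0 < r \<and> r \<le> 1 \<and>
      emeasure gauss_borel (ball c (5 * r)) \<le> ennreal (5 ^ DIM('a) * exp 88) * emeasure gauss_borel (ball c r)"
    proof (clarify, intro conjI)
      fix c :: 'a and r :: real assume "(c, r) \<in> local_balls"
      then have r: "0 < r" "r * (1 + norm c) \<le> 1" by (auto simp: local_balls_def)
      have rc: "0 \<le> r * norm c" using r by simp
      show r1: "0 < r" "r \<le> 1" using r rc unfolding distrib_left by linarith+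
      have rc1: "r * norm c \<le> 1" using r by (simp add: distrib_left)
      have rr: "r * r \<le> 1" using r1 mult_mono[of r 1 r 1] by simp
      \<comment> \<open>\<open>(norm y)\<^sup>2\<close> is at least \<open>(norm c)\<^sup>2 - 85\<close> on the enlarged ball and at most \<open>(norm c)\<^sup>2 + 3\<close>
        on the ball itself.\<close>
      have "emeasure gauss_borel (ball c (5 * r)) \<le> ennreal (?g * exp (- ((norm c)\<^sup>2 - 85))) * emeasure lborel (ball c (5 * r))"
      proof (rule gauss_borel_le)
        fix y assume "y \<in> ball c (5 * r)"
        then have d: "norm (c - y) \<le> 5 * r" by (simp add: dist_norm)
        have "norm c \<le> norm y + norm (c - y)"
          using norm_triangle_ineq[of y "c - y"] by simp
        then have y: "norm c \<le> norm y + 5 * r" using d by simp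
        then have "(norm c)\<^sup>2 \<le> (norm y + 5 * r)\<^sup>2" by (intro power_mono) auto
        also have "\<dots> = (norm y)\<^sup>2 + 10 * (r * norm y) + 25 * (r * r)"
          by (simp add: power2_eq_square algebra_simps)
        finally have sq: "(norm c)\<^sup>2 \<le> (norm y)\<^sup>2 + 10 * (r * norm y) + 25 * (r * r)" .
        have "norm y \<le> norm c + 5 * r"
          using norm_triangle_ineq4[of c "c - y"] d by simp
        then have "r * norm y \<le> r * (norm c + 5 * r)" using r1 by (intro mult_left_mono) auto
        then have "r * norm y \<le> r * norm c + 5 * (r * r)" by (simp add: algebra_simps)
        then show "(norm c)\<^sup>2 - 85 \<le> (norm y)\<^sup>2" using sq rc1 rr by linarith
      qed auto
      also have "\<dots> = ennreal (5 ^ DIM('a) * exp 88) * (ennreal (?g * exp (- ((norm c)\<^sup>2 + 3))) * emeasure lborel (ball c r))"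
      proof -
        have "exp (- ((norm c)\<^sup>2 - 85)) = exp 88 * exp (- ((norm c)\<^sup>2 + 3))" by (simp flip: exp_add)
        then show ?thesis using r1
          by (simp add: emeasure_ball ennreal_mult[symmetric] power_mult_distrib mult_ac)
      qed
      also have "\<dots> \<le> ennreal (5 ^ DIM('a) * exp 88) * emeasure gauss_borel (ball c r)"
      proof (intro mult_left_mono gauss_borel_ge)
        fix y assume "y \<in> ball c r"
        then have "norm y \<le> norm c + r"
          using norm_triangle_ineq4[of c "c - y"] by (auto simp: dist_norm)
        then have "(norm y)\<^sup>2 \<le> (norm c + r)\<^sup>2" by (intro power_mono) auto
        also have "\<dots> = (norm c)\<^sup>2 + 2 * (r * norm c) + r * r" by (simp add: power2_eq_square algebra_simps)
        finally show "(norm y)\<^sup>2 \<le> (norm c)\<^sup>2 + 3" using rc1 rr by linarith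
      qed auto
      finally show "emeasure gauss_borel (ball c (5 * r)) \<le> ennreal (5 ^ DIM('a) * exp 88) * emeasure gauss_borel (ball c r)" .
    qed
  qed
  then show ?thesis by blast
qed

text \<open>
  These radii are at least 2/5: otherwise \<open>norm c < 1 + r < 7 / 5\<close> would give \<open>r * (1 + norm c) < 1\<close>. Hence
  the ball contains one of radius 2/5 with points of norm at most 9/5.
\<close>

lemma central_ball_average_le:
  "\<exists>C>0. \<forall>(c::'a::euclidean_space) r h. norm c - r < 1 \<longrightarrow> 1 < r * (1 + norm c) \<longrightarrow> 0 < r \<longrightarrow>
     (\<integral>\<^sup>+y\<in>ball c r. h y \<partial>gauss_borel) / emeasure gauss_borel (ball c r) \<le> ennreal C * (\<integral>\<^sup>+y. h y \<partial>gauss_borel)"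
proof -
  define k where "k = pi powr (- (real DIM('a) / 2)) * unit_ball_vol (real DIM('a)) * (2 / 5) ^ DIM('a) * exp (- (9 / 5)\<^sup>2)"
  have k: "0 < k" by (simp add: k_def)
  have "(\<integral>\<^sup>+y\<in>ball c r. h y \<partial>gauss_borel) / emeasure gauss_borel (ball c r) \<le> ennreal (1 / k) * (\<integral>\<^sup>+y. h y \<partial>gauss_borel)"
    if cr: "norm c - r < 1" "1 < r * (1 + norm c)" "0 < r" for c :: 'a and r h
  proof -
    have "2 / 5 \<le> r"
    proof (rule ccontr)
      assume "\<not> 2 / 5 \<le> r"
      then have "r * (1 + norm c) \<le> 2 / 5 * (12 / 5)" using cr by (intro mult_mono) auto
      then show False using cr by simp
    qed
    have "k \<le> pi powr (- (real DIM('a) / 2)) * unit_ball_vol (real DIM('a)) * (2 / 5) ^ DIM('a) *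
        exp (- (max 0 (norm c - r) + 2 * (2 / 5))\<^sup>2)"
      unfolding k_def
    proof (intro mult_left_mono)
      have "(max 0 (norm c - r) + 2 * (2 / 5))\<^sup>2 \<le> (9 / 5 :: real)\<^sup>2" using cr by (intro power_mono) auto
      then show "exp (- (9 / 5)\<^sup>2) \<le> exp (- (max 0 (norm c - r) + 2 * (2 / 5))\<^sup>2)" by simp
    qed auto
    then have "ennreal k \<le> emeasure gauss_borel (ball c r)"
      using \<open>2 / 5 \<le> r\<close> by (intro order_trans[OF ennreal_leI gauss_borel_ball_lower[of "2 / 5"]]) auto
    with k have "(\<integral>\<^sup>+y\<in>ball c r. h y \<partial>gauss_borel) / emeasure gauss_borel (ball c r) \<le>
      ennreal (1 / k) * (\<integral>\<^sup>+y\<in>ball c r. h y \<partial>gauss_borel)"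
      by (rule ennreal_divide_le)
    also have "\<dots> \<le> ennreal (1 / k) * (\<integral>\<^sup>+y. h y \<partial>gauss_borel)"
      by (intro mult_left_mono nn_integral_mono) (auto simp: indicator_def)
    finally show ?thesis .
  qed
  then show ?thesis using k by (intro exI[of _ "1 / k"]) auto
qed

section \<open>Large balls far from the origin\<close>

lemma norm_diff_polar:
  fixes e w :: "'a::real_inner"
  assumes "norm e = 1" "norm w = 1"
  shows "(norm (L *\<^sub>R e - t *\<^sub>R w))\<^sup>2 = (t - L)\<^sup>2 + t * L * (norm (e - w))\<^sup>2"
proof -
  have "e \<bullet> e = 1" "w \<bullet> w = 1"
    using assms by (simp_all add: norm_eq_1)
  then show ?thesis
    by (simp add: power2_norm_eq_inner inner_diff_left inner_diff_right inner_commute[of w e]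
        power2_eq_square[of "t - L"] algebra_simps)
qed

text \<open>
  By the law of cosines the ball, at distance \<open>a\<close> from the origin, meets the sphere of radius \<open>t\<close> in the cap
  where \<open>(norm (e - w))\<^sup>2 < (t - a) * (2 * r + a - t) / (t * (a + r))\<close>. The natural unit for the
  width of the caps is \<open>sqrt (r / (24 * a\<^sup>2 * (a + r)))\<close>, comparable to their size where \<open>t - a\<close> is \<open>1 / a\<close>.
\<close>

lemma ball_in_polar_sector:
  fixes e w :: "'a::real_inner"
  assumes ew: "norm e = 1" "norm w = 1" and r: "0 < r" and a: "1 \<le> a" and t: "0 \<le> t"
    and mem: "t *\<^sub>R w \<in> ball ((a + r) *\<^sub>R e) r"
  shows "a < t" "norm (e - w) < 7 * sqrt (r / (24 * a\<^sup>2 * (a + r))) * (1 + a * (t - a))"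
proof -
  define L where "L = a + r"
  have L: "0 < L" using a r by (simp add: L_def)
  have "norm (L *\<^sub>R e - t *\<^sub>R w) < r"
    using mem by (simp add: L_def dist_norm)
  then have "(norm (L *\<^sub>R e - t *\<^sub>R w))\<^sup>2 < r\<^sup>2"
    by (intro power_strict_mono) auto
  then have lt: "(t - L)\<^sup>2 + t * L * (norm (e - w))\<^sup>2 < r\<^sup>2"
    by (simp add: norm_diff_polar[OF ew])
  have nn: "0 \<le> t * L * (norm (e - w))\<^sup>2" using t L by simp
  then have "(t - L)\<^sup>2 < r\<^sup>2" using lt by linarith
  then have "\<bar>t - L\<bar> < r" using r abs_le_square_iff[of r "t - L"] by linarith
  then show at: "a < t" using r by (simp add: L_def)
  have "r\<^sup>2 - (t - L)\<^sup>2 = (t - a) * (2 * r + a - t)"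
    by (simp add: L_def power2_eq_square algebra_simps)
  also have "\<dots> \<le> (t - a) * (2 * r)"
    using at by (intro mult_left_mono) auto
  also have "\<dots> = 2 * r * (t - a)" by (rule mult.commute)
  finally have "t * L * (norm (e - w))\<^sup>2 < 2 * r * (t - a)" using lt by linarith
  moreover have "a * L * (norm (e - w))\<^sup>2 \<le> t * L * (norm (e - w))\<^sup>2"
    using at L by (intro mult_right_mono) auto
  ultimately have "a * L * (norm (e - w))\<^sup>2 < 2 * r * (t - a)" by linarith
  then have 1: "(norm (e - w))\<^sup>2 < 2 * r * (t - a) / (a * L)"
    using a L by (simp add: pos_less_divide_eq mult.commute)
  define s where "s = a * (t - a)"
  have s: "0 \<le> s" using a at by (simp add: s_def)
  have "2 * r * (t - a) / (a * L) = 48 * s * (r / (24 * a\<^sup>2 * L))"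
    using a L by (simp add: s_def field_simps power2_eq_square)
  also have "\<dots> \<le> 49 * (1 + s)\<^sup>2 * (r / (24 * a\<^sup>2 * L))"
  proof (intro mult_right_mono)
    show "48 * s \<le> 49 * (1 + s)\<^sup>2" using s by (simp add: power2_eq_square algebra_simps)
    show "0 \<le> r / (24 * a\<^sup>2 * L)" using r L by simp
  qed
  also have "\<dots> = (7 * sqrt (r / (24 * a\<^sup>2 * L)) * (1 + s))\<^sup>2"
    using r L by (simp add: power_mult_distrib)
  finally have "(norm (e - w))\<^sup>2 < (7 * sqrt (r / (24 * a\<^sup>2 * L)) * (1 + s))\<^sup>2" using 1 by linarith
  then have "norm (e - w) < 7 * sqrt (r / (24 * a\<^sup>2 * L)) * (1 + s)"
    by (rule power2_less_imp_less) (use s r L in auto)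
  then show "norm (e - w) < 7 * sqrt (r / (24 * a\<^sup>2 * (a + r))) * (1 + a * (t - a))"
    by (simp add: L_def s_def)
qed

text \<open>
  The condition \<open>1 / 3 \<le> r * a\<close> gives \<open>t - a \<le> r / 2\<close>. Then \<open>2 * r + a - t \<ge> r\<close>, and by the law of
  cosines the cap at radius \<open>t\<close> is at least as wide as the natural unit.
\<close>

lemma polar_sector_in_ball:
  fixes e w :: "'a::real_inner"
  assumes ew: "norm e = 1" "norm w = 1" and r: "0 < r" and a: "1 \<le> a" "1 / 3 \<le> r * a"
    and t: "a + 1 / (12 * a) \<le> t" "t \<le> a + 1 / (6 * a)"
    and d: "norm (e - w) < sqrt (r / (24 * a\<^sup>2 * (a + r)))"
  shows "t *\<^sub>R w \<in> ball ((a + r) *\<^sub>R e) r"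
proof -
  define L where "L = a + r"
  have L: "0 < L" using a r by (simp add: L_def)
  have at: "a \<le> t" using a t(1) by (smt (verit) divide_nonneg_nonneg)
  then have t0: "0 < t" using a by simp
  have "1 / (6 * a) \<le> a"
    using a mult_mono[of 1 a 1 a] by (simp add: field_simps)
  then have t2: "t \<le> 2 * a" using t by simp
  have "(norm (e - w))\<^sup>2 < (sqrt (r / (24 * a\<^sup>2 * L)))\<^sup>2"
    using d unfolding L_def by (intro power_strict_mono) auto
  then have "(norm (e - w))\<^sup>2 < r / (24 * a\<^sup>2 * L)" using r L by simp
  then have "t * L * (norm (e - w))\<^sup>2 < t * L * (r / (24 * a\<^sup>2 * L))"
    using t0 L by (intro mult_strict_left_mono) auto
  also have "\<dots> = t * (r / (24 * a\<^sup>2))" using L by simp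
  also have "\<dots> \<le> 2 * a * (r / (24 * a\<^sup>2))"
    using t2 r by (intro mult_right_mono) auto
  also have "\<dots> = 1 / (12 * a) * r" using a by (simp add: field_simps power2_eq_square)
  also have "\<dots> \<le> (t - a) * (2 * r + a - t)"
  proof (intro mult_mono)
    have "1 / (6 * a) \<le> r" using a by (simp add: field_simps)
    then show "r \<le> 2 * r + a - t" using t by linarith
  qed (use t at a r in \<open>auto simp: field_simps\<close>)
  also have "\<dots> = r\<^sup>2 - (t - L)\<^sup>2"
    by (simp add: L_def power2_eq_square algebra_simps)
  finally have "t * L * (norm (e - w))\<^sup>2 < r\<^sup>2 - (t - L)\<^sup>2" .
  then have "(norm (L *\<^sub>R e - t *\<^sub>R w))\<^sup>2 < r\<^sup>2"
    unfolding norm_diff_polar[OF ew] by (simp only: less_diff_eq add.commute)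
  then have "norm (L *\<^sub>R e - t *\<^sub>R w) < r"
    by (rule power2_less_imp_less) (use r in auto)
  then show ?thesis by (simp add: L_def dist_norm)
qed

lemma measurable_slice_maximal:
  fixes h :: "'a::euclidean_space \<Rightarrow> ennreal"
  assumes [measurable]: "h \<in> borel_measurable borel" and Q: "countable Q"
  shows "(\<lambda>(t, w). ball_maximal Q sphere_measure (\<lambda>w'. h (t *\<^sub>R w')) w) \<in> borel_measurable (borel \<Otimes>\<^sub>M borel)"
proof -
  interpret S: finite_measure "sphere_measure :: 'a measure" by (rule finite_measure_sphere_measure)
  show ?thesis
    unfolding ball_maximal_def split_beta' using Q
    by (intro borel_measurable_SUP) (auto simp: split_beta')
qed

text \<open>
  The maximal function over caps on each sphere, integrated in the radius against the radial kernel. The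
  powers of the weight make the radial part act on \<open>L\<^sup>p\<close> of Lebesgue measure by the plain kernel.
\<close>

definition exterior_operator ::
  "('a::euclidean_space \<times> real) set \<Rightarrow> real \<Rightarrow> ('a \<Rightarrow> ennreal) \<Rightarrow> 'a \<Rightarrow> ennreal" where
  "exterior_operator Q p h x =
     indicator {1..} (norm x) * (ennreal (radial_weight (DIM('a) - 1) (norm x) powr (- 1 / p)) *
       (\<integral>\<^sup>+t\<in>{1..}. ennreal (radial_kernel (min (1 / p) (1 - 1 / p) / 2) (norm x) t) *
          (ennreal (radial_weight (DIM('a) - 1) t powr (1 / p)) *
           ball_maximal Q sphere_measure (\<lambda>w. h (t *\<^sub>R w)) (sgn x)) \<partial>lborel))"

text \<open>
  The ball is contained in a union of caps of radius \<open>T t\<close> on the spheres of radius \<open>t \<ge> a\<close>, each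
  enlarged so that it also contains the direction of \<open>x\<close>; the integral over each is at most its size, of
  order \<open>T t ^ (DIM('a) - 1)\<close>, times the maximal function over caps in that direction.
  Dividing by the measure of the sector inside the ball gives the kernel
  of \<open>large_ball_kernel_le\<close>.
\<close>

lemma far_ball_average_le:
  fixes Q :: "('a::euclidean_space \<times> real) set"
  assumes Q: "countable Q" and p: "1 < p" and C1: "0 < C1"
    and cap: "\<And>e w s k. norm e = 1 \<Longrightarrow> norm w = 1 \<Longrightarrow> w \<in> ball e s \<Longrightarrow> k \<in> borel_measurable borel \<Longrightarrow>
      (\<integral>\<^sup>+z\<in>ball e s. k z \<partial>sphere_measure) \<le> ennreal (C1 * s ^ (DIM('a) - 1)) * ball_maximal Q sphere_measure k w"
  shows "\<exists>C>0. \<forall>h\<in>borel_measurable borel. \<forall>c r x. x \<in> ball c r \<longrightarrow> 1 \<le> norm c - r \<longrightarrow> 1 < r * (1 + norm c) \<longrightarrow>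
     (\<integral>\<^sup>+y\<in>ball c r. h y \<partial>gauss_borel) / emeasure gauss_borel (ball c r) \<le> ennreal C * exterior_operator Q p h x"
proof -
  interpret S: finite_measure "sphere_measure :: 'a measure" by (rule finite_measure_sphere_measure)
  define n where "n = DIM('a) - 1"
  define g where "g = pi powr (- (real DIM('a) / 2))"
  have g: "0 < g" by (simp add: g_def)
  define \<delta> where "\<delta> = min (1 / p) (1 - 1 / p) / 2"
  obtain k0 where k0: "0 < k0" "\<And>(e::'a) s. norm e = 1 \<Longrightarrow> 0 < s \<Longrightarrow> s \<le> 4 \<Longrightarrow>
     ennreal (k0 * s ^ n) \<le> emeasure sphere_measure (ball e s)"
    using emeasure_cap_lower[where 'a='a] unfolding n_def by blast
  obtain C2 where C2: "0 < C2" "\<And>a t R. 1 \<le> a \<Longrightarrow> a \<le> t \<Longrightarrow> a \<le> R \<Longrightarrow>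
    (1 + a * (t - a) + a * (R - a)) ^ n * (a / a ^ n) * exp (a\<^sup>2) * radial_weight n t
      \<le> C2 * radial_weight n R powr (- 1 / p) * radial_kernel \<delta> R t * radial_weight n t powr (1 / p)"
    using large_ball_kernel_le[OF p, of n] unfolding \<delta>_def by blast
  define C3 where "C3 = C1 * 7 ^ n * 12 * exp 1 / k0"
  have C3: "0 < C3" using C1 k0 by (simp add: C3_def)
  have "(\<integral>\<^sup>+y\<in>ball c r. h y \<partial>gauss_borel) / emeasure gauss_borel (ball c r) \<le> ennreal (C3 * C2) * exterior_operator Q p h x"
    if h [measurable]: "h \<in> borel_measurable borel" and x: "x \<in> ball c r" and far: "1 \<le> norm c - r" "1 < r * (1 + norm c)"
    for h and c x :: 'a and r
  proof -
    define a where "a = norm c - r"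
    have r: "0 < r" using x by (metis ball_empty empty_iff not_le)
    have a: "1 \<le> a" using far by (simp add: a_def)
    have c: "norm c = a + r" by (simp add: a_def)
    have ra: "1 / 3 \<le> r * a"
    proof (cases "r \<le> 1")
      case True
      have "r * (1 + norm c) \<le> r * (3 * a)" using True a r c by (intro mult_left_mono) auto
      then show ?thesis using far by linarith
    next
      case False
      then show ?thesis using mult_mono[of 1 r 1 a] a by simp
    qed
    define e where "e = sgn c"
    have e: "norm e = 1" "c = (a + r) *\<^sub>R e"
      using a r c by (auto simp: e_def norm_sgn sgn_div_norm)
    define R where "R = norm x"
    define w0 where "w0 = sgn x"
    have x0: "x \<noteq> 0" using x far by (auto simp: dist_norm)
    have w0: "norm w0 = 1" "x = R *\<^sub>R w0" "0 \<le> R"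
      using x0 by (auto simp: w0_def R_def norm_sgn sgn_div_norm)
    define s0 where "s0 = sqrt (r / (24 * a\<^sup>2 * (a + r)))"
    have "0 < s0" using r a by (simp add: s0_def)
    have "s0 \<le> 4"
    proof -
      have "1 \<le> a\<^sup>2" using a by (simp add: one_le_power)
      then have "1 \<le> 24 * a\<^sup>2" by linarith
      from mult_mono[OF _ this] have "r * 1 \<le> (a + r) * (24 * a\<^sup>2)" using r a by simp
      then have "r / (24 * a\<^sup>2 * (a + r)) \<le> 1" using r a by (simp add: divide_le_eq mult.commute)
      then have "s0 \<le> 1" by (simp add: s0_def)
      then show ?thesis by simp
    qed
    note s0 = \<open>0 < s0\<close> \<open>s0 \<le> 4\<close>
    have aR: "a < R" and w0e: "norm (e - w0) < 7 * s0 * (1 + a * (R - a))"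
      using ball_in_polar_sector[OF e(1) w0(1) r a w0(3)] x unfolding w0(2)[symmetric] e(2)[symmetric] s0_def by auto
    define F where "F t = ball_maximal Q sphere_measure (\<lambda>w. h (t *\<^sub>R w)) w0" for t :: real
    have [measurable]: "F \<in> borel_measurable borel"
      using measurable_compose[OF measurable_Pair2'[of w0 borel borel] measurable_slice_maximal[OF h Q]]
      unfolding F_def by simp
    \<comment> \<open>The last summand makes every cap wide enough to contain the direction of \<open>x\<close>.\<close>
    define T where "T t = 7 * s0 * (1 + a * (t - a) + a * (R - a))" for t
    have upper: "(\<integral>\<^sup>+y\<in>ball c r. h y \<partial>gauss_borel) \<le>
       (\<integral>\<^sup>+t. ennreal (g * radial_weight n t * (C1 * T t ^ n)) * indicator {a..} t * F t \<partial>lborel)"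
    proof -
      have "(\<integral>\<^sup>+y\<in>ball c r. h y \<partial>gauss_borel) = (\<integral>\<^sup>+t. ennreal (g * radial_weight n t) * indicator {0..} t *
         (\<integral>\<^sup>+w. h (t *\<^sub>R w) * indicator (ball c r) (t *\<^sub>R w) \<partial>sphere_measure) \<partial>lborel)"
        unfolding g_def n_def by (rule nn_integral_gauss_borel_polar) measurable
      also have "\<dots> \<le> (\<integral>\<^sup>+t. ennreal (g * radial_weight n t * (C1 * T t ^ n)) * indicator {a..} t * F t \<partial>lborel)"
      proof (intro nn_integral_mono)
        fix t :: real
        show "ennreal (g * radial_weight n t) * indicator {0..} t *
           (\<integral>\<^sup>+w. h (t *\<^sub>R w) * indicator (ball c r) (t *\<^sub>R w) \<partial>sphere_measure)
          \<le> ennreal (g * radial_weight n t * (C1 * T t ^ n)) * indicator {a..} t * F t"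
        proof (cases "0 \<le> t")
          case t: True
          have pt: "indicator (ball c r) (t *\<^sub>R w) \<le> (indicator {a..} t * indicator (ball e (T t)) w :: ennreal)"
            if w: "norm w = 1" for w :: 'a
          proof (cases "t *\<^sub>R w \<in> ball c r")
            case True
            then have 1: "a < t" "norm (e - w) < 7 * s0 * (1 + a * (t - a))"
              using ball_in_polar_sector[OF e(1) w r a t] unfolding e(2)[symmetric] s0_def by auto
            have "7 * s0 * (1 + a * (t - a)) \<le> T t"
              unfolding T_def using s0 a aR by (intro mult_left_mono) auto
            then have "w \<in> ball e (T t)" using 1 by (simp add: dist_norm)
            then show ?thesis using 1 by (simp add: indicator_def)
          qed (simp add: indicator_def)
          have "(\<integral>\<^sup>+w. h (t *\<^sub>R w) * indicator (ball c r) (t *\<^sub>R w) \<partial>sphere_measure)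
            \<le> (\<integral>\<^sup>+w. indicator {a..} t * (h (t *\<^sub>R w) * indicator (ball e (T t)) w) \<partial>sphere_measure)"
          proof (rule nn_integral_mono_AE)
            show "AE w in sphere_measure. h (t *\<^sub>R w) * indicator (ball c r) (t *\<^sub>R w)
               \<le> indicator {a..} t * (h (t *\<^sub>R w) * indicator (ball e (T t)) w)"
              using AE_sphere_measure
            proof eventually_elim
              case (elim w)
              show ?case using mult_left_mono[OF pt[OF elim], of "h (t *\<^sub>R w)"] by (simp only: mult_ac zero_le)
            qed
          qed
          also have "\<dots> = indicator {a..} t * (\<integral>\<^sup>+w\<in>ball e (T t). h (t *\<^sub>R w) \<partial>sphere_measure)"
            by (rule nn_integral_cmult) measurable
          also have "\<dots> \<le> indicator {a..} t * (ennreal (C1 * T t ^ n) * F t)"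
          proof (cases "a \<le> t")
            case True
            have "7 * s0 * (1 + a * (R - a)) \<le> T t"
              unfolding T_def using s0 a aR True by (intro mult_left_mono) auto
            then have "w0 \<in> ball e (T t)" using w0e by (simp add: dist_norm)
            then show ?thesis
              unfolding F_def n_def by (intro mult_left_mono cap e w0) auto
          qed simp
          finally have "(\<integral>\<^sup>+w. h (t *\<^sub>R w) * indicator (ball c r) (t *\<^sub>R w) \<partial>sphere_measure) \<le> \<dots>" .
          then have "ennreal (g * radial_weight n t) * (\<integral>\<^sup>+w. h (t *\<^sub>R w) * indicator (ball c r) (t *\<^sub>R w) \<partial>sphere_measure)
            \<le> ennreal (g * radial_weight n t) * (indicator {a..} t * (ennreal (C1 * T t ^ n) * F t))"
            by (intro mult_left_mono) auto
          also have "\<dots> = ennreal (g * radial_weight n t * (C1 * T t ^ n)) * indicator {a..} t * F t"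
          proof (cases "a \<le> t")
            case True
            have "0 \<le> T t" unfolding T_def using s0 a aR True by simp
            then show ?thesis using g t C1 by (simp add: ennreal_mult radial_weight_def mult_ac)
          qed simp
          finally show ?thesis using t by simp
        qed simp
      qed
      finally show ?thesis .
    qed
    \<comment> \<open>A lower bound for the product of the radial mass on an interval of length \<open>1 / (12 * a)\<close>, where the density has its
      size at \<open>a\<close> up to a constant, and of the measure of a cap of unit width.\<close>
    define kk where "kk = g * (a ^ n * exp (- (a\<^sup>2 + 1))) * (k0 * s0 ^ n) * (1 / (12 * a))"
    have kk: "0 < kk" using g a k0 s0 by (simp add: kk_def)
    have lower: "ennreal kk \<le> emeasure gauss_borel (ball c r)"
    proof -
      let ?I = "{a + 1 / (12 * a)..a + 1 / (6 * a)}"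
      have I: "0 \<le> 1 / (12 * a)" "0 \<le> 1 / (6 * a)" using a by auto
      have "ennreal kk = (ennreal (g * (a ^ n * exp (- (a\<^sup>2 + 1)))) * ennreal (k0 * s0 ^ n)) * ennreal (1 / (12 * a))"
        using g a k0 s0 by (simp add: kk_def ennreal_mult[symmetric])
      also have "ennreal (1 / (12 * a)) = emeasure lborel ?I"
        using a by (simp add: field_simps)
      also have "(ennreal (g * (a ^ n * exp (- (a\<^sup>2 + 1)))) * ennreal (k0 * s0 ^ n)) * emeasure lborel ?I
        = (\<integral>\<^sup>+t. (ennreal (g * (a ^ n * exp (- (a\<^sup>2 + 1)))) * ennreal (k0 * s0 ^ n)) * indicator ?I t \<partial>lborel)"
        by (subst nn_integral_cmult_indicator) auto
      also have "\<dots> \<le> (\<integral>\<^sup>+t. ennreal (g * radial_weight n t) * indicator {0..} t *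
         (\<integral>\<^sup>+w. indicator (ball c r) (t *\<^sub>R w) \<partial>sphere_measure) \<partial>lborel)"
      proof (intro nn_integral_mono)
        fix t :: real
        show "(ennreal (g * (a ^ n * exp (- (a\<^sup>2 + 1)))) * ennreal (k0 * s0 ^ n)) * indicator ?I t
          \<le> ennreal (g * radial_weight n t) * indicator {0..} t * (\<integral>\<^sup>+w. indicator (ball c r) (t *\<^sub>R w) \<partial>sphere_measure)"
        proof (cases "t \<in> ?I")
          case True
          then have t: "a + 1 / (12 * a) \<le> t" "t \<le> a + 1 / (6 * a)" by auto
          then have ta: "a \<le> t" using I by linarith
          have "t\<^sup>2 \<le> (a + 1 / (6 * a))\<^sup>2" using t ta a by (intro power_mono) auto
          also have "\<dots> = a\<^sup>2 + 1 / 3 + (1 / (6 * a))\<^sup>2" using a by (simp add: power2_eq_square field_simps)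
          also have "(1 / (6 * a))\<^sup>2 \<le> (1 / 6)\<^sup>2" using a by (intro power_mono) (auto simp: field_simps)
          finally have t2: "t\<^sup>2 \<le> a\<^sup>2 + 1" by (simp add: power2_eq_square)
          have W: "a ^ n * exp (- (a\<^sup>2 + 1)) \<le> radial_weight n t"
            unfolding radial_weight_def using ta t2 a by (intro mult_mono power_mono) auto
          have "ennreal (k0 * s0 ^ n) \<le> emeasure sphere_measure (ball e s0)"
            by (intro k0 e s0)
          also have "\<dots> = (\<integral>\<^sup>+w. indicator (ball e s0) w \<partial>sphere_measure)" by simp
          also have "\<dots> \<le> (\<integral>\<^sup>+w. indicator (ball c r) (t *\<^sub>R w) \<partial>sphere_measure)"
          proof (rule nn_integral_mono_AE)
            show "AE w in sphere_measure. indicator (ball e s0) w \<le> (indicator (ball c r) (t *\<^sub>R w) :: ennreal)"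
              using AE_sphere_measure
            proof eventually_elim
              case (elim w)
              have "t *\<^sub>R w \<in> ball c r" if "w \<in> ball e s0"
                using polar_sector_in_ball[OF e(1) elim r a ra t] that unfolding e(2)[symmetric] s0_def
                by (simp add: dist_norm)
              then show ?case by (auto simp: indicator_def)
            qed
          qed
          finally have "ennreal (g * (a ^ n * exp (- (a\<^sup>2 + 1)))) * ennreal (k0 * s0 ^ n) \<le>
            ennreal (g * radial_weight n t) * (\<integral>\<^sup>+w. indicator (ball c r) (t *\<^sub>R w) \<partial>sphere_measure)"
            using W g by (intro mult_mono ennreal_leI mult_left_mono) auto
          then show ?thesis using ta a True by simp
        qed simp
      qed
      also have "\<dots> = (\<integral>\<^sup>+y. indicator (ball c r) y \<partial>gauss_borel)"
        unfolding g_def n_def by (rule nn_integral_gauss_borel_polar[symmetric]) measurable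
      finally show ?thesis by simp
    qed
    define B where "B = radial_weight n R powr (- 1 / p)"
    have B: "0 \<le> B" by (simp add: B_def)
    have "(\<integral>\<^sup>+y\<in>ball c r. h y \<partial>gauss_borel) / emeasure gauss_borel (ball c r)
      \<le> ennreal (1 / kk) * (\<integral>\<^sup>+y\<in>ball c r. h y \<partial>gauss_borel)"
      by (rule ennreal_divide_le[OF kk lower])
    also have "\<dots> \<le> ennreal (1 / kk) * (\<integral>\<^sup>+t. ennreal (g * radial_weight n t * (C1 * T t ^ n)) * indicator {a..} t * F t \<partial>lborel)"
      by (intro mult_left_mono upper) simp
    also have "\<dots> = (\<integral>\<^sup>+t. ennreal (1 / kk) * (ennreal (g * radial_weight n t * (C1 * T t ^ n)) * indicator {a..} t * F t) \<partial>lborel)"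
      unfolding T_def by (rule nn_integral_cmult[symmetric]) measurable
    also have "\<dots> \<le> (\<integral>\<^sup>+t. ennreal (C3 * C2 * B) *
       (ennreal (radial_kernel \<delta> R t) * (ennreal (radial_weight n t powr (1 / p)) * F t) * indicator {1..} t) \<partial>lborel)"
    proof (intro nn_integral_mono)
      fix t :: real
      show "ennreal (1 / kk) * (ennreal (g * radial_weight n t * (C1 * T t ^ n)) * indicator {a..} t * F t)
        \<le> ennreal (C3 * C2 * B) * (ennreal (radial_kernel \<delta> R t) * (ennreal (radial_weight n t powr (1 / p)) * F t) * indicator {1..} t)"
      proof (cases "a \<le> t")
        case True
        have K: "0 \<le> radial_kernel \<delta> R t" unfolding radial_kernel_def using True a aR by auto
        have W: "0 \<le> radial_weight n t" using True a by (simp add: radial_weight_def)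
        have T: "0 \<le> T t" unfolding T_def using s0 a aR True by simp
        have "1 / kk * (g * radial_weight n t * (C1 * T t ^ n)) =
           C3 * ((1 + a * (t - a) + a * (R - a)) ^ n * (a / a ^ n) * exp (a\<^sup>2) * radial_weight n t)"
        proof -
          have "exp (- (a\<^sup>2 + 1)) = 1 / (exp 1 * exp (a\<^sup>2))"
            by (simp only: exp_minus exp_add inverse_eq_divide mult.commute)
          moreover have "1 / (g * (A * (1 / (E1 * E))) * (k0 * s0 ^ n) * (1 / (12 * a))) * (g * W * (C1 * (7 * s0 * u) ^ n))
            = C1 * 7 ^ n * 12 * E1 / k0 * (u ^ n * (a / A) * E * W)"
            if "0 < A" "0 < E" "0 < E1" for A E E1 u W :: real
            using that g a s0(1) k0(1) by (simp add: power_mult_distrib field_simps)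
          ultimately show ?thesis using a unfolding kk_def T_def C3_def by simp
        qed
        also have "\<dots> \<le> C3 * (C2 * radial_weight n R powr (- 1 / p) * radial_kernel \<delta> R t * radial_weight n t powr (1 / p))"
          using C3 a True aR by (intro mult_left_mono C2) auto
        finally have *: "ennreal (1 / kk * (g * radial_weight n t * (C1 * T t ^ n))) \<le>
           ennreal ((C3 * C2 * B) * radial_kernel \<delta> R t * radial_weight n t powr (1 / p))"
          by (intro ennreal_leI) (simp add: B_def mult_ac)
        have "ennreal (1 / kk) * ennreal (g * radial_weight n t * (C1 * T t ^ n)) \<le>
           ennreal (C3 * C2 * B) * ennreal (radial_kernel \<delta> R t) * ennreal (radial_weight n t powr (1 / p))"
        proof -
          have "0 \<le> 1 / kk" "0 \<le> g * radial_weight n t * (C1 * T t ^ n)" "0 \<le> C3 * C2 * B"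
            "0 \<le> C3 * C2 * B * radial_kernel \<delta> R t"
            using kk g W C1 T C3 C2 B K by simp_all
          then show ?thesis using * K by (simp only: ennreal_mult powr_ge_zero)
        qed
        from mult_right_mono[OF this, of "F t"] show ?thesis
          using True a by (simp add: mult.assoc)
      qed simp
    qed
    also have "\<dots> = ennreal (C3 * C2 * B) * (\<integral>\<^sup>+t\<in>{1..}. ennreal (radial_kernel \<delta> R t) *
       (ennreal (radial_weight n t powr (1 / p)) * F t) \<partial>lborel)"
      by (rule nn_integral_cmult) measurable
    also have "\<dots> = ennreal (C3 * C2) * exterior_operator Q p h x"
      using aR a C3 C2 B
      by (simp add: exterior_operator_def F_def B_def R_def[symmetric] w0_def n_def \<delta>_def ennreal_mult mult.assoc)
    finally show ?thesis .
  qed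
  then show ?thesis using C2 C3 by (intro exI[of _ "C3 * C2"]) auto
qed

section \<open>Constant exponents\<close>

lemma borel_measurable_exterior_operator:
  fixes h :: "'a::euclidean_space \<Rightarrow> ennreal"
  assumes h [measurable]: "h \<in> borel_measurable borel" and Q: "countable Q"
  shows "exterior_operator Q p h \<in> borel_measurable borel"
proof -
  have [measurable]: "(\<lambda>(x, t). ball_maximal Q sphere_measure (\<lambda>w. h (t *\<^sub>R w)) (sgn x))
      \<in> borel_measurable ((borel :: 'a measure) \<Otimes>\<^sub>M borel)"
    using measurable_compose[of "\<lambda>z. (snd z, sgn (fst z))" "borel \<Otimes>\<^sub>M borel" "borel \<Otimes>\<^sub>M borel",
        OF _ measurable_slice_maximal[OF h Q]]
    by (simp add: split_beta')
  show ?thesis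
    unfolding exterior_operator_def[abs_def] by measurable
qed

text \<open>
  In polar coordinates, Schur's test on each ray removes the radial integration, and the maximal theorem
  for caps on each sphere removes the maximal function.
\<close>

lemma exterior_operator_strong_type:
  fixes Q :: "('a::euclidean_space \<times> real) set"
  assumes Q: "countable Q" and D: "doubling_on Q sphere_measure K" and p: "1 < p"
  shows "\<exists>C>0. \<forall>h\<in>borel_measurable borel.
    (\<integral>\<^sup>+x. ennreal_powr (exterior_operator Q p h x) p \<partial>gauss_borel)
      \<le> ennreal C * (\<integral>\<^sup>+x. ennreal_powr (h x) p \<partial>gauss_borel)"
proof -
  interpret S: finite_measure "sphere_measure :: 'a measure" by (rule finite_measure_sphere_measure)
  interpret LS: pair_sigma_finite "lborel :: real measure" "sphere_measure :: 'a measure" ..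
  define n where "n = DIM('a) - 1"
  define g where "g = pi powr (- (real DIM('a) / 2))"
  have g: "0 < g" by (simp add: g_def)
  define \<delta> where "\<delta> = min (1 / p) (1 - 1 / p) / 2"
  have \<delta>: "0 < \<delta>" using p by (simp add: \<delta>_def)
  define k where "k R t = indicator {1..} R * (indicator {1..} t * radial_kernel \<delta> R t)" for R t :: real
  have [measurable]: "case_prod k \<in> borel_measurable (borel \<Otimes>\<^sub>M borel)"
    unfolding k_def by measurable
  have k_sym: "k R t = k t R" for R t
    unfolding k_def by (simp add: radial_kernel_sym[of \<delta> R t] mult_ac)
  have k_int: "(\<integral>\<^sup>+t. ennreal (k R t) \<partial>lborel) \<le> ennreal (1 / \<delta>)" for R
  proof (cases "1 \<le> R")
    case True
    have "(\<integral>\<^sup>+t. ennreal (k R t) \<partial>lborel) \<le> (\<integral>\<^sup>+t. ennreal (radial_kernel \<delta> R t) * indicator {0..} t \<partial>lborel)"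
      using True by (intro nn_integral_mono) (auto simp: k_def indicator_def)
    also have "\<dots> \<le> ennreal (1 / \<delta>)"
      using True by (intro nn_integral_radial_kernel_le \<delta>) auto
    finally show ?thesis .
  qed (simp add: k_def)
  define K' where "K' = 2 powr p * K * p / (p - 1)"
  have K': "0 < K'" using D p by (simp add: K'_def doubling_on_def)
  have "(\<integral>\<^sup>+x. ennreal_powr (exterior_operator Q p h x) p \<partial>gauss_borel)
      \<le> ennreal ((1 / \<delta>) powr p * K') * (\<integral>\<^sup>+x. ennreal_powr (h x) p \<partial>gauss_borel)"
    if h [measurable]: "h \<in> borel_measurable borel" for h
  proof -
    let ?w = "\<lambda>R. ennreal (g * radial_weight n R) * indicator {0..} R"
    let ?E = "\<lambda>x. ennreal_powr (exterior_operator Q p h x) p"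
    let ?S = "\<lambda>t. \<integral>\<^sup>+w. ennreal_powr (h (t *\<^sub>R w)) p \<partial>sphere_measure"
    note borel_measurable_exterior_operator[OF h Q, measurable]
    define F where "F t w = ball_maximal Q sphere_measure (\<lambda>w'. h (t *\<^sub>R w')) w" for t w
    have F_meas [measurable]: "case_prod F \<in> borel_measurable (borel \<Otimes>\<^sub>M borel)"
      unfolding F_def by (rule measurable_slice_maximal[OF h Q])
    define H where "H w t = indicator {1..} t * (ennreal (radial_weight n t powr (1 / p)) * F t w)" for w t
    have [measurable]: "(\<lambda>t. H w t) \<in> borel_measurable borel" for w
      unfolding H_def by measurable
    let ?J = "\<lambda>w R. \<integral>\<^sup>+t. ennreal (k R t) * H w t \<partial>lborel"
    have slice: "?w R * ?E (R *\<^sub>R w)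
        \<le> ennreal g * ennreal_powr (?J w R) p" if w: "norm w = 1" for w R
    proof (cases "1 \<le> R")
      case True
      have nR: "norm (R *\<^sub>R w) = R" and sR: "sgn (R *\<^sub>R w) = w"
        using True w by (simp_all add: sgn_scaleR) (simp add: sgn_div_norm)
      have J: "(\<integral>\<^sup>+t\<in>{1..}. ennreal (radial_kernel \<delta> R t) * (ennreal (radial_weight n t powr (1 / p)) * F t w) \<partial>lborel)
         = ?J w R"
        using True by (intro nn_integral_cong) (auto simp: k_def H_def indicator_def)
      have E: "exterior_operator Q p h (R *\<^sub>R w) =
         ennreal (radial_weight n R powr (- 1 / p)) * ?J w R"
        unfolding exterior_operator_def nR sR J[symmetric] using True by (simp add: F_def n_def \<delta>_def)
      have W: "0 < radial_weight n R" using True by (simp add: radial_weight_pos)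
      have "?E (R *\<^sub>R w) = ennreal ((radial_weight n R powr (- 1 / p)) powr p) *
         ennreal_powr (?J w R) p"
        unfolding E using p by (simp add: ennreal_powr_mult ennreal_powr_ennreal)
      also have "(radial_weight n R powr (- 1 / p)) powr p = 1 / radial_weight n R"
      proof -
        have "(radial_weight n R powr (- 1 / p)) powr p = radial_weight n R powr (- 1 / p * p)"
          by (rule powr_powr)
        also have "- 1 / p * p = - 1" using p by simp
        finally show ?thesis using W by (simp add: powr_minus inverse_eq_divide)
      qed
      finally show ?thesis
        using True W g by (simp add: mult.assoc[symmetric] ennreal_mult[symmetric])
    next
      case False
      then have "?w R * ?E (R *\<^sub>R w) = 0"
        using w by (cases "0 \<le> R") (auto simp: exterior_operator_def)
      then show ?thesis by (simp only: zero_le)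
    qed
    have "(\<integral>\<^sup>+x. ?E x \<partial>gauss_borel) =
      (\<integral>\<^sup>+R. ?w R *
         (\<integral>\<^sup>+w. ?E (R *\<^sub>R w) \<partial>sphere_measure) \<partial>lborel)"
      unfolding g_def n_def by (rule nn_integral_gauss_borel_polar) measurable
    also have "\<dots> = (\<integral>\<^sup>+R. (\<integral>\<^sup>+w. ?w R *
         ?E (R *\<^sub>R w) \<partial>sphere_measure) \<partial>lborel)"
      by (intro nn_integral_cong nn_integral_cmult[symmetric]) measurable
    also have "\<dots> = (\<integral>\<^sup>+w. (\<integral>\<^sup>+R. ?w R *
         ?E (R *\<^sub>R w) \<partial>lborel) \<partial>sphere_measure)"
      by (rule LS.Fubini'[symmetric]) measurable
    also have "\<dots> \<le> (\<integral>\<^sup>+w. ennreal g * (ennreal ((1 / \<delta>) powr p) *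
         (\<integral>\<^sup>+t. ennreal (radial_weight n t) * indicator {1..} t * ennreal_powr (F t w) p \<partial>lborel)) \<partial>sphere_measure)"
    proof (rule nn_integral_mono_AE)
      show "AE w in sphere_measure. (\<integral>\<^sup>+R. ?w R *
         ?E (R *\<^sub>R w) \<partial>lborel) \<le> ennreal g * (ennreal ((1 / \<delta>) powr p) *
         (\<integral>\<^sup>+t. ennreal (radial_weight n t) * indicator {1..} t * ennreal_powr (F t w) p \<partial>lborel))"
        using AE_sphere_measure
      proof eventually_elim
        case (elim w)
        have "(\<integral>\<^sup>+R. ?w R *
           ?E (R *\<^sub>R w) \<partial>lborel)
          \<le> (\<integral>\<^sup>+R. ennreal g * ennreal_powr (?J w R) p \<partial>lborel)"
          by (intro nn_integral_mono slice elim)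
        also have "\<dots> = ennreal g * (\<integral>\<^sup>+R. ennreal_powr (?J w R) p \<partial>lborel)"
          by (rule nn_integral_cmult) measurable
        also have "\<dots> \<le> ennreal g * (ennreal ((1 / \<delta>) powr p) * (\<integral>\<^sup>+t. ennreal_powr (H w t) p \<partial>lborel))"
        proof (intro mult_left_mono Schur_test_symmetric)
          show "sigma_finite_measure (lborel :: real measure)" ..
        qed (use \<delta> p k_sym k_int in auto)
        also have "(\<integral>\<^sup>+t. ennreal_powr (H w t) p \<partial>lborel) =
          (\<integral>\<^sup>+t. ennreal (radial_weight n t) * indicator {1..} t * ennreal_powr (F t w) p \<partial>lborel)"
        proof (intro nn_integral_cong)
          fix t :: real
          show "ennreal_powr (H w t) p = ennreal (radial_weight n t) * indicator {1..} t * ennreal_powr (F t w) p"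
          proof (cases "1 \<le> t")
            case True
            then have "0 < radial_weight n t" by (simp add: radial_weight_pos)
            then show ?thesis using True p
              by (simp add: H_def ennreal_powr_mult ennreal_powr_ennreal powr_powr)
          qed (simp add: H_def)
        qed
        finally show ?case .
      qed
    qed
    also have "\<dots> = ennreal g * (ennreal ((1 / \<delta>) powr p) * (\<integral>\<^sup>+w. (\<integral>\<^sup>+t. ennreal (radial_weight n t) * indicator {1..} t * ennreal_powr (F t w) p \<partial>lborel) \<partial>sphere_measure))"
      by (simp add: nn_integral_cmult)
    also have "(\<integral>\<^sup>+w. (\<integral>\<^sup>+t. ennreal (radial_weight n t) * indicator {1..} t * ennreal_powr (F t w) p \<partial>lborel) \<partial>sphere_measure)
      = (\<integral>\<^sup>+t. (\<integral>\<^sup>+w. ennreal (radial_weight n t) * indicator {1..} t * ennreal_powr (F t w) p \<partial>sphere_measure) \<partial>lborel)"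
      by (rule LS.Fubini') measurable
    also have "\<dots> \<le> (\<integral>\<^sup>+t. ennreal K' * (ennreal (radial_weight n t) * indicator {0..} t * ?S t) \<partial>lborel)"
    proof (intro nn_integral_mono)
      fix t :: real
      have "(\<integral>\<^sup>+w. ennreal (radial_weight n t) * indicator {1..} t * ennreal_powr (F t w) p \<partial>sphere_measure)
        = ennreal (radial_weight n t) * indicator {1..} t * (\<integral>\<^sup>+w. ennreal_powr (F t w) p \<partial>sphere_measure)"
        by (rule nn_integral_cmult) measurable
      also have "\<dots> \<le> ennreal (radial_weight n t) * indicator {0..} t * (ennreal K' * ?S t)"
      proof (intro mult_mono)
        show "(\<integral>\<^sup>+w. ennreal_powr (F t w) p \<partial>sphere_measure) \<le> ennreal K' * ?S t"
          unfolding F_def K'_def by (rule ball_maximal_strong_type[OF S.finite_measure_axioms _ D _ p]) auto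
      qed (auto simp: indicator_def)
      finally show "(\<integral>\<^sup>+w. ennreal (radial_weight n t) * indicator {1..} t * ennreal_powr (F t w) p \<partial>sphere_measure)
        \<le> ennreal K' * (ennreal (radial_weight n t) * indicator {0..} t * ?S t)"
        by (simp only: mult_ac)
    qed
    also have "\<dots> = ennreal K' * (\<integral>\<^sup>+t. ennreal (radial_weight n t) * indicator {0..} t * ?S t \<partial>lborel)"
      by (rule nn_integral_cmult) measurable
    also have "ennreal g * (ennreal ((1 / \<delta>) powr p) * (ennreal K' * (\<integral>\<^sup>+t. ennreal (radial_weight n t) * indicator {0..} t * ?S t \<partial>lborel)))
      = ennreal ((1 / \<delta>) powr p * K') * (ennreal g * (\<integral>\<^sup>+t. ennreal (radial_weight n t) * indicator {0..} t * ?S t \<partial>lborel))"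
      using K' by (simp add: ennreal_mult mult_ac)
    also have "ennreal g * (\<integral>\<^sup>+t. ennreal (radial_weight n t) * indicator {0..} t * ?S t \<partial>lborel)
      = (\<integral>\<^sup>+t. ennreal g * (ennreal (radial_weight n t) * indicator {0..} t * ?S t) \<partial>lborel)"
      by (rule nn_integral_cmult[symmetric]) measurable
    also have "\<dots> = (\<integral>\<^sup>+t. ennreal (g * radial_weight n t) * indicator {0..} t * ?S t \<partial>lborel)"
      using g by (intro nn_integral_cong) (auto simp: indicator_def ennreal_mult radial_weight_def mult.assoc)
    also have "\<dots> = (\<integral>\<^sup>+x. ennreal_powr (h x) p \<partial>gauss_borel)"
      unfolding g_def n_def by (rule nn_integral_gauss_borel_polar[symmetric]) measurable
    finally show ?thesis by (simp add: mult_left_mono)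
  qed
  moreover have "0 < (1 / \<delta>) powr p * K'" using K' \<delta> by simp
  ultimately show ?thesis by blast
qed

text \<open>
  Every ball is local, or comes within distance 1 of the origin, or is large and far; the maximal function is
  at most the sum of the three corresponding bounds.
\<close>

theorem gauss_ball_maximal_strong_type:
  assumes p: "1 < p"
  shows "\<exists>C>0. \<forall>h\<in>borel_measurable (borel :: 'a::euclidean_space measure).
    (\<integral>\<^sup>+x. ennreal_powr (ball_maximal UNIV gauss_borel h x) p \<partial>gauss_borel)
      \<le> ennreal C * (\<integral>\<^sup>+x. ennreal_powr (h x) p \<partial>gauss_borel)"
proof -
  interpret G: finite_measure "gauss_borel :: 'a measure" by (rule finite_measure_gauss_borel)
  define m where "m = measure (gauss_borel :: 'a measure) UNIV + 1"
  have m: "0 < m" "emeasure (gauss_borel :: 'a measure) UNIV \<le> ennreal m"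
    by (auto simp: m_def G.emeasure_eq_measure ennreal_leI add_nonneg_pos)
  obtain Q :: "('a \<times> real) set" and K C1 where Q: "countable Q" "doubling_on Q sphere_measure K" "0 < C1"
    and cap: "\<And>e w s k. norm e = 1 \<Longrightarrow> norm w = 1 \<Longrightarrow> w \<in> ball e s \<Longrightarrow> k \<in> borel_measurable borel \<Longrightarrow>
      (\<integral>\<^sup>+z\<in>ball e s. k z \<partial>sphere_measure) \<le> ennreal (C1 * s ^ (DIM('a) - 1)) * ball_maximal Q sphere_measure k w"
    using countable_cap_family[where 'a='a] by metis
  obtain K1 where K1: "doubling_on (local_balls :: ('a \<times> real) set) gauss_borel K1"
    using doubling_on_local_balls by blast
  define L1 where "L1 = 2 powr p * K1 * p / (p - 1)"
  have L1: "0 < L1" using K1 p by (simp add: L1_def doubling_on_def)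
  obtain C2 where C2: "0 < C2" "\<And>(c::'a) r h. norm c - r < 1 \<Longrightarrow> 1 < r * (1 + norm c) \<Longrightarrow> 0 < r \<Longrightarrow>
     (\<integral>\<^sup>+y\<in>ball c r. h y \<partial>gauss_borel) / emeasure gauss_borel (ball c r) \<le> ennreal C2 * (\<integral>\<^sup>+y. h y \<partial>gauss_borel)"
    using central_ball_average_le[where 'a='a] by metis
  have "\<exists>C>0. \<forall>h\<in>borel_measurable borel. \<forall>c r x. x \<in> ball c r \<longrightarrow> 1 \<le> norm c - r \<longrightarrow> 1 < r * (1 + norm c) \<longrightarrow>
     (\<integral>\<^sup>+y\<in>ball c r. h y \<partial>gauss_borel) / emeasure gauss_borel (ball c r) \<le> ennreal C * exterior_operator Q p h x"
    by (rule far_ball_average_le[OF Q(1) p Q(3)]) (rule cap)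
  then obtain C3 where C3: "0 < C3" and C3': "\<forall>h\<in>borel_measurable borel. \<forall>c r x. x \<in> ball c r \<longrightarrow> 1 \<le> norm c - r \<longrightarrow> 1 < r * (1 + norm c) \<longrightarrow>
     (\<integral>\<^sup>+y\<in>ball c r. h y \<partial>gauss_borel) / emeasure gauss_borel (ball c r) \<le> ennreal C3 * exterior_operator Q p h x"
    by blast
  note far = C3'[rule_format]
  obtain C4 where C4: "0 < C4" "\<And>h :: 'a \<Rightarrow> ennreal. h \<in> borel_measurable borel \<Longrightarrow>
    (\<integral>\<^sup>+x. ennreal_powr (exterior_operator Q p h x) p \<partial>gauss_borel)
      \<le> ennreal C4 * (\<integral>\<^sup>+x. ennreal_powr (h x) p \<partial>gauss_borel)"
    using exterior_operator_strong_type[OF Q(1,2) p] by metis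
  define C where "C = 2 powr p * (L1 + 2 powr p * (C2 powr p * m powr p + C3 powr p * C4))"
  have "0 < C" unfolding C_def using L1 C2 C3 C4 m by (intro mult_pos_pos add_pos_pos) auto
  moreover have "(\<integral>\<^sup>+x. ennreal_powr (ball_maximal UNIV gauss_borel h x) p \<partial>gauss_borel)
      \<le> ennreal C * (\<integral>\<^sup>+x. ennreal_powr (h x) p \<partial>gauss_borel)"
    if h [measurable]: "h \<in> borel_measurable borel" for h :: "'a \<Rightarrow> ennreal"
  proof -
    note borel_measurable_exterior_operator[OF h Q(1), measurable]
    define I where "I = (\<integral>\<^sup>+x. ennreal_powr (h x) p \<partial>gauss_borel)"
    define A where "A = (\<integral>\<^sup>+x. h x \<partial>gauss_borel)"
    have dom: "ball_maximal UNIV gauss_borel h x \<le> ball_maximal local_balls gauss_borel h x +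
        (ennreal C2 * A + ennreal C3 * exterior_operator Q p h x)" for x
      unfolding ball_maximal_def[of UNIV]
    proof (intro SUP_least, clarify)
      fix c :: 'a and r :: real
      let ?avg = "(\<integral>\<^sup>+y\<in>ball c r. h y \<partial>gauss_borel) / emeasure gauss_borel (ball c r)"
      show "indicator (ball c r) x * ?avg \<le> ball_maximal local_balls gauss_borel h x +
        (ennreal C2 * A + ennreal C3 * exterior_operator Q p h x)"
      proof (cases "x \<in> ball c r")
        case True
        then have r: "0 < r" by (metis ball_empty empty_iff not_le)
        consider "(c, r) \<in> local_balls" | "1 < r * (1 + norm c)" "norm c - r < 1" | "1 < r * (1 + norm c)" "1 \<le> norm c - r"
          using r by (force simp: local_balls_def)
        then have "?avg \<le> ball_maximal local_balls gauss_borel h x +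
          (ennreal C2 * A + ennreal C3 * exterior_operator Q p h x)"
        proof cases
          case 1
          then show ?thesis
            using ball_average_le_ball_maximal[OF 1 True, where h = h and M = gauss_borel] by (simp add: add_increasing2)
        next
          case 2
          then show ?thesis
            using C2(2)[OF 2(2,1) r, of h] unfolding A_def by (intro add_increasing add_increasing2) auto
        next
          case 3
          then show ?thesis
            using far[OF h True 3(2,1)] by (intro add_increasing) auto
        qed
        with True show ?thesis by (simp del: mem_ball)
      qed (simp del: mem_ball)
    qed
    let ?m = "emeasure (gauss_borel :: 'a measure) UNIV"
    let ?M = "\<lambda>x. ennreal_powr (ball_maximal UNIV gauss_borel h x) p"
    let ?L = "\<lambda>x. ennreal_powr (ball_maximal local_balls gauss_borel h x) p"
    let ?E = "\<lambda>x. ennreal_powr (exterior_operator Q p h x) p"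
    have A: "ennreal_powr (ennreal C2 * A) p * ?m \<le> ennreal (C2 powr p * m powr p) * I"
    proof -
      have "ennreal_powr (ennreal C2 * A) p * ?m
        = ennreal (C2 powr p) * ennreal_powr A p * ?m"
        using p C2 by (simp add: ennreal_powr_mult ennreal_powr_ennreal)
      also have "\<dots> \<le> ennreal (C2 powr p) * (ennreal (m powr (p - 1)) * I) * ennreal m"
        unfolding A_def I_def using p m by (intro mult_mono nn_integral_Jensen_powr) auto
      also have "\<dots> = ennreal (C2 powr p * (m powr (p - 1) * m powr 1)) * I"
        using m by (simp add: ennreal_mult mult_ac)
      also have "m powr (p - 1) * m powr 1 = m powr p" by (simp only: powr_add[symmetric] diff_add_cancel)
      finally show ?thesis .
    qed
    have "(\<integral>\<^sup>+x. ?M x \<partial>gauss_borel)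
      \<le> (\<integral>\<^sup>+x. ennreal (2 powr p) * (?L x +
        ennreal (2 powr p) * (ennreal_powr (ennreal C2 * A) p + ennreal (C3 powr p) * ?E x)) \<partial>gauss_borel)"
    proof (intro nn_integral_mono)
      fix x
      have "?M x \<le> ennreal_powr (ball_maximal local_balls gauss_borel h x +
        (ennreal C2 * A + ennreal C3 * exterior_operator Q p h x)) p"
        using p by (intro ennreal_powr_mono dom) auto
      also have "\<dots> \<le> ennreal (2 powr p) * (?L x +
         ennreal_powr (ennreal C2 * A + ennreal C3 * exterior_operator Q p h x) p)"
        using p by (intro ennreal_powr_sum_le) auto
      also have "\<dots> \<le> ennreal (2 powr p) * (?L x +
         ennreal (2 powr p) * (ennreal_powr (ennreal C2 * A) p + ennreal_powr (ennreal C3 * exterior_operator Q p h x) p))"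
        using p by (intro mult_left_mono add_left_mono ennreal_powr_sum_le) auto
      also have "ennreal_powr (ennreal C3 * exterior_operator Q p h x) p = ennreal (C3 powr p) * ?E x"
        using p C3 by (simp add: ennreal_powr_mult ennreal_powr_ennreal)
      finally show "?M x \<le>
        ennreal (2 powr p) * (?L x +
        ennreal (2 powr p) * (ennreal_powr (ennreal C2 * A) p + ennreal (C3 powr p) * ?E x))" .
    qed
    also have "\<dots> = ennreal (2 powr p) * ((\<integral>\<^sup>+x. ?L x \<partial>gauss_borel) +
        ennreal (2 powr p) * (ennreal_powr (ennreal C2 * A) p * ?m +
        ennreal (C3 powr p) * (\<integral>\<^sup>+x. ?E x \<partial>gauss_borel)))"
      by (simp add: nn_integral_cmult nn_integral_add)
    also have "\<dots> \<le> ennreal (2 powr p) * (ennreal L1 * I +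
        ennreal (2 powr p) * (ennreal (C2 powr p * m powr p) * I + ennreal (C3 powr p) * (ennreal C4 * I)))"
      unfolding I_def L1_def using A C4(2)[OF h]
      by (intro mult_left_mono add_mono ball_maximal_strong_type[OF G.finite_measure_axioms _ K1 h p])
         (auto simp: I_def)
    also have "\<dots> = ennreal C * I"
      using L1 C2 C3 C4 m by (simp add: C_def ennreal_mult ennreal_plus distrib_left distrib_right mult_ac)
    finally show ?thesis by (simp add: I_def)
  qed
  ultimately show ?thesis by blast
qed

section \<open>Variable exponents\<close>

lemma LH0_continuous:
  fixes p :: "'a::euclidean_space \<Rightarrow> real"
  assumes "LH0 p"
  shows "continuous_on UNIV p"
proof -
  obtain C where C: "0 < C" "\<And>x y. 0 < norm (x - y) \<Longrightarrow> norm (x - y) < 1 / 2 \<Longrightarrow> \<bar>p x - p y\<bar> \<le> C / (- ln (norm (x - y)))"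
    using assms unfolding LH0_def by blast
  have "isCont p x" for x
    unfolding continuous_at_eps_delta
  proof (intro allI impI)
    fix \<epsilon> :: real assume \<epsilon>: "0 < \<epsilon>"
    define d where "d = min (1 / 2) (exp (- (C / \<epsilon>)))"
    have "\<bar>p y - p x\<bar> < \<epsilon>" if "norm (y - x) < d" for y
    proof (cases "y = x")
      case False
      then have n: "0 < norm (y - x)" by simp
      have "ln (norm (y - x)) < ln (exp (- (C / \<epsilon>)))"
        using n that by (subst ln_less_cancel_iff) (auto simp: d_def)
      then have l: "C / \<epsilon> < - ln (norm (y - x))" by simp
      have Ce: "0 < C / \<epsilon>" using C \<epsilon> by simp
      have "\<bar>p y - p x\<bar> \<le> C / (- ln (norm (y - x)))" using C(2)[of y x] n that by (simp add: d_def)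
      also have "\<dots> < C / (C / \<epsilon>)"
        by (rule divide_strict_left_mono[OF l C(1) mult_pos_pos[OF order_less_trans[OF Ce l] Ce]])
      finally show ?thesis using C by simp
    qed (use \<epsilon> in simp)
    moreover have "0 < d" by (simp add: d_def)
    ultimately show "\<exists>d>0. \<forall>y. dist y x < d \<longrightarrow> dist (p y) (p x) < \<epsilon>"
      by (auto simp: dist_norm)
  qed
  then show ?thesis by (simp add: continuous_at_imp_continuous_on)
qed

text \<open>
  The set where the continuous function \<open>p\<close> falls below a number smaller than its essential infimum is
  open and null, hence empty.
\<close>

lemma continuous_exponent_bounded_below:
  fixes p :: "'a::euclidean_space \<Rightarrow> real"
  assumes c: "continuous_on UNIV p" and m: "1 < exponent_minus p"
  shows "\<exists>p0>1. \<forall>x. p0 \<le> p x"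
proof -
  obtain p0 :: real where p0: "1 < ereal p0" "ereal p0 < exponent_minus p"
    using ereal_dense2[OF m] by blast
  have "AE x in lebesgue. - ereal (p x) \<le> - exponent_minus p"
    using esssup_AE[where M = lebesgue and f = "\<lambda>x. - ereal (p x)"] by (simp add: exponent_minus_def)
  then have ae: "AE x in lebesgue. \<not> p x < p0"
  proof eventually_elim
    case (elim x)
    then have "exponent_minus p \<le> ereal (p x)" by (simp only: ereal_minus_le_minus)
    then have "ereal p0 < ereal (p x)" by (rule order_less_le_trans[OF p0(2)])
    then show ?case by simp
  qed
  have "open {x. p x < p0}"
    using c by (intro open_Collect_less) auto
  moreover have "negligible {x. p x < p0}"
  proof -
    have "{x. p x < p0} \<in> sets lebesgue" using \<open>open {x. p x < p0}\<close> by (simp add: borel_open)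
    then have "{x. p x < p0} \<in> null_sets lebesgue"
      using ae AE_iff_null_sets[of "{x. p x < p0}" lebesgue] by simp
    then show ?thesis by (simp add: negligible_iff_null_sets)
  qed
  ultimately have "{x. p x < p0} = {}"
    using open_not_negligible by blast
  then show ?thesis using p0 by (intro exI[of _ p0]) (auto simp: not_less[symmetric])
qed

text \<open>
  With \<open>s = min r 1\<close> and \<open>a\<close> the distance of the ball from the origin, the logarithm is at most a constant
  plus \<open>- DIM('a) * ln s + 2 * a\<^sup>2\<close>. The oscillation of \<open>p\<close> compensates the first term by the log-Hoelder
  condition and the second by the decay at infinity.
\<close>

lemma oscillation_log_measure_bound:
  fixes p :: "'a::euclidean_space \<Rightarrow> real"
  assumes "exponent p" "LH0 p" "P_gauss_infty p" and A: "0 < A"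
  shows "\<exists>C>0. \<forall>c r x y. x \<in> ball c r \<longrightarrow> y \<in> ball c r \<longrightarrow>
    \<bar>p x - p y\<bar> * ln (A / measure gauss_borel (ball c r)) \<le> C"
proof -
  interpret G: finite_measure "gauss_borel :: 'a measure" by (rule finite_measure_gauss_borel)
  define g where "g = pi powr (- (real DIM('a) / 2)) * unit_ball_vol (real DIM('a))"
  have g: "0 < g" by (simp add: g_def)
  obtain P where P: "\<And>x. \<bar>p x\<bar> \<le> P"
    using assms(1) unfolding exponent_def bounded_iff by auto
  then have P0: "0 \<le> P" using abs_ge_zero order_trans by blast
  obtain C1 where C1: "0 < C1" "\<And>x y. 0 < norm (x - y) \<Longrightarrow> norm (x - y) < 1 / 2 \<Longrightarrow> \<bar>p x - p y\<bar> \<le> C1 / (- ln (norm (x - y)))"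
    using assms(2) unfolding LH0_def by blast
  obtain C2 q where C2: "0 < C2" "\<And>x. x \<noteq> 0 \<Longrightarrow> \<bar>p x - q\<bar> \<le> C2 / (norm x)\<^sup>2"
    using assms(3) unfolding P_gauss_infty_def by blast
  define K where "K = 2 * P * \<bar>ln A - ln g\<bar> + real DIM('a) * (2 * P * ln 8 + 2 * C1) + (4 * C2 + 16 * P) + 1"
  have main: "\<bar>p x - p y\<bar> * ln (A / measure gauss_borel (ball c r)) \<le> K"
    if x: "x \<in> ball c r" and y: "y \<in> ball c r" for x y c r
  proof -
    define D where "D = \<bar>p x - p y\<bar>"
    have D: "0 \<le> D" "D \<le> 2 * P" using P[of x] P[of y] by (auto simp: D_def)
    have r: "0 < r" using x by (metis ball_empty empty_iff not_le)
    define s where "s = min r 1"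
    have s: "0 < s" "s \<le> r" "s \<le> 1" using r by (auto simp: s_def)
    define a where "a = max 0 (norm c - r)"
    have a: "0 \<le> a" by (simp add: a_def)
    define l where "l = g * s ^ DIM('a) * exp (- (a + 2 * s)\<^sup>2)"
    have l0: "0 < l" using g s by (simp add: l_def)
    have "ennreal l \<le> emeasure gauss_borel (ball c r)"
      unfolding l_def g_def a_def by (rule gauss_borel_ball_lower[OF s(1,2)])
    then have l: "l \<le> measure gauss_borel (ball c r)"
      by (simp add: G.emeasure_eq_measure)
    have "ln (A / measure gauss_borel (ball c r)) \<le> ln (A / l)"
      using l l0 A by (subst ln_le_cancel_iff) (auto intro!: divide_left_mono mult_pos_pos divide_pos_pos)
    also have "\<dots> = (ln A - ln g) + real DIM('a) * (- ln s) + (a + 2 * s)\<^sup>2"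
      using A g s l0 by (simp add: l_def ln_div ln_mult ln_realpow)
    also have "\<dots> \<le> \<bar>ln A - ln g\<bar> + real DIM('a) * (- ln s) + (2 * a\<^sup>2 + 8)"
    proof -
      have "0 \<le> (a - 2 * s)\<^sup>2" by simp
      moreover have "s\<^sup>2 \<le> 1" using s by (simp add: power_le_one)
      ultimately have "(a + 2 * s)\<^sup>2 \<le> 2 * a\<^sup>2 + 8"
        by (simp add: power2_eq_square algebra_simps)
      then show ?thesis by simp
    qed
    finally have ln: "ln (A / measure gauss_borel (ball c r)) \<le> \<bar>ln A - ln g\<bar> + real DIM('a) * (- ln s) + (2 * a\<^sup>2 + 8)" .
    have t1: "D * \<bar>ln A - ln g\<bar> \<le> 2 * P * \<bar>ln A - ln g\<bar>"
      using D by (intro mult_right_mono) auto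
    have t2: "D * (- ln s) \<le> 2 * P * ln 8 + 2 * C1"
    proof (cases "r < 1 / 8")
      case False
      have "ln (1 / 8) \<le> ln s" using False s by (subst ln_le_cancel_iff) (auto simp: s_def)
      then have "- ln s \<le> ln 8" by (simp add: ln_div)
      moreover have "0 \<le> - ln s" using s by simp
      ultimately have "D * (- ln s) \<le> 2 * P * ln 8" using D by (intro mult_mono) auto
      then show ?thesis using C1 by simp
    next
      case True
      then have sr: "s = r" by (simp add: s_def)
      show ?thesis
      proof (cases "x = y")
        case True
        then show ?thesis using C1 P0 by (simp add: D_def)
      next
        case False
        define u where "u = norm (x - y)"
        have "dist x y < 2 * r" using dist_triangle2[of x y c] x y by (simp add: dist_commute)
        then have u: "0 < u" "u < 2 * r" using False by (auto simp: u_def dist_norm)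
        have lu: "ln u \<le> ln (2 * r)" using u r by (subst ln_le_cancel_iff) auto
        have "ln r \<le> ln (1 / 8)" using r True by (subst ln_le_cancel_iff) auto
        moreover have "ln (8::real) = 3 * ln 2"
          using ln_realpow[of 2 3] by simp
        moreover have "0 < ln (2::real)" by simp
        ultimately have lr: "ln r \<le> - 3 * ln 2" by (simp add: ln_div)
        have "ln (2 * r) = ln 2 + ln r" using r by (simp add: ln_mult)
        then have lu2: "- ln r \<le> 2 * (- ln u)" and lu3: "0 < - ln u"
          using lu lr \<open>0 < ln 2\<close> by linarith+
        have "D \<le> C1 / (- ln u)" unfolding D_def u_def using C1(2)[of x y] u True by (simp add: u_def)
        then have "D * (- ln u) \<le> C1" by (simp only: pos_le_divide_eq[OF lu3])
        moreover have "D * (- ln r) \<le> D * (2 * (- ln u))" using lu2 D by (intro mult_left_mono) auto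
        ultimately have "D * (- ln r) \<le> 2 * C1" by simp
        moreover have "0 \<le> 2 * P * ln 8" using P0 by simp
        ultimately show ?thesis unfolding sr by linarith
      qed
    qed
    have t3: "D * (2 * a\<^sup>2 + 8) \<le> 4 * C2 + 16 * P"
    proof -
      have "D * a\<^sup>2 \<le> 2 * C2"
      proof (cases "a = 0")
        case True
        then show ?thesis using C2 by simp
      next
        case False
        then have a0: "0 < a" using a by simp
        have nz: "\<bar>p z - q\<bar> \<le> C2 / a\<^sup>2" if z: "z \<in> ball c r" for z
        proof -
          have "norm c \<le> norm z + norm (c - z)"
            using norm_triangle_ineq[of z "c - z"] by simp
          then have az: "a \<le> norm z" using z a0 by (auto simp: a_def dist_norm max_def split: if_splits)
          then have "\<bar>p z - q\<bar> \<le> C2 / (norm z)\<^sup>2" using a0 by (intro C2) auto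
          also have "\<dots> \<le> C2 / a\<^sup>2" using az a0 C2(1) by (intro divide_left_mono power_mono mult_pos_pos zero_less_power) auto
          finally show ?thesis .
        qed
        have "D \<le> 2 * (C2 / a\<^sup>2)" using nz[OF x] nz[OF y] by (auto simp: D_def abs_le_iff)
        then show ?thesis using a0 by (simp add: pos_le_divide_eq)
      qed
      then show ?thesis using D by (simp add: algebra_simps)
    qed
    have "D * ln (A / measure gauss_borel (ball c r)) \<le> D * (\<bar>ln A - ln g\<bar> + real DIM('a) * (- ln s) + (2 * a\<^sup>2 + 8))"
      using ln D by (intro mult_left_mono) auto
    also have "\<dots> = D * \<bar>ln A - ln g\<bar> + real DIM('a) * (D * (- ln s)) + D * (2 * a\<^sup>2 + 8)"
      by (simp add: algebra_simps)
    also have "\<dots> \<le> 2 * P * \<bar>ln A - ln g\<bar> + real DIM('a) * (2 * P * ln 8 + 2 * C1) + (4 * C2 + 16 * P)"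
      by (intro add_mono t1 t3 mult_left_mono t2) auto
    finally show ?thesis by (simp add: K_def D_def)
  qed
  have "0 < K"
    unfolding K_def using P0 C1 C2 by (intro add_nonneg_pos add_nonneg_nonneg) auto
  then show ?thesis using main by blast
qed

text \<open>
  The constant power \<open>\<alpha>\<close> is at most \<open>q y = p y / p0\<close> on the whole ball, so Jensen's inequality bounds the average
  to the power \<open>\<alpha>\<close> by the average \<open>Y\<close> of \<open>h powr q + 1\<close>. Passing from \<open>\<alpha>\<close> to \<open>q x\<close> costs
  a factor \<open>Y powr \<eta>\<close>, where \<open>\<eta>\<close> bounds the oscillation of \<open>q\<close>. This is bounded because
  \<open>Y\<close> is at most a constant over the measure of the ball.
\<close>

lemma average_powr_variable_exponent:
  fixes p :: "'a::euclidean_space \<Rightarrow> real"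
  assumes p: "exponent p" "LH0 p" "P_gauss_infty p" and p0: "1 < p0" "\<And>x. p0 \<le> p x"
  shows "\<exists>C>0. \<forall>h\<in>borel_measurable borel. (\<integral>\<^sup>+x. ennreal_powr (h x) (p x) \<partial>gauss_borel) \<le> 1 \<longrightarrow>
    (\<forall>c r x. x \<in> ball c r \<longrightarrow>
      ennreal_powr ((\<integral>\<^sup>+y\<in>ball c r. h y \<partial>gauss_borel) / emeasure gauss_borel (ball c r)) (p x)
      \<le> ennreal C * ennreal_powr ((\<integral>\<^sup>+y\<in>ball c r. (ennreal_powr (h y) (p y / p0) + 1) \<partial>gauss_borel) /
            emeasure gauss_borel (ball c r)) p0)"
proof -
  interpret G: finite_measure "gauss_borel :: 'a measure" by (rule finite_measure_gauss_borel)
  have [measurable]: "p \<in> borel_measurable borel"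
    using LH0_continuous[OF p(2)] by (rule borel_measurable_continuous_onI)
  define m0 where "m0 = measure (gauss_borel :: 'a measure) UNIV"
  have m0: "0 \<le> m0" by (simp add: m0_def)
  \<comment> \<open>An upper bound for the integral of \<open>h powr q + 1\<close>; it is also above \<open>m0\<close>, which makes the logarithms below positive.\<close>
  define A where "A = 1 + 2 * m0"
  have A: "0 < A" using m0 by (simp add: A_def)
  obtain C where C: "0 < C" "\<And>c r x y. x \<in> ball c r \<Longrightarrow> y \<in> ball c r \<Longrightarrow>
    \<bar>p x - p y\<bar> * ln (A / measure gauss_borel (ball c r)) \<le> C"
    using oscillation_log_measure_bound[OF p A] by blast
  have "ennreal_powr ((\<integral>\<^sup>+y\<in>ball c r. h y \<partial>gauss_borel) / emeasure gauss_borel (ball c r)) (p x)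
      \<le> ennreal (exp C) * ennreal_powr ((\<integral>\<^sup>+y\<in>ball c r. (ennreal_powr (h y) (p y / p0) + 1) \<partial>gauss_borel) /
            emeasure gauss_borel (ball c r)) p0"
    if h [measurable]: "h \<in> borel_measurable borel" and h1: "(\<integral>\<^sup>+x. ennreal_powr (h x) (p x) \<partial>gauss_borel) \<le> 1"
      and x: "x \<in> ball c r" for h c r x
  proof -
    define m where "m = measure gauss_borel (ball c r)"
    have em: "emeasure gauss_borel (ball c r) = ennreal m"
      by (simp add: m_def G.emeasure_eq_measure)
    have r: "0 < r" using x by (metis ball_empty empty_iff not_le)
    have "0 < m"
    proof -
      have "0 < pi powr (- (real DIM('a) / 2)) * unit_ball_vol (real DIM('a)) * r ^ DIM('a) *
         exp (- (max 0 (norm c - r) + 2 * r)\<^sup>2)" using r by simp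
      then have "0 < emeasure gauss_borel (ball c r)"
        using gauss_borel_ball_lower[OF r order_refl, of c] by (metis ennreal_less_zero_iff order_less_le_trans)
      then show ?thesis by (simp add: em)
    qed
    have "m \<le> m0" unfolding m_def m0_def by (intro G.finite_measure_mono) auto
    then have Am: "1 < A / m" using \<open>0 < m\<close> by (simp add: A_def)
    define lA where "lA = ln (A / m)"
    have lA: "0 < lA" using Am by (simp add: lA_def)
    define \<eta> where "\<eta> = C / (p0 * lA)"
    have \<eta>: "0 < \<eta>" using C p0 lA by (simp add: \<eta>_def)
    define q where "q y = p y / p0" for y
    have q1: "1 \<le> q y" for y using p0 by (simp add: q_def)
    have [measurable]: "q \<in> borel_measurable borel" unfolding q_def by measurable
    \<comment> \<open>A lower bound for \<open>q\<close> on the ball, kept at least 1 for Jensen.\<close>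
    define \<alpha> where "\<alpha> = max 1 (q x - \<eta>)"
    have \<alpha>: "1 \<le> \<alpha>" "\<alpha> \<le> q x" "q x - \<alpha> \<le> \<eta>" using q1[of x] \<eta> by (auto simp: \<alpha>_def)
    have \<alpha>q: "\<alpha> \<le> q y" if y: "y \<in> ball c r" for y
    proof -
      have "\<bar>p x - p y\<bar> \<le> C / lA"
        using C(2)[OF x y] lA by (simp add: lA_def m_def pos_le_divide_eq)
      then have "(p x - p y) / p0 \<le> C / lA / p0"
        using p0 by (intro divide_right_mono) auto
      then have "q x - q y \<le> \<eta>" by (simp add: q_def \<eta>_def diff_divide_distrib mult.commute)
      then show ?thesis using q1[of y] by (simp add: \<alpha>_def)
    qed
    define I where "I = (\<integral>\<^sup>+y\<in>ball c r. (ennreal_powr (h y) (q y) + 1) \<partial>gauss_borel)"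
    define avg where "avg = (\<integral>\<^sup>+y\<in>ball c r. h y \<partial>gauss_borel) / ennreal m"
    have split: "ennreal_powr z s \<le> ennreal_powr z t + 1" if "1 \<le> s" "s \<le> t" for z :: ennreal and s t
    proof (cases "1 \<le> z")
      case True
      then show ?thesis using ennreal_powr_mono_exponent[OF True that(2)] by (simp add: add_increasing2)
    next
      case False
      then have "ennreal_powr z s \<le> ennreal_powr 1 s" using that by (intro ennreal_powr_mono) auto
      then show ?thesis by (simp add: add_increasing)
    qed
    have jensen: "ennreal_powr avg \<alpha> \<le> I / ennreal m"
    proof -
      let ?N = "density gauss_borel (indicator (ball c r))"
      let ?J = "\<integral>\<^sup>+y\<in>ball c r. h y \<partial>gauss_borel"
      have dens: "(\<integral>\<^sup>+y. f y \<partial>?N) = (\<integral>\<^sup>+y\<in>ball c r. f y \<partial>gauss_borel)"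
        if [measurable]: "f \<in> borel_measurable borel" for f :: "'a \<Rightarrow> ennreal"
        by (subst nn_integral_density) (auto simp: mult.commute)
      have "ennreal_powr (\<integral>\<^sup>+y. h y \<partial>?N) \<alpha> \<le>
         ennreal (m powr (\<alpha> - 1)) * (\<integral>\<^sup>+y. ennreal_powr (h y) \<alpha> \<partial>?N)"
      proof (rule nn_integral_Jensen_powr[OF _ \<alpha>(1) \<open>0 < m\<close>])
        show "emeasure (?N) (space (?N)) \<le> ennreal m"
          by (simp add: emeasure_density em[symmetric])
      qed measurable
      then have 1: "ennreal_powr ?J \<alpha> \<le>
         ennreal (m powr (\<alpha> - 1)) * (\<integral>\<^sup>+y\<in>ball c r. ennreal_powr (h y) \<alpha> \<partial>gauss_borel)"
        by (simp add: dens)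
      also have "\<dots> \<le> ennreal (m powr (\<alpha> - 1)) * I"
        unfolding I_def using split[OF \<alpha>(1) \<alpha>q]
        by (intro mult_left_mono nn_integral_mono) (auto simp: indicator_def)
      finally have 2: "ennreal_powr ?J \<alpha> \<le> ennreal (m powr (\<alpha> - 1)) * I" .
      have "avg = ennreal (1 / m) * ?J"
        using \<open>0 < m\<close> by (simp add: avg_def divide_ennreal_def inverse_ennreal inverse_eq_divide mult.commute)
      then have "ennreal_powr avg \<alpha> = ennreal ((1 / m) powr \<alpha>) * ennreal_powr ?J \<alpha>"
        using \<alpha> \<open>0 < m\<close> by (simp add: ennreal_powr_mult ennreal_powr_ennreal)
      also have "\<dots> \<le> ennreal ((1 / m) powr \<alpha>) * (ennreal (m powr (\<alpha> - 1)) * I)"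
        by (intro mult_left_mono 2) simp
      also have "\<dots> = ennreal ((1 / m) powr \<alpha> * m powr (\<alpha> - 1)) * I"
        by (simp add: ennreal_mult mult.assoc)
      also have "(1 / m) powr \<alpha> * m powr (\<alpha> - 1) = 1 / m"
        using \<open>0 < m\<close> by (simp add: powr_divide powr_diff)
      also have "ennreal (1 / m) * I = I / ennreal m"
        using \<open>0 < m\<close> by (simp add: divide_ennreal_def inverse_ennreal inverse_eq_divide mult.commute)
      finally show ?thesis .
    qed
    have IA: "I \<le> ennreal A"
    proof -
      have "I \<le> (\<integral>\<^sup>+y. ennreal_powr (h y) (p y) + 2 \<partial>gauss_borel)"
        unfolding I_def
      proof (intro nn_integral_mono)
        fix y
        have "q y \<le> p y" using p0(1) p0(2)[of y] by (simp add: q_def field_simps)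
        then have "ennreal_powr (h y) (q y) + 1 \<le> (ennreal_powr (h y) (p y) + 1) + 1"
          by (intro add_right_mono split q1)
        then have "ennreal_powr (h y) (q y) + 1 \<le> ennreal_powr (h y) (p y) + 2" by (simp add: add.assoc)
        then show "(ennreal_powr (h y) (q y) + 1) * indicator (ball c r) y \<le> ennreal_powr (h y) (p y) + 2"
          by (auto simp: indicator_def)
      qed
      also have "\<dots> = (\<integral>\<^sup>+y. ennreal_powr (h y) (p y) \<partial>gauss_borel) + 2 * ennreal m0"
        by (subst nn_integral_add) (auto simp: m0_def G.emeasure_eq_measure)
      also have "\<dots> \<le> 1 + 2 * ennreal m0" using h1 by (intro add_right_mono) auto
      also have "\<dots> = ennreal A" using m0 by (simp add: A_def ennreal_mult)
      finally show ?thesis .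
    qed
    have Im: "ennreal m \<le> I"
    proof -
      have "ennreal m = (\<integral>\<^sup>+y\<in>ball c r. 1 \<partial>gauss_borel)" by (simp add: em)
      also have "\<dots> \<le> I" unfolding I_def by (intro nn_integral_mono mult_right_mono) auto
      finally show ?thesis .
    qed
    obtain i where i: "I = ennreal i" "0 \<le> i"
      using IA by (cases I) (auto simp: top_unique)
    have i': "m \<le> i" "i \<le> A" using Im IA i A by (auto simp: ennreal_le_iff)
    define Y where "Y = i / m"
    have Y: "I / ennreal m = ennreal Y" "1 \<le> Y" "Y \<le> A / m"
      using i i' \<open>0 < m\<close> by (auto simp: Y_def divide_ennreal intro: divide_right_mono)
    have "ennreal_powr avg (q x) = ennreal_powr (ennreal_powr avg \<alpha>) (q x / \<alpha>)"
      using \<alpha> by (simp add: ennreal_powr_powr)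
    also have "\<dots> \<le> ennreal_powr (ennreal Y) (q x / \<alpha>)"
      using jensen Y \<alpha> q1[of x] by (intro ennreal_powr_mono) auto
    also have "\<dots> = ennreal (Y powr (q x / \<alpha>))"
      using Y by (simp add: ennreal_powr_ennreal)
    also have "\<dots> \<le> ennreal (Y * exp (C / p0))"
    proof (intro ennreal_leI)
      have "q x / \<alpha> \<le> 1 + \<eta>"
      proof -
        have "q x \<le> \<alpha> + \<eta> * 1" using \<alpha> by simp
        also have "\<dots> \<le> \<alpha> + \<eta> * \<alpha>" using \<alpha> \<eta> by (intro add_left_mono mult_left_mono) auto
        finally show ?thesis using \<alpha> by (simp add: pos_divide_le_eq algebra_simps)
      qed
      then have "Y powr (q x / \<alpha>) \<le> Y powr (1 + \<eta>)" using Y by (intro powr_mono) auto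
      also have "\<dots> = Y * Y powr \<eta>" using Y by (simp add: powr_add)
      also have "\<dots> \<le> Y * (A / m) powr \<eta>" using Y \<eta> by (intro mult_left_mono powr_mono2) auto
      also have "(A / m) powr \<eta> = exp (\<eta> * lA)" using \<open>0 < m\<close> A by (simp add: powr_def lA_def)
      also have "\<eta> * lA = C / p0" using lA by (simp add: \<eta>_def)
      finally show "Y powr (q x / \<alpha>) \<le> Y * exp (C / p0)" .
    qed
    finally have "ennreal_powr (ennreal_powr avg (q x)) p0 \<le> ennreal_powr (ennreal (Y * exp (C / p0))) p0"
      using p0 by (intro ennreal_powr_mono) auto
    also have "\<dots> = ennreal ((Y * exp (C / p0)) powr p0)"
      using Y by (intro ennreal_powr_ennreal) auto
    also have "(Y * exp (C / p0)) powr p0 = exp C * Y powr p0"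
      using Y p0 by (simp add: powr_mult exp_powr_real)
    also have "ennreal (exp C * Y powr p0) = ennreal (exp C) * ennreal_powr (ennreal Y) p0"
      using Y by (simp add: ennreal_powr_ennreal ennreal_mult)
    also have "ennreal_powr (ennreal_powr avg (q x)) p0 = ennreal_powr avg (p x)"
      using p0 by (simp add: ennreal_powr_powr q_def)
    finally show ?thesis
      unfolding Y(1)[symmetric] I_def avg_def em q_def .
  qed
  then show ?thesis by (intro exI[of _ "exp C"]) simp
qed

lemma ball_maximal_modular_bound:
  fixes p :: "'a::euclidean_space \<Rightarrow> real"
  assumes p: "exponent p" "LH0 p" "P_gauss_infty p" and p0: "1 < p0" "\<And>x. p0 \<le> p x"
  shows "\<exists>K>0. \<forall>h\<in>borel_measurable borel. (\<integral>\<^sup>+x. ennreal_powr (h x) (p x) \<partial>gauss_borel) \<le> 1 \<longrightarrow>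
    (\<integral>\<^sup>+x. ennreal_powr (ball_maximal UNIV gauss_borel h x) (p x) \<partial>gauss_borel) \<le> ennreal K"
proof -
  interpret G: finite_measure "gauss_borel :: 'a measure" by (rule finite_measure_gauss_borel)
  have [measurable]: "p \<in> borel_measurable borel"
    using LH0_continuous[OF p(2)] by (rule borel_measurable_continuous_onI)
  define m0 where "m0 = measure (gauss_borel :: 'a measure) UNIV"
  have m0: "0 \<le> m0" by (simp add: m0_def)
  obtain C where C: "0 < C" and C': "\<forall>h\<in>borel_measurable borel. (\<integral>\<^sup>+x. ennreal_powr (h x) (p x) \<partial>gauss_borel) \<le> 1 \<longrightarrow>
    (\<forall>c r x. x \<in> ball c r \<longrightarrow>
      ennreal_powr ((\<integral>\<^sup>+y\<in>ball c r. h y \<partial>gauss_borel) / emeasure gauss_borel (ball c r)) (p x)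
      \<le> ennreal C * ennreal_powr ((\<integral>\<^sup>+y\<in>ball c r. (ennreal_powr (h y) (p y / p0) + 1) \<partial>gauss_borel) /
            emeasure gauss_borel (ball c r)) p0)"
    using average_powr_variable_exponent[OF p p0] by blast
  note avg = C'[rule_format]
  obtain L where L: "0 < L" and L': "\<forall>h\<in>borel_measurable (borel :: 'a measure).
    (\<integral>\<^sup>+x. ennreal_powr (ball_maximal UNIV gauss_borel h x) p0 \<partial>gauss_borel)
      \<le> ennreal L * (\<integral>\<^sup>+x. ennreal_powr (h x) p0 \<partial>gauss_borel)"
    using gauss_ball_maximal_strong_type[OF p0(1), where 'a='a] by blast
  define K where "K = C * (L * (2 powr p0 * (1 + m0)))"
  have "(\<integral>\<^sup>+x. ennreal_powr (ball_maximal UNIV gauss_borel h x) (p x) \<partial>gauss_borel) \<le> ennreal K"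
    if h [measurable]: "h \<in> borel_measurable borel" and h1: "(\<integral>\<^sup>+x. ennreal_powr (h x) (p x) \<partial>gauss_borel) \<le> 1" for h
  proof -
    define k where "k y = ennreal_powr (h y) (p y / p0) + 1" for y
    have [measurable]: "k \<in> borel_measurable borel" unfolding k_def by measurable
    have pt: "ennreal_powr (ball_maximal UNIV gauss_borel h x) (p x) \<le>
        ennreal C * ennreal_powr (ball_maximal UNIV gauss_borel k x) p0" for x
    proof -
      have px: "0 < p x" using p0(1) p0(2)[of x] by linarith
      have "ball_maximal UNIV gauss_borel h x \<le>
        ennreal_powr (ennreal C * ennreal_powr (ball_maximal UNIV gauss_borel k x) p0) (1 / p x)"
        unfolding ball_maximal_def[of UNIV gauss_borel h]
      proof (intro SUP_least, clarify)
        fix c r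
        let ?avg = "(\<integral>\<^sup>+y\<in>ball c r. h y \<partial>gauss_borel) / emeasure gauss_borel (ball c r)"
        show "indicator (ball c r) x * ?avg \<le>
          ennreal_powr (ennreal C * ennreal_powr (ball_maximal UNIV gauss_borel k x) p0) (1 / p x)"
        proof (cases "x \<in> ball c r")
          case True
          have "ennreal_powr ?avg (p x) \<le> ennreal C * ennreal_powr ((\<integral>\<^sup>+y\<in>ball c r. k y \<partial>gauss_borel) /
            emeasure gauss_borel (ball c r)) p0"
            unfolding k_def by (rule avg[OF h h1 True])
          also have "\<dots> \<le> ennreal C * ennreal_powr (ball_maximal UNIV gauss_borel k x) p0"
            using p0 True by (intro mult_left_mono ennreal_powr_mono ball_average_le_ball_maximal) auto
          finally show ?thesis
            using True unfolding ennreal_powr_le_iff[OF px] by (simp del: mem_ball)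
        qed (simp del: mem_ball)
      qed
      then show ?thesis unfolding ennreal_powr_le_iff[OF px] .
    qed
    have "(\<integral>\<^sup>+x. ennreal_powr (ball_maximal UNIV gauss_borel h x) (p x) \<partial>gauss_borel) \<le>
      (\<integral>\<^sup>+x. ennreal C * ennreal_powr (ball_maximal UNIV gauss_borel k x) p0 \<partial>gauss_borel)"
      by (intro nn_integral_mono pt)
    also have "\<dots> = ennreal C * (\<integral>\<^sup>+x. ennreal_powr (ball_maximal UNIV gauss_borel k x) p0 \<partial>gauss_borel)"
      by (rule nn_integral_cmult) measurable
    also have "\<dots> \<le> ennreal C * (ennreal L * (\<integral>\<^sup>+x. ennreal_powr (k x) p0 \<partial>gauss_borel))"
      by (intro mult_left_mono L'[rule_format]) auto
    also have "\<dots> \<le> ennreal C * (ennreal L * (\<integral>\<^sup>+x. ennreal (2 powr p0) * (ennreal_powr (h x) (p x) + 1) \<partial>gauss_borel))"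
    proof (intro mult_left_mono nn_integral_mono)
      fix x
      have "ennreal_powr (k x) p0 \<le> ennreal (2 powr p0) * (ennreal_powr (ennreal_powr (h x) (p x / p0)) p0 + ennreal_powr 1 p0)"
        unfolding k_def using p0 by (intro ennreal_powr_sum_le) auto
      then show "ennreal_powr (k x) p0 \<le> ennreal (2 powr p0) * (ennreal_powr (h x) (p x) + 1)"
        using p0 by (simp add: ennreal_powr_powr)
    qed auto
    also have "(\<integral>\<^sup>+x. ennreal (2 powr p0) * (ennreal_powr (h x) (p x) + 1) \<partial>gauss_borel) =
       ennreal (2 powr p0) * ((\<integral>\<^sup>+x. ennreal_powr (h x) (p x) \<partial>gauss_borel) + ennreal m0)"
      by (simp add: nn_integral_cmult nn_integral_add m0_def G.emeasure_eq_measure)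
    also have "ennreal C * (ennreal L * (ennreal (2 powr p0) * ((\<integral>\<^sup>+x. ennreal_powr (h x) (p x) \<partial>gauss_borel) + ennreal m0)))
      \<le> ennreal C * (ennreal L * (ennreal (2 powr p0) * (1 + ennreal m0)))"
      using h1 by (intro mult_left_mono add_right_mono) auto
    also have "\<dots> = ennreal K"
      using C L m0 by (simp add: K_def ennreal_mult flip: ennreal_1 ennreal_plus)
    finally show ?thesis .
  qed
  moreover have "0 < K" unfolding K_def using C L m0 by (intro mult_pos_pos) auto
  ultimately show ?thesis by blast
qed

section \<open>The norm inequality\<close>

lemma nn_integral_gauss:
  fixes h :: "'a::euclidean_space \<Rightarrow> ennreal"
  assumes [measurable]: "h \<in> borel_measurable borel"
  shows "(\<integral>\<^sup>+x. h x \<partial>gauss) = (\<integral>\<^sup>+x. h x \<partial>gauss_borel)"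
proof -
  have h: "h \<in> borel_measurable lebesgue"
    by (rule measurable_completion) simp
  have w: "(\<lambda>x::'a. ennreal (pi powr (- (real DIM('a) / 2)) * exp (- (norm x)\<^sup>2))) \<in> borel_measurable lebesgue"
    by (rule measurable_completion) simp
  have "(\<integral>\<^sup>+x. h x \<partial>gauss) = (\<integral>\<^sup>+x. ennreal (pi powr (- (real DIM('a) / 2)) * exp (- (norm x)\<^sup>2)) * h x \<partial>lebesgue)"
    unfolding gauss_def by (rule nn_integral_density[OF w h])
  also have "\<dots> = (\<integral>\<^sup>+x. h x \<partial>gauss_borel)"
    by (simp only: nn_integral_completion nn_integral_gauss_borel[OF assms])
  finally show ?thesis .
qed

lemma emeasure_gauss_ball: "emeasure gauss (ball c r) = emeasure gauss_borel (ball (c::'a::euclidean_space) r)"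
proof -
  have "ball c r \<in> sets (gauss :: 'a measure)"
    by (simp add: gauss_def)
  then have "emeasure gauss (ball c r) = (\<integral>\<^sup>+x. indicator (ball c r) x \<partial>gauss)"
    by simp
  also have "\<dots> = (\<integral>\<^sup>+x. indicator (ball c r) x \<partial>gauss_borel)"
    by (rule nn_integral_gauss) measurable
  finally show ?thesis by simp
qed

lemma AE_gauss:
  assumes "AE x in (lborel :: 'a::euclidean_space measure). P x"
  shows "AE x in gauss. P x"
proof -
  let ?w = "\<lambda>x::'a. ennreal (pi powr (- (real DIM('a) / 2)) * exp (- (norm x)\<^sup>2))"
  have w: "?w \<in> borel_measurable lebesgue"
    by (rule measurable_completion) simp
  have "AE x in lebesgue. 0 < ?w x \<longrightarrow> P x"
    using AE_completion[OF assms] by (rule eventually_mono) simp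
  then show ?thesis
    unfolding gauss_def AE_density[OF w] .
qed

text \<open>
  A Lebesgue measurable function is replaced by a Borel representative, and the scale \<open>l\<close> of the norm is pulled out.
\<close>

lemma gauss_maximal_le_ball_maximal:
  fixes f f' :: "'a::euclidean_space \<Rightarrow> real"
  assumes [measurable]: "f' \<in> borel_measurable borel" and ae: "AE x in lborel. f x = f' x" and l: "0 < l"
  shows "gauss_maximal f x \<le> ennreal l * ball_maximal UNIV gauss_borel (\<lambda>y. ennreal (\<bar>f' y\<bar> / l)) x"
  unfolding gauss_maximal_def
proof (rule SUP_least, clarify)
  fix c r assume x: "x \<in> ball c r"
  have "(\<integral>\<^sup>+y\<in>ball c r. ennreal \<bar>f y\<bar> \<partial>gauss) = (\<integral>\<^sup>+y\<in>ball c r. ennreal \<bar>f' y\<bar> \<partial>gauss)"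
    using AE_gauss[OF ae] by (intro nn_integral_cong_AE) (auto elim: eventually_mono)
  also have "\<dots> = (\<integral>\<^sup>+y\<in>ball c r. ennreal \<bar>f' y\<bar> \<partial>gauss_borel)"
    by (rule nn_integral_gauss) measurable
  also have "\<dots> = (\<integral>\<^sup>+y. ennreal l * (ennreal (\<bar>f' y\<bar> / l) * indicator (ball c r) y) \<partial>gauss_borel)"
    using l by (intro nn_integral_cong) (simp add: mult.assoc[symmetric] ennreal_mult[symmetric])
  also have "\<dots> = ennreal l * (\<integral>\<^sup>+y\<in>ball c r. ennreal (\<bar>f' y\<bar> / l) \<partial>gauss_borel)"
    by (rule nn_integral_cmult) measurable
  finally have "(\<integral>\<^sup>+y\<in>ball c r. ennreal \<bar>f y\<bar> \<partial>gauss) / emeasure gauss (ball c r) =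
    ennreal l * ((\<integral>\<^sup>+y\<in>ball c r. ennreal (\<bar>f' y\<bar> / l) \<partial>gauss_borel) / emeasure gauss_borel (ball c r))"
    by (simp add: emeasure_gauss_ball ennreal_times_divide)
  also have "\<dots> \<le> ennreal l * ball_maximal UNIV gauss_borel (\<lambda>y. ennreal (\<bar>f' y\<bar> / l)) x"
    using x by (intro mult_left_mono ball_average_le_ball_maximal) auto
  finally show "(\<integral>\<^sup>+y\<in>ball c r. ennreal \<bar>f y\<bar> \<partial>gauss) / emeasure gauss (ball c r) \<le> \<dots>" .
qed

theorem theorem5p14:
  fixes p :: "'a::euclidean_space \<Rightarrow> real"
  assumes "exponent p"
    and "LH0 p"
    and "P_gauss_infty p"
    and "1 < exponent_minus p"
  shows "\<exists>K::real. K > 0 \<and> (\<forall>f\<in>gauss_Lp p.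
    gauss_norm p (gauss_maximal f) \<le> ennreal K * gauss_norm p (\<lambda>x. ennreal \<bar>f x\<bar>))"
proof -
  have c: "continuous_on UNIV p" by (rule LH0_continuous) fact
  then have [measurable]: "p \<in> borel_measurable borel" by (rule borel_measurable_continuous_onI)
  obtain p0 where p0: "1 < p0" "\<And>x. p0 \<le> p x"
    using continuous_exponent_bounded_below[OF c assms(4)] by blast
  have p1: "1 < p x" for x using p0(1) p0(2)[of x] by linarith
  obtain K0 where "0 < K0" and K0: "\<forall>h\<in>borel_measurable borel. (\<integral>\<^sup>+x. ennreal_powr (h x) (p x) \<partial>gauss_borel) \<le> 1 \<longrightarrow>
    (\<integral>\<^sup>+x. ennreal_powr (ball_maximal UNIV gauss_borel h x) (p x) \<partial>gauss_borel) \<le> ennreal K0"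
    using ball_maximal_modular_bound[OF assms(1-3) p0] by blast
  define K where "K = max 1 K0"
  have K: "1 \<le> K" "K0 \<le> K" by (auto simp: K_def)
  have "gauss_norm p (gauss_maximal f) \<le> ennreal K * gauss_norm p (\<lambda>x. ennreal \<bar>f x\<bar>)"
    if f: "f \<in> gauss_Lp p" for f
  proof -
    have "f \<in> borel_measurable lebesgue" using f by (simp add: gauss_Lp_def)
    then obtain f' where f' [measurable]: "f' \<in> borel_measurable borel" and ae: "AE x in lborel. f x = f' x"
      using completion_ex_borel_measurable_real[of f lborel] by auto
    have step: "gauss_norm p (gauss_maximal f) \<le> ennreal (K * l)"
      if l: "0 < l" and mod: "gauss_modular p (\<lambda>x. ennreal \<bar>f x\<bar> / ennreal l) \<le> 1" for l
    proof -
      define h where "h x = ennreal (\<bar>f' x\<bar> / l)" for x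
      have [measurable]: "h \<in> borel_measurable borel" unfolding h_def by measurable
      have "(\<integral>\<^sup>+x. ennreal_powr (h x) (p x) \<partial>gauss_borel) = (\<integral>\<^sup>+x. ennreal_powr (h x) (p x) \<partial>gauss)"
        by (rule nn_integral_gauss[symmetric]) measurable
      also have "\<dots> = gauss_modular p (\<lambda>x. ennreal \<bar>f x\<bar> / ennreal l)"
        unfolding gauss_modular_def h_def using AE_gauss[OF ae] l
        by (intro nn_integral_cong_AE) (auto elim!: eventually_mono simp: divide_ennreal)
      finally have h1: "(\<integral>\<^sup>+x. ennreal_powr (h x) (p x) \<partial>gauss_borel) \<le> 1" using mod by simp
      let ?M = "ball_maximal UNIV gauss_borel h"
      have pt: "ennreal_powr (gauss_maximal f x / ennreal (K * l)) (p x) \<le> ennreal (1 / K) * ennreal_powr (?M x) (p x)" for x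
      proof -
        have "gauss_maximal f x / ennreal (K * l) \<le> (ennreal l * ?M x) / ennreal (K * l)"
          unfolding h_def by (intro divide_right_mono_ennreal gauss_maximal_le_ball_maximal f' ae l)
        also have "\<dots> = (ennreal l * ennreal (1 / (K * l))) * ?M x"
          using l K by (simp add: divide_ennreal_def inverse_ennreal inverse_eq_divide mult_ac)
        also have "ennreal l * ennreal (1 / (K * l)) = ennreal (1 / K)"
          using l K by (simp add: ennreal_mult[symmetric])
        finally have "ennreal_powr (gauss_maximal f x / ennreal (K * l)) (p x) \<le> ennreal_powr (ennreal (1 / K) * ?M x) (p x)"
          using p1[of x] by (intro ennreal_powr_mono) auto
        also have "\<dots> = ennreal ((1 / K) powr p x) * ennreal_powr (?M x) (p x)"
          using p1[of x] K by (subst ennreal_powr_mult) (auto simp: ennreal_powr_ennreal)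
        also have "\<dots> \<le> ennreal (1 / K) * ennreal_powr (?M x) (p x)"
        proof (intro mult_right_mono ennreal_leI)
          have "(1 / K) powr p x \<le> (1 / K) powr 1"
            using K p1[of x] by (intro powr_mono') auto
          then show "(1 / K) powr p x \<le> 1 / K" using K by simp
        qed simp
        finally show ?thesis .
      qed
      have "gauss_modular p (\<lambda>x. gauss_maximal f x / ennreal (K * l)) \<le>
        (\<integral>\<^sup>+x. ennreal (1 / K) * ennreal_powr (?M x) (p x) \<partial>gauss)"
        unfolding gauss_modular_def by (intro nn_integral_mono pt)
      also have "\<dots> = (\<integral>\<^sup>+x. ennreal (1 / K) * ennreal_powr (?M x) (p x) \<partial>gauss_borel)"
        by (rule nn_integral_gauss) measurable
      also have "\<dots> = ennreal (1 / K) * (\<integral>\<^sup>+x. ennreal_powr (?M x) (p x) \<partial>gauss_borel)"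
        by (rule nn_integral_cmult) measurable
      also have "\<dots> \<le> ennreal (1 / K) * ennreal K"
        using K0[rule_format, of h] h1 K by (intro mult_left_mono order_trans[OF _ ennreal_leI[OF K(2)]]) auto
      also have "\<dots> = 1" using K by (simp add: ennreal_mult[symmetric])
      finally have "gauss_modular p (\<lambda>x. gauss_maximal f x / ennreal (K * l)) \<le> 1" .
      then show ?thesis
        unfolding gauss_norm_def using l K by (intro Inf_lower) (auto intro!: exI[of _ "K * l"])
    qed
    have "ennreal (1 / K) * gauss_norm p (gauss_maximal f) \<le> gauss_norm p (\<lambda>x. ennreal \<bar>f x\<bar>)"
      unfolding gauss_norm_def[of p "\<lambda>x. ennreal \<bar>f x\<bar>"]
    proof (rule Inf_greatest, clarify)
      fix l :: real assume l: "0 < l" "gauss_modular p (\<lambda>x. ennreal \<bar>f x\<bar> / ennreal l) \<le> 1"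
      have "ennreal (1 / K) * gauss_norm p (gauss_maximal f) \<le> ennreal (1 / K) * ennreal (K * l)"
        by (intro mult_left_mono step l) simp
      also have "\<dots> = ennreal l" using K l by (simp add: ennreal_mult[symmetric])
      finally show "ennreal (1 / K) * gauss_norm p (gauss_maximal f) \<le> ennreal l" .
    qed
    then have "ennreal K * (ennreal (1 / K) * gauss_norm p (gauss_maximal f)) \<le> ennreal K * gauss_norm p (\<lambda>x. ennreal \<bar>f x\<bar>)"
      by (intro mult_left_mono) auto
    then show ?thesis using K by (simp add: mult.assoc[symmetric] ennreal_mult[symmetric])
  qed
  then show ?thesis using K by (intro exI[of _ K]) auto
qed

end
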